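(* Let $(\mathcal{M},\mathbf{c},K)$ be an $(n+2)$-dimensional conformal optical geometry, where $n>2$, with non-shearing congruence of null geodesics $\mathcal{K}$. Then, for any optical vector field $k$, the Weyl tensor satisfies $$4\,\kappa_{[a}W_{b]ef[c}\kappa_{d]}k^ek^f=\tau_{abe}\tau^e{}_{cd}+\frac4n\,\tau_{[a}{}^{ef}g_{b][c}\tau_{d]ef},$$ where $\kappa_a=g_{ab}k^b$ and $\tau_{abc}:=3\,\kappa_{[a}\nabla_b\kappa_{c]}$.
   Context: A conformal optical geometry is an oriented, time-oriented smooth manifold $\mathcal{M}$ with a conformal structure $\mathbf{c}$ of Lorentzian signature $(+,\ldots,+,-)$ and a real null line distribution $K$; an optical vector field is a nowhere vanishing section $k$ of $K$. The congruence $\mathcal{K}$ of integral curves of $K$ is geodesic if $(\mathcal{L}_k\kappa)(v)=0$ for all $v\in\Gamma(K^\perp)$, and non-shearing if $\mathcal{L}_kg(v,w)\propto g(v,w)$ for all $v,w\in\Gamma(K^\perp)$. In the formula, $g$ denotes the (density-weighted) conformal metric of $\mathbf{c}$, with which indices are raised and lowered; equivalently one may take $g$ to be any metric in $\mathbf{c}$ with Levi-Civita connection $\nabla$ (the formula is conformally invariant). Conventions: $2\nabla_{[a}\nabla_{b]}V^c=R_{ab}{}^c{}_dV^d$, $\mathrm{Ric}_{ab}=R_{ca}{}^c{}_b$, and $W_{abcd}$ is the tracefree part of $R_{abcd}$. Square brackets denote skew-symmetrisation with weight one (e.g. $\lambda_{[ab]}=\frac12(\lambda_{ab}-\lambda_{ba})$).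 *)

theory Defs
  imports "HOL-Analysis.Analysis"
begin

text \<open>
  Tensor fields on a manifold are treated classically: a field is a family of component
  functions, one for each chart of the atlas and defined on the coordinate range of that chart,
  which are smooth and related by the tensorial transformation law under changes of charts.
  Values for charts outside the atlas, or outside the coordinate range, carry no meaning.
\<close>

subsection \<open>Smooth functions\<close>

primrec Ck_on ::
  "nat \<Rightarrow> 'a::real_normed_vector set \<Rightarrow> ('a \<Rightarrow> 'b::real_normed_vector) \<Rightarrow> bool" where
  "Ck_on 0 S f \<longleftrightarrow> continuous_on S f"
| "Ck_on (Suc r) S f \<longleftrightarrow>
     (\<forall>x\<in>S. f differentiable (at x)) \<and> (\<forall>v. Ck_on r S (\<lambda>x. frechet_derivative f (at x) v))"

text \<open>Only used for open \<open>S\<close>.\<close>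

definition smooth_on ::
  "'a::real_normed_vector set \<Rightarrow> ('a \<Rightarrow> 'b::real_normed_vector) \<Rightarrow> bool" where
  "smooth_on S f \<longleftrightarrow> (\<forall>r. Ck_on r S f)"

definition pd :: "'m::finite \<Rightarrow> (real^'m \<Rightarrow> real) \<Rightarrow> real^'m \<Rightarrow> real" where
  "pd i f x = frechet_derivative f (at x) (axis i 1)"


subsection \<open>Oriented smooth manifolds\<close>

record ('p, 'm) chart =
  chart_dom :: "'p set"
  chart_map :: "'p \<Rightarrow> real^'m"

definition chart_range :: "('p, 'm::finite) chart \<Rightarrow> (real^'m) set" where
  "chart_range \<phi> = chart_map \<phi> ` chart_dom \<phi>"

definition chart_inv :: "('p, 'm::finite) chart \<Rightarrow> real^'m \<Rightarrow> 'p" where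
  "chart_inv \<phi> = inv_into (chart_dom \<phi>) (chart_map \<phi>)"

definition is_chart :: "('p::topological_space, 'm::finite) chart \<Rightarrow> bool" where
  "is_chart \<phi> \<longleftrightarrow> open (chart_dom \<phi>) \<and> open (chart_range \<phi>) \<and>
     homeomorphism (chart_dom \<phi>) (chart_range \<phi>) (chart_map \<phi>) (chart_inv \<phi>)"

definition overlap :: "('p, 'm::finite) chart \<Rightarrow> ('p, 'm) chart \<Rightarrow> (real^'m) set" where
  "overlap \<phi> \<psi> = chart_map \<phi> ` (chart_dom \<phi> \<inter> chart_dom \<psi>)"

definition transition :: "('p, 'm::finite) chart \<Rightarrow> ('p, 'm) chart \<Rightarrow> real^'m \<Rightarrow> real^'m" where
  "transition \<phi> \<psi> = chart_map \<psi> \<circ> chart_inv \<phi>"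

definition jacobian :: "('p, 'm::finite) chart \<Rightarrow> ('p, 'm) chart \<Rightarrow> real^'m \<Rightarrow> real^'m^'m" where
  "jacobian \<phi> \<psi> x = matrix (frechet_derivative (transition \<phi> \<psi>) (at x))"

text \<open>
  The atlas carries both the smooth structure and the orientation. It is not required to be
  maximal. The Hausdorff and second countability axioms are the sort constraints on the type
  of points.
\<close>

definition oriented_smooth_atlas ::
  "('p::{second_countable_topology, t2_space}, 'm::finite) chart set \<Rightarrow> bool" where
  "oriented_smooth_atlas A \<longleftrightarrow>
     (\<forall>\<phi>\<in>A. is_chart \<phi>) \<and> (\<Union>\<phi>\<in>A. chart_dom \<phi>) = UNIV \<and>
     (\<forall>\<phi>\<in>A. \<forall>\<psi>\<in>A. smooth_on (overlap \<phi> \<psi>) (transition \<phi> \<psi>) \<and>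
        (\<forall>x\<in>overlap \<phi> \<psi>. det (jacobian \<phi> \<psi> x) > 0))"


subsection \<open>Vector fields and metrics\<close>

type_synonym ('p, 'm) vfield = "('p, 'm) chart \<Rightarrow> real^'m \<Rightarrow> real^'m"
type_synonym ('p, 'm) metric = "('p, 'm) chart \<Rightarrow> real^'m \<Rightarrow> real^'m^'m"

definition smooth_scalar :: "('p, 'm::finite) chart set \<Rightarrow> ('p \<Rightarrow> real) \<Rightarrow> bool" where
  "smooth_scalar A f \<longleftrightarrow> (\<forall>\<phi>\<in>A. smooth_on (chart_range \<phi>) (\<lambda>x. f (chart_inv \<phi> x)))"

definition vector_field :: "('p, 'm::finite) chart set \<Rightarrow> ('p, 'm) vfield \<Rightarrow> bool" where
  "vector_field A X \<longleftrightarrow>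
     (\<forall>\<phi>\<in>A. smooth_on (chart_range \<phi>) (X \<phi>)) \<and>
     (\<forall>\<phi>\<in>A. \<forall>\<psi>\<in>A. \<forall>x\<in>overlap \<phi> \<psi>. X \<psi> (transition \<phi> \<psi> x) = jacobian \<phi> \<psi> x *v X \<phi> x)"

text \<open>Signature \<open>(+,\<dots>,+,-)\<close>.\<close>

definition lorentzian :: "real^'m^'m::finite \<Rightarrow> bool" where
  "lorentzian G \<longleftrightarrow> transpose G = G \<and>
     (\<exists>(P :: real^'m^'m) t. invertible P \<and>
        transpose P ** G ** P = (\<chi> i j. if i = j then (if i = t then -1 else 1) else 0))"

definition lorentzian_metric :: "('p, 'm::finite) chart set \<Rightarrow> ('p, 'm) metric \<Rightarrow> bool" where
  "lorentzian_metric A g \<longleftrightarrow>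
     (\<forall>\<phi>\<in>A. smooth_on (chart_range \<phi>) (g \<phi>) \<and> (\<forall>x\<in>chart_range \<phi>. lorentzian (g \<phi> x))) \<and>
     (\<forall>\<phi>\<in>A. \<forall>\<psi>\<in>A. \<forall>x\<in>overlap \<phi> \<psi>.
        g \<phi> x = transpose (jacobian \<phi> \<psi> x) ** g \<psi> (transition \<phi> \<psi> x) ** jacobian \<phi> \<psi> x)"

definition conformally_related ::
  "('p, 'm::finite) chart set \<Rightarrow> ('p, 'm) metric \<Rightarrow> ('p, 'm) metric \<Rightarrow> bool" where
  "conformally_related A g h \<longleftrightarrow>
     (\<exists>\<Omega>. smooth_scalar A \<Omega> \<and> (\<forall>p. \<Omega> p > 0) \<and>
        (\<forall>\<phi>\<in>A. \<forall>x\<in>chart_range \<phi>. h \<phi> x = (\<Omega> (chart_inv \<phi> x))\<^sup>2 *\<^sub>R g \<phi> x))"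

definition conformal_structure ::
  "('p, 'm::finite) chart set \<Rightarrow> ('p, 'm) metric set \<Rightarrow> bool" where
  "conformal_structure A \<C> \<longleftrightarrow>
     (\<exists>g. lorentzian_metric A g \<and>
        \<C> = {h. lorentzian_metric A h \<and> conformally_related A g h})"

definition ip :: "real^'m^'m::finite \<Rightarrow> real^'m \<Rightarrow> real^'m \<Rightarrow> real" where
  "ip G v w = (\<Sum>a\<in>UNIV. \<Sum>b\<in>UNIV. G $ a $ b * v $ a * w $ b)"


subsection \<open>Conformal optical geometries\<close>

text \<open>A choice of a subset of each tangent space, given in components.\<close>

type_synonym ('p, 'm) tset = "('p, 'm) chart \<Rightarrow> real^'m \<Rightarrow> (real^'m) set"

definition tangent_subsets :: "('p, 'm::finite) chart set \<Rightarrow> ('p, 'm) tset \<Rightarrow> bool" where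
  "tangent_subsets A S \<longleftrightarrow>
     (\<forall>\<phi>\<in>A. \<forall>\<psi>\<in>A. \<forall>x\<in>overlap \<phi> \<psi>. S \<psi> (transition \<phi> \<psi> x) = (*v) (jacobian \<phi> \<psi> x) ` S \<phi> x)"

text \<open>
  A time-orientation selects one of the two time cones at each point, in such a way that it
  locally contains a smooth vector field.
\<close>

definition time_orientation ::
  "('p, 'm::finite) chart set \<Rightarrow> ('p, 'm) metric set \<Rightarrow> ('p, 'm) tset \<Rightarrow> bool" where
  "time_orientation A \<C> F \<longleftrightarrow> tangent_subsets A F \<and>
     (\<forall>g\<in>\<C>. \<forall>\<phi>\<in>A. \<forall>x\<in>chart_range \<phi>. \<exists>T. ip (g \<phi> x) T T < 0 \<and>
        F \<phi> x = {v. ip (g \<phi> x) v v < 0 \<and> ip (g \<phi> x) v T < 0}) \<and>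
     (\<forall>\<phi>\<in>A. \<forall>x\<in>chart_range \<phi>. \<exists>V X. open V \<and> x \<in> V \<and> V \<subseteq> chart_range \<phi> \<and>
        smooth_on V X \<and> (\<forall>y\<in>V. X y \<in> F \<phi> y))"

definition null_line_distribution ::
  "('p, 'm::finite) chart set \<Rightarrow> ('p, 'm) metric set \<Rightarrow> ('p, 'm) tset \<Rightarrow> bool" where
  "null_line_distribution A \<C> K \<longleftrightarrow> tangent_subsets A K \<and>
     (\<forall>\<phi>\<in>A. \<forall>x\<in>chart_range \<phi>. \<exists>V X. open V \<and> x \<in> V \<and> V \<subseteq> chart_range \<phi> \<and>
        smooth_on V X \<and> (\<forall>y\<in>V. X y \<noteq> 0 \<and> K \<phi> y = span {X y})) \<and>
     (\<forall>g\<in>\<C>. \<forall>\<phi>\<in>A. \<forall>x\<in>chart_range \<phi>. \<forall>v\<in>K \<phi> x. ip (g \<phi> x) v v = 0)"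

definition conformal_optical_geometry ::
  "('p::{second_countable_topology, t2_space}, 'm::finite) chart set \<Rightarrow> ('p, 'm) metric set \<Rightarrow>
     ('p, 'm) tset \<Rightarrow> ('p, 'm) tset \<Rightarrow> bool" where
  "conformal_optical_geometry A \<C> F K \<longleftrightarrow>
     oriented_smooth_atlas A \<and> conformal_structure A \<C> \<and> time_orientation A \<C> F \<and>
     null_line_distribution A \<C> K"

text \<open>Smooth global sections, \<open>\<Gamma>(S)\<close>.\<close>

definition section_of ::
  "('p, 'm::finite) chart set \<Rightarrow> ('p, 'm) tset \<Rightarrow> ('p, 'm) vfield \<Rightarrow> bool" where
  "section_of A S X \<longleftrightarrow> vector_field A X \<and> (\<forall>\<phi>\<in>A. \<forall>x\<in>chart_range \<phi>. X \<phi> x \<in> S \<phi> x)"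

definition optical_vector_field ::
  "('p, 'm::finite) chart set \<Rightarrow> ('p, 'm) tset \<Rightarrow> ('p, 'm) vfield \<Rightarrow> bool" where
  "optical_vector_field A K k \<longleftrightarrow>
     section_of A K k \<and> (\<forall>\<phi>\<in>A. \<forall>x\<in>chart_range \<phi>. k \<phi> x \<noteq> 0)"

definition perp :: "('p, 'm::finite) metric \<Rightarrow> ('p, 'm) tset \<Rightarrow> ('p, 'm) tset" where
  "perp g K \<phi> x = {v. \<forall>u\<in>K \<phi> x. ip (g \<phi> x) u v = 0}"

text \<open>The one-form \<open>\<kappa>\<^sub>a = g\<^sub>a\<^sub>b k\<^sup>b\<close>.\<close>

definition lower :: "('p, 'm::finite) metric \<Rightarrow> ('p, 'm) vfield \<Rightarrow> ('p, 'm) vfield" where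
  "lower g k \<phi> x = g \<phi> x *v k \<phi> x"


subsection \<open>Lie derivatives and the congruence\<close>

text \<open>
  From here on, fields with arguments \<open>G\<close>, \<open>k\<close>, \<open>\<alpha>\<close> are the components in a single chart,
  and tensors are functions of their indices.
\<close>

definition lie_form ::
  "(real^'m::finite \<Rightarrow> real^'m) \<Rightarrow> (real^'m \<Rightarrow> real^'m) \<Rightarrow> real^'m \<Rightarrow> 'm \<Rightarrow> real" where
  "lie_form k \<alpha> x a =
     (\<Sum>b\<in>UNIV. k x $ b * pd b (\<lambda>y. \<alpha> y $ a) x + \<alpha> x $ b * pd a (\<lambda>y. k y $ b) x)"

definition lie_metric ::
  "(real^'m::finite \<Rightarrow> real^'m) \<Rightarrow> (real^'m \<Rightarrow> real^'m^'m) \<Rightarrow> real^'m \<Rightarrow> 'm \<Rightarrow> 'm \<Rightarrow> real" where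
  "lie_metric k G x a b =
     (\<Sum>c\<in>UNIV. k x $ c * pd c (\<lambda>y. G y $ a $ b) x
        + G x $ c $ b * pd a (\<lambda>y. k y $ c) x + G x $ a $ c * pd b (\<lambda>y. k y $ c) x)"

text \<open>
  For both conditions the choice of the metric \<open>g\<close> in the conformal class and of the optical
  vector field \<open>k\<close> is immaterial, because \<open>\<kappa>\<close>
  annihilates \<open>K\<^sup>\<bottom>\<close> and rescaling \<open>g\<close> alters \<open>\<L>\<^sub>k g\<close> by a multiple of \<open>g\<close>.
\<close>

definition geodesic_congruence ::
  "('p, 'm::finite) chart set \<Rightarrow> ('p, 'm) metric set \<Rightarrow> ('p, 'm) tset \<Rightarrow> bool" where
  "geodesic_congruence A \<C> K \<longleftrightarrow>
     (\<forall>g\<in>\<C>. \<forall>k. optical_vector_field A K k \<longrightarrow>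
        (\<forall>v. section_of A (perp g K) v \<longrightarrow>
           (\<forall>\<phi>\<in>A. \<forall>x\<in>chart_range \<phi>.
              (\<Sum>a\<in>UNIV. lie_form (k \<phi>) (lower g k \<phi>) x a * v \<phi> x $ a) = 0)))"

definition nonshearing_congruence ::
  "('p, 'm::finite) chart set \<Rightarrow> ('p, 'm) metric set \<Rightarrow> ('p, 'm) tset \<Rightarrow> bool" where
  "nonshearing_congruence A \<C> K \<longleftrightarrow>
     (\<forall>g\<in>\<C>. \<forall>k. optical_vector_field A K k \<longrightarrow>
        (\<exists>\<rho> :: 'p \<Rightarrow> real. \<forall>v w. section_of A (perp g K) v \<longrightarrow> section_of A (perp g K) w \<longrightarrow>
           (\<forall>\<phi>\<in>A. \<forall>x\<in>chart_range \<phi>.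
              (\<Sum>a\<in>UNIV. \<Sum>b\<in>UNIV. lie_metric (k \<phi>) (g \<phi>) x a b * v \<phi> x $ a * w \<phi> x $ b)
              = \<rho> (chart_inv \<phi> x) * ip (g \<phi> x) (v \<phi> x) (w \<phi> x))))"


subsection \<open>Levi-Civita connection and curvature\<close>

definition ginv :: "(real^'m::finite \<Rightarrow> real^'m^'m) \<Rightarrow> real^'m \<Rightarrow> 'm \<Rightarrow> 'm \<Rightarrow> real" where
  "ginv G x a b = matrix_inv (G x) $ a $ b"

text \<open>The Christoffel symbols \<open>\<Gamma>\<^sup>a\<^sub>b\<^sub>c\<close> of the Levi-Civita connection.\<close>

definition christoffel ::
  "(real^'m::finite \<Rightarrow> real^'m^'m) \<Rightarrow> 'm \<Rightarrow> 'm \<Rightarrow> 'm \<Rightarrow> real^'m \<Rightarrow> real" where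
  "christoffel G a b c x = (1/2) * (\<Sum>d\<in>UNIV. ginv G x a d *
     (pd b (\<lambda>y. G y $ d $ c) x + pd c (\<lambda>y. G y $ d $ b) x - pd d (\<lambda>y. G y $ b $ c) x))"

text \<open>\<open>\<nabla>\<^sub>a \<alpha>\<^sub>b\<close>\<close>

definition nabla_form ::
  "(real^'m::finite \<Rightarrow> real^'m^'m) \<Rightarrow> (real^'m \<Rightarrow> real^'m) \<Rightarrow> real^'m \<Rightarrow> 'm \<Rightarrow> 'm \<Rightarrow> real" where
  "nabla_form G \<alpha> x a b =
     pd a (\<lambda>y. \<alpha> y $ b) x - (\<Sum>c\<in>UNIV. christoffel G c a b x * \<alpha> x $ c)"

text \<open>
  \<open>R\<^sub>a\<^sub>b\<^sup>c\<^sub>d\<close> (arguments in this order), the result of expanding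
  \<open>\<nabla>\<^sub>a\<nabla>\<^sub>b V\<^sup>c - \<nabla>\<^sub>b\<nabla>\<^sub>a V\<^sup>c = R\<^sub>a\<^sub>b\<^sup>c\<^sub>d V\<^sup>d\<close> in coordinates.
\<close>

definition riemann_up ::
  "(real^'m::finite \<Rightarrow> real^'m^'m) \<Rightarrow> real^'m \<Rightarrow> 'm \<Rightarrow> 'm \<Rightarrow> 'm \<Rightarrow> 'm \<Rightarrow> real" where
  "riemann_up G x a b c d =
     pd a (christoffel G c b d) x - pd b (christoffel G c a d) x
     + (\<Sum>e\<in>UNIV. christoffel G c a e x * christoffel G e b d x
                - christoffel G c b e x * christoffel G e a d x)"

definition riemann ::
  "(real^'m::finite \<Rightarrow> real^'m^'m) \<Rightarrow> real^'m \<Rightarrow> 'm \<Rightarrow> 'm \<Rightarrow> 'm \<Rightarrow> 'm \<Rightarrow> real" where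
  "riemann G x a b c d = (\<Sum>e\<in>UNIV. G x $ c $ e * riemann_up G x a b e d)"

text \<open>\<open>Ric\<^sub>a\<^sub>b = R\<^sub>c\<^sub>a\<^sup>c\<^sub>b\<close>\<close>

definition ricci ::
  "(real^'m::finite \<Rightarrow> real^'m^'m) \<Rightarrow> real^'m \<Rightarrow> 'm \<Rightarrow> 'm \<Rightarrow> real" where
  "ricci G x a b = (\<Sum>c\<in>UNIV. riemann_up G x c a c b)"

definition scalar_curvature :: "(real^'m::finite \<Rightarrow> real^'m^'m) \<Rightarrow> real^'m \<Rightarrow> real" where
  "scalar_curvature G x = (\<Sum>a\<in>UNIV. \<Sum>b\<in>UNIV. ginv G x a b * ricci G x a b)"

text \<open>
  The tracefree part \<open>W\<^sub>a\<^sub>b\<^sub>c\<^sub>d\<close> of \<open>R\<^sub>a\<^sub>b\<^sub>c\<^sub>d\<close>, in dimension \<open>CARD('m) \<ge> 3\<close>.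
\<close>

definition weyl ::
  "(real^'m::finite \<Rightarrow> real^'m^'m) \<Rightarrow> real^'m \<Rightarrow> 'm \<Rightarrow> 'm \<Rightarrow> 'm \<Rightarrow> 'm \<Rightarrow> real" where
  "weyl G x a b c d = riemann G x a b c d
     - (1 / (real CARD('m) - 2)) *
         (G x $ a $ c * ricci G x b d - G x $ a $ d * ricci G x b c
          - G x $ b $ c * ricci G x a d + G x $ b $ d * ricci G x a c)
     + (scalar_curvature G x / ((real CARD('m) - 1) * (real CARD('m) - 2))) *
         (G x $ a $ c * G x $ b $ d - G x $ a $ d * G x $ b $ c)"


subsection \<open>Skew-symmetrisation and the tensor \<open>\<tau>\<close>\<close>

definition alt2 :: "('m \<Rightarrow> 'm \<Rightarrow> real) \<Rightarrow> 'm \<Rightarrow> 'm \<Rightarrow> real" where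
  "alt2 T a b = (T a b - T b a) / 2"

definition alt3 :: "('m \<Rightarrow> 'm \<Rightarrow> 'm \<Rightarrow> real) \<Rightarrow> 'm \<Rightarrow> 'm \<Rightarrow> 'm \<Rightarrow> real" where
  "alt3 T a b c = (T a b c + T b c a + T c a b - T b a c - T a c b - T c b a) / 6"

text \<open>Skew-symmetrisation \<open>T\<^bsub>[ab][cd]\<^esub>\<close> over two disjoint pairs of indices.\<close>

definition alt22 ::
  "('m \<Rightarrow> 'm \<Rightarrow> 'm \<Rightarrow> 'm \<Rightarrow> real) \<Rightarrow> 'm \<Rightarrow> 'm \<Rightarrow> 'm \<Rightarrow> 'm \<Rightarrow> real" where
  "alt22 T a b c d = alt2 (\<lambda>a b. alt2 (\<lambda>c d. T a b c d) c d) a b"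

definition tau ::
  "(real^'m::finite \<Rightarrow> real^'m^'m) \<Rightarrow> (real^'m \<Rightarrow> real^'m) \<Rightarrow> real^'m \<Rightarrow> 'm \<Rightarrow> 'm \<Rightarrow> 'm \<Rightarrow> real" where
  "tau G \<kappa> x a b c = 3 * alt3 (\<lambda>a b c. \<kappa> x $ a * nabla_form G \<kappa> x b c) a b c"

text \<open>\<open>\<tau>\<^sup>a\<^sub>b\<^sub>c\<close> and \<open>\<tau>\<^sub>a\<^sup>b\<^sup>c\<close>\<close>

definition tau_up1 ::
  "(real^'m::finite \<Rightarrow> real^'m^'m) \<Rightarrow> (real^'m \<Rightarrow> real^'m) \<Rightarrow> real^'m \<Rightarrow> 'm \<Rightarrow> 'm \<Rightarrow> 'm \<Rightarrow> real" where
  "tau_up1 G \<kappa> x a b c = (\<Sum>p\<in>UNIV. ginv G x a p * tau G \<kappa> x p b c)"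

definition tau_up23 ::
  "(real^'m::finite \<Rightarrow> real^'m^'m) \<Rightarrow> (real^'m \<Rightarrow> real^'m) \<Rightarrow> real^'m \<Rightarrow> 'm \<Rightarrow> 'm \<Rightarrow> 'm \<Rightarrow> real" where
  "tau_up23 G \<kappa> x a b c =
     (\<Sum>p\<in>UNIV. \<Sum>q\<in>UNIV. ginv G x b p * ginv G x c q * tau G \<kappa> x a p q)"

end

(*
  Proof idea. Work in one chart, with B = nabla kappa, F = d kappa / 2, and N_bc = k^e k^f R_befc.
  Sections of K^perp with prescribed value at a point exist (cut-offs), so the hypotheses say
  L_k kappa = mu kappa and L_k g = rho g + kappa eta + eta kappa with local functions mu, rho and
  a one-form eta, all differentiable. Hence B = (L_k g) / 2 + F.

  The Ricci identity for kappa gives N = L_k B - mu B - d mu kappa - B B^T, where the transpose product is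
  formed with the inverse metric. Since d F = 0, L_k F = mu F modulo kappa, and so
  N = sigma g - F F^T modulo terms kappa_b (...)_c and (...)_b kappa_c. The trace of N is -Ric(k, k); together
  with N(k, .) = N(., k) = 0 this determines sigma and shows that W_befc k^e k^f is, modulo such terms, the
  trace-free part of -F F^T. The skew-symmetrisations with kappa remove these terms, and the right-hand side
  is expanded with tau_abc = kappa_a F_bc + kappa_b F_ca + kappa_c F_ab.
*)

theory Submission
  imports Defs
begin

subsection \<open>Calculus of smooth functions\<close>

text \<open>The obstacle is regularity. The hypotheses test Lie derivatives only against global
  sections and give \<rho> as a bare function, whereas the Ricci identity requires differentiating
  the shear-free equation once. Differentiability of \<rho> is recovered by evaluating that equation
  on a field in K^perp that is non-null near the given point. Such a field exists because a
  nondegenerate form cannot vanish on a hyperplane in dimension at least 3. Explicit rational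
  formulas, with the Euclidean inner product of the chart as auxiliary structure, then give \<mu>
  and \<eta>. Lie derivatives along k are used because they preserve the shape of the decomposition
  of L_k g, so no frame of K^perp/K has to be chosen or propagated. The derivative of \<rho> along k
  enters through \<sigma> alone, and \<sigma> cancels against the Ricci term of the Weyl tensor.
  What survives is F_ab F^ab + \<mu>^2/2, the squared norm of F on K^perp/K, divided by the rank n
  of that bundle. The factor 4 compensates the two halvings of the double
  skew-symmetrisation.\<close>

lemma frechet_derivative_eqI:
  "(f has_derivative f') (at x) \<Longrightarrow> frechet_derivative f (at x) = f'"
  by (simp add: frechet_derivative_at[symmetric])

lemma Ck_on_cong:
  assumes "open S" "\<And>x. x \<in> S \<Longrightarrow> f x = g x"
  shows "Ck_on r S f \<longleftrightarrow> Ck_on r S g"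
  using assms(2)
proof (induction r arbitrary: f g)
  case 0
  then show ?case by (simp cong: continuous_on_cong)
next
  case (Suc r)
  have hd: "(f has_derivative D) (at x) \<longleftrightarrow> (g has_derivative D) (at x)" if "x \<in> S" for x D
    using has_derivative_transform_within_open[OF _ assms(1) that] Suc.prems by metis
  then have d: "f differentiable (at x) \<longleftrightarrow> g differentiable (at x)"
    and fd: "frechet_derivative f (at x) = frechet_derivative g (at x)" if "x \<in> S" for x
    using that unfolding differentiable_def frechet_derivative_def by auto
  show ?case
    using Suc.IH[of "\<lambda>x. frechet_derivative f (at x) v" "\<lambda>x. frechet_derivative g (at x) v" for v]
      d fd by simp
qed

lemma Ck_on_subset: "Ck_on r S f \<Longrightarrow> T \<subseteq> S \<Longrightarrow> Ck_on r T f"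
  by (induction r arbitrary: f) (auto intro: continuous_on_subset)

lemma Ck_on_Un:
  "open S \<Longrightarrow> open T \<Longrightarrow> Ck_on r S f \<Longrightarrow> Ck_on r T f \<Longrightarrow> Ck_on r (S \<union> T) f"
  by (induction r arbitrary: f) (auto intro: continuous_on_open_Un)

lemma Ck_on_const: "Ck_on r S (\<lambda>x. c)"
  by (induction r arbitrary: c) auto

lemma Ck_on_SucD: "Ck_on (Suc r) S f \<Longrightarrow> Ck_on r S f"
proof (induction r arbitrary: f)
  case 0
  then show ?case
    by (auto intro!: continuous_at_imp_continuous_on differentiable_imp_continuous_within)
next
  case (Suc r)
  then show ?case by auto
qed

text \<open>\<open>frechet_derivative\<close> is a choice term, so the inductive closure proofs go
  through this rule: exhibit some derivative \<open>D\<close> and control its values in constant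
  directions.\<close>

lemma Ck_on_SucI:
  assumes "\<And>x. x \<in> S \<Longrightarrow> (f has_derivative D x) (at x)"
    and "open S" "\<And>v. Ck_on r S (\<lambda>x. D x v)"
  shows "Ck_on (Suc r) S f"
proof -
  have "frechet_derivative f (at x) = D x" if "x \<in> S" for x
    using frechet_derivative_eqI assms(1) that by blast
  then have "Ck_on r S (\<lambda>x. frechet_derivative f (at x) v)" for v
    using Ck_on_cong[OF \<open>open S\<close>, of "\<lambda>x. frechet_derivative f (at x) v" "\<lambda>x. D x v"] assms(3)
    by simp
  then show ?thesis
    using assms(1) by (auto simp: differentiable_def)
qed

lemma Ck_on_SucE:
  assumes "Ck_on (Suc r) S f"
  shows "x \<in> S \<Longrightarrow> (f has_derivative frechet_derivative f (at x)) (at x)"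
    and "Ck_on r S (\<lambda>x. frechet_derivative f (at x) v)"
  using assms by (auto simp: frechet_derivative_works[symmetric])

lemma Ck_on_linear:
  assumes "bounded_linear L" "open S" "Ck_on r S f"
  shows "Ck_on r S (\<lambda>x. L (f x))"
  using assms(3)
proof (induction r arbitrary: f)
  case 0
  then show ?case using bounded_linear.continuous_on[OF assms(1)] by simp
next
  case (Suc r)
  show ?case
  proof (rule Ck_on_SucI[where D = "\<lambda>x v. L (frechet_derivative f (at x) v)"])
    show "((\<lambda>x. L (f x)) has_derivative (\<lambda>v. L (frechet_derivative f (at x) v))) (at x)"
      if "x \<in> S" for x
      using bounded_linear.has_derivative[OF assms(1) Ck_on_SucE(1)[OF Suc.prems that]] .
    show "Ck_on r S (\<lambda>x. L (frechet_derivative f (at x) v))" for v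
      by (rule Suc.IH[OF Ck_on_SucE(2)[OF Suc.prems]])
  qed (rule assms(2))
qed

lemma Ck_on_add:
  assumes "open S" "Ck_on r S f" "Ck_on r S g"
  shows "Ck_on r S (\<lambda>x. f x + g x)"
  using assms(2,3)
proof (induction r arbitrary: f g)
  case 0
  then show ?case by (simp add: continuous_on_add)
next
  case (Suc r)
  show ?case
    by (rule Ck_on_SucI[where D = "\<lambda>x v. frechet_derivative f (at x) v + frechet_derivative g (at x) v"])
      (use assms(1) Ck_on_SucE[OF Suc.prems(1)] Ck_on_SucE[OF Suc.prems(2)] Suc.IH in
        \<open>auto intro!: has_derivative_add\<close>)
qed

lemma Ck_on_sum:
  assumes "open S" "\<And>i. i \<in> I \<Longrightarrow> Ck_on r S (f i)"
  shows "Ck_on r S (\<lambda>x. \<Sum>i\<in>I. f i x)"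
  using assms(2)
  by (induction I rule: infinite_finite_induct) (auto intro: Ck_on_add assms(1) Ck_on_const)

lemma Ck_on_bilinear:
  assumes "bounded_bilinear P" "open S" "Ck_on r S f" "Ck_on r S g"
  shows "Ck_on r S (\<lambda>x. P (f x) (g x))"
  using assms(3,4)
proof (induction r arbitrary: f g)
  case 0
  then show ?case by (simp add: bounded_bilinear.continuous_on[OF assms(1)])
next
  case (Suc r)
  show ?case
  proof (rule Ck_on_SucI[where
        D = "\<lambda>x v. P (f x) (frechet_derivative g (at x) v) + P (frechet_derivative f (at x) v) (g x)"])
    show "((\<lambda>x. P (f x) (g x)) has_derivative (\<lambda>v. P (f x) (frechet_derivative g (at x) v)
        + P (frechet_derivative f (at x) v) (g x))) (at x)" if "x \<in> S" for x
      by (rule bounded_bilinear.FDERIV[OF assms(1)])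
        (use Ck_on_SucE[OF Suc.prems(1)] Ck_on_SucE[OF Suc.prems(2)] that in auto)
    show "Ck_on r S (\<lambda>x. P (f x) (frechet_derivative g (at x) v)
        + P (frechet_derivative f (at x) v) (g x))" for v
      by (intro Ck_on_add assms(2) Suc.IH Ck_on_SucE(2)[OF Suc.prems(1)] Ck_on_SucE(2)[OF Suc.prems(2)]
          Ck_on_SucD[OF Suc.prems(1)] Ck_on_SucD[OF Suc.prems(2)])
  qed (rule assms(2))
qed

lemmas Ck_on_mult = Ck_on_bilinear[OF bounded_bilinear_mult]
lemmas Ck_on_scaleR = Ck_on_bilinear[OF bounded_bilinear_scaleR]

text \<open>\<open>Ck_on\<close> speaks of derivatives in a constant direction, whereas the chain
  rule and the Jacobian produce directions that vary with the point. Expansion in a basis restores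
  constant directions.\<close>

lemma frechet_derivative_Basis_sum:
  fixes f :: "'a::euclidean_space \<Rightarrow> 'b::real_normed_vector"
  assumes "f differentiable (at x)"
  shows "frechet_derivative f (at x) v
    = (\<Sum>i\<in>Basis. (v \<bullet> i) *\<^sub>R frechet_derivative f (at x) i)"
proof -
  interpret linear "frechet_derivative f (at x)"
    by (rule linear_frechet_derivative[OF assms])
  have "frechet_derivative f (at x) (\<Sum>i\<in>Basis. (v \<bullet> i) *\<^sub>R i)
      = (\<Sum>i\<in>Basis. (v \<bullet> i) *\<^sub>R frechet_derivative f (at x) i)"
    by (simp add: sum scaleR)
  then show ?thesis by (simp add: euclidean_representation)
qed

lemma Ck_on_compose:
  fixes f :: "'b::euclidean_space \<Rightarrow> 'c::real_normed_vector"
    and g :: "'a::real_normed_vector \<Rightarrow> 'b"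
  assumes "open S" "open T" "g ` S \<subseteq> T" "Ck_on r S g" "Ck_on r T f"
  shows "Ck_on r S (\<lambda>x. f (g x))"
  using assms(4,5)
proof (induction r arbitrary: f)
  case 0
  then show ?case
    using continuous_on_compose2[of T f S g] assms(3) by simp
next
  case (Suc r)
  show ?case
  proof (rule Ck_on_SucI[where D = "\<lambda>x v. \<Sum>i\<in>Basis. (frechet_derivative g (at x) v \<bullet> i)
      *\<^sub>R frechet_derivative f (at (g x)) i"])
    fix x assume x: "x \<in> S"
    have df: "f differentiable (at (g x))"
      using Suc.prems(2) x assms(3) by auto
    have "((\<lambda>x. f (g x)) has_derivative (\<lambda>v. frechet_derivative f (at (g x))
        (frechet_derivative g (at x) v))) (at x)"
      by (rule has_derivative_compose)
        (use Ck_on_SucE(1)[OF Suc.prems(1) x] df in \<open>auto simp: frechet_derivative_works[symmetric]\<close>)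
    then show "((\<lambda>x. f (g x)) has_derivative (\<lambda>v. \<Sum>i\<in>Basis. (frechet_derivative g (at x) v \<bullet> i)
        *\<^sub>R frechet_derivative f (at (g x)) i)) (at x)"
      by (subst (asm) frechet_derivative_Basis_sum[OF df])
  next
    show "Ck_on r S (\<lambda>x. \<Sum>i\<in>Basis. (frechet_derivative g (at x) v \<bullet> i)
        *\<^sub>R frechet_derivative f (at (g x)) i)" for v
      by (intro Ck_on_sum Ck_on_scaleR assms(1) Ck_on_linear[OF bounded_linear_inner_left]
          Suc.IH Ck_on_SucE(2)[OF Suc.prems(1)] Ck_on_SucE(2)[OF Suc.prems(2)] Ck_on_SucD[OF Suc.prems(1)])
  qed (rule assms(1))
qed

lemma smooth_onI: "(\<And>r. Ck_on r S f) \<Longrightarrow> smooth_on S f"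
  by (simp add: smooth_on_def)

lemma smooth_on_cong:
  "open S \<Longrightarrow> (\<And>x. x \<in> S \<Longrightarrow> f x = g x) \<Longrightarrow> smooth_on S f \<longleftrightarrow> smooth_on S g"
  unfolding smooth_on_def using Ck_on_cong[of S f g] by blast

lemma smooth_on_subset: "smooth_on S f \<Longrightarrow> T \<subseteq> S \<Longrightarrow> smooth_on T f"
  unfolding smooth_on_def using Ck_on_subset by blast

lemma smooth_on_Un:
  "open S \<Longrightarrow> open T \<Longrightarrow> smooth_on S f \<Longrightarrow> smooth_on T f \<Longrightarrow> smooth_on (S \<union> T) f"
  unfolding smooth_on_def using Ck_on_Un by blast

lemma smooth_on_const: "smooth_on S (\<lambda>x. c)"
  by (simp add: smooth_on_def Ck_on_const)

lemma smooth_on_add: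
  "open S \<Longrightarrow> smooth_on S f \<Longrightarrow> smooth_on S g \<Longrightarrow> smooth_on S (\<lambda>x. f x + g x)"
  by (simp add: smooth_on_def Ck_on_add)

lemma smooth_on_linear:
  "bounded_linear L \<Longrightarrow> open S \<Longrightarrow> smooth_on S f \<Longrightarrow> smooth_on S (\<lambda>x. L (f x))"
  by (simp add: smooth_on_def Ck_on_linear)

lemma smooth_on_diff:
  fixes f g :: "'a::real_normed_vector \<Rightarrow> 'b::real_normed_vector"
  assumes "open S" "smooth_on S f" "smooth_on S g" 
  shows "smooth_on S (\<lambda>x. f x - g x)"
  using smooth_on_add[OF assms(1,2) smooth_on_linear[OF bounded_linear_minus[OF bounded_linear_ident] assms(1,3)]]
  by simp

lemma smooth_on_sum:
  "open S \<Longrightarrow> (\<And>i. i \<in> I \<Longrightarrow> smooth_on S (f i)) \<Longrightarrow> smooth_on S (\<lambda>x. \<Sum>i\<in>I. f i x)"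
  by (simp add: smooth_on_def Ck_on_sum)

lemma smooth_on_mult:
  fixes f g :: "'a::real_normed_vector \<Rightarrow> real"
  shows "open S \<Longrightarrow> smooth_on S f \<Longrightarrow> smooth_on S g \<Longrightarrow> smooth_on S (\<lambda>x. f x * g x)"
  by (simp add: smooth_on_def Ck_on_mult)

lemma smooth_on_scaleR:
  "open S \<Longrightarrow> smooth_on S f \<Longrightarrow> smooth_on S g \<Longrightarrow> smooth_on S (\<lambda>x. f x *\<^sub>R g x)"
  by (simp add: smooth_on_def Ck_on_scaleR)

lemma smooth_on_compose:
  fixes f :: "'b::euclidean_space \<Rightarrow> 'c::real_normed_vector"
  assumes "open S" "open T" "g ` S \<subseteq> T" "smooth_on S g" "smooth_on T f"
  shows "smooth_on S (\<lambda>x. f (g x))"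
  using assms Ck_on_compose unfolding smooth_on_def by blast

lemma smooth_on_differentiable: "smooth_on S f \<Longrightarrow> x \<in> S \<Longrightarrow> f differentiable (at x)"
  unfolding smooth_on_def using Ck_on.simps(2)[of 0 S f] by blast

lemma smooth_on_continuous: "smooth_on S f \<Longrightarrow> continuous_on S f"
  unfolding smooth_on_def using Ck_on.simps(1)[of S f] by blast

lemma smooth_on_frechet_derivative:
  "smooth_on S f \<Longrightarrow> smooth_on S (\<lambda>x. frechet_derivative f (at x) v)"
  unfolding smooth_on_def using Ck_on.simps(2)[of _ S f] by blast

lemma smooth_on_nth: "open S \<Longrightarrow> smooth_on S f \<Longrightarrow> smooth_on S (\<lambda>x. f x $ i)"
  using smooth_on_linear[OF bounded_linear_vec_nth] .

lemma smooth_on_vec: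
  fixes f :: "'a::real_normed_vector \<Rightarrow> real^'n::finite"
  assumes "open S" "\<And>i. smooth_on S (\<lambda>x. f x $ i)"
  shows "smooth_on S f"
proof -
  have "smooth_on S (\<lambda>x. \<Sum>i\<in>UNIV. (f x $ i) *\<^sub>R axis i (1::real))"
    by (intro smooth_on_sum smooth_on_scaleR assms smooth_on_const)
  moreover have "(\<Sum>i\<in>UNIV. (f x $ i) *\<^sub>R axis i (1::real)) = f x" for x
    using basis_expansion[of "f x"] by (simp add: scalar_mult_eq_scaleR)
  ultimately show ?thesis by simp
qed

lemma smooth_on_pd: "smooth_on S f \<Longrightarrow> smooth_on S (pd i f)"
  unfolding pd_def using smooth_on_frechet_derivative by blast

lemma smooth_on_matrix_vector_mult:
  fixes M :: "'a::real_normed_vector \<Rightarrow> real^'n::finite^'m::finite"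
  assumes "open S" "smooth_on S M" "smooth_on S V"
  shows "smooth_on S (\<lambda>x. M x *v V x)"
  by (rule smooth_on_vec)
    (auto simp: matrix_vector_mult_def intro!: assms smooth_on_sum smooth_on_mult smooth_on_nth)

text \<open>Both mixed second derivatives are limits of the second difference quotient.\<close>

lemma second_difference_mean_value:
  fixes f :: "'a::real_normed_vector \<Rightarrow> real"
  assumes "s > 0"
    and S: "\<And>a b. a \<in> {0..s} \<Longrightarrow> b \<in> {0..s} \<Longrightarrow> x + a *\<^sub>R u + b *\<^sub>R v \<in> S"
    and f: "\<And>y. y \<in> S \<Longrightarrow> f differentiable (at y)"
    and fu: "\<And>y. y \<in> S \<Longrightarrow> (\<lambda>y. frechet_derivative f (at y) u) differentiable (at y)"
  shows "\<exists>a\<in>{0..s}. \<exists>b\<in>{0..s}. f (x + s *\<^sub>R u + s *\<^sub>R v) - f (x + s *\<^sub>R u) - f (x + s *\<^sub>R v) + f x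
    = s\<^sup>2 * frechet_derivative (\<lambda>y. frechet_derivative f (at y) u) (at (x + a *\<^sub>R u + b *\<^sub>R v)) v"
proof -
  define fu where "fu = (\<lambda>y. frechet_derivative f (at y) u)"
  \<comment> \<open>The mean value theorem is applied twice: to the increment in direction
    \<open>v\<close> as a function of the displacement along \<open>u\<close>, then to
    \<open>fu\<close> along \<open>v\<close>. The term \<open>0 *\<^sub>R v\<close> is kept so that
    \<open>D\<close> fits both ends.\<close>
  define \<phi> where "\<phi> = (\<lambda>a. f (x + a *\<^sub>R u + s *\<^sub>R v) - f (x + a *\<^sub>R u + 0 *\<^sub>R v))"
  have D: "((\<lambda>a. f (x + a *\<^sub>R u + b *\<^sub>R v)) has_real_derivative fu (x + a *\<^sub>R u + b *\<^sub>R v)) (at a)"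
    if "a \<in> {0..s}" "b \<in> {0..s}" for a b
  proof -
    let ?y = "x + a *\<^sub>R u + b *\<^sub>R v"
    have fd: "f differentiable (at ?y)" by (rule f[OF S[OF that]])
    have "(f has_derivative frechet_derivative f (at ?y)) (at ?y)"
      using fd by (simp add: frechet_derivative_works)
    then have "((\<lambda>a. f (x + a *\<^sub>R u + b *\<^sub>R v)) has_derivative (\<lambda>h. frechet_derivative f (at ?y) (h *\<^sub>R u))) (at a)"
      by (intro has_derivative_compose[of "\<lambda>a. x + a *\<^sub>R u + b *\<^sub>R v" "\<lambda>h. h *\<^sub>R u" a UNIV f])
        (auto intro!: derivative_eq_intros)
    then show ?thesis
      by (simp add: has_field_derivative_def fu_def linear_cmul[OF linear_frechet_derivative[OF fd]]
          mult_commute_abs)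
  qed
  have "\<exists>a. a > 0 \<and> a < s \<and> \<phi> s - \<phi> 0 = (s - 0) * (fu (x + a *\<^sub>R u + s *\<^sub>R v) - fu (x + a *\<^sub>R u + 0 *\<^sub>R v))"
    by (rule MVT2) (use \<open>s > 0\<close> D in \<open>auto simp: \<phi>_def simp del: scaleR_zero_left intro!: DERIV_diff\<close>)
  then obtain a where a: "a > 0" "a < s"
    "\<phi> s - \<phi> 0 = s * (fu (x + a *\<^sub>R u + s *\<^sub>R v) - fu (x + a *\<^sub>R u + 0 *\<^sub>R v))" by auto
  have D2: "((\<lambda>b. fu (x + a *\<^sub>R u + b *\<^sub>R v)) has_real_derivative frechet_derivative fu (at (x + a *\<^sub>R u + b *\<^sub>R v)) v) (at b)"
    if "b \<in> {0..s}" for b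
  proof -
    let ?y = "x + a *\<^sub>R u + b *\<^sub>R v"
    have fd: "fu differentiable (at ?y)" unfolding fu_def by (rule assms(4)) (use S that a in auto)
    have "(fu has_derivative frechet_derivative fu (at ?y)) (at ?y)"
      using fd by (simp add: frechet_derivative_works)
    then have "((\<lambda>b. fu (x + a *\<^sub>R u + b *\<^sub>R v)) has_derivative (\<lambda>h. frechet_derivative fu (at ?y) (h *\<^sub>R v))) (at b)"
      by (intro has_derivative_compose[of "\<lambda>b. x + a *\<^sub>R u + b *\<^sub>R v" "\<lambda>h. h *\<^sub>R v" b UNIV fu])
        (auto intro!: derivative_eq_intros)
    then show ?thesis
      by (simp add: has_field_derivative_def linear_cmul[OF linear_frechet_derivative[OF fd]]
          mult_commute_abs)
  qed
  have "\<exists>b. b > 0 \<and> b < s \<and> fu (x + a *\<^sub>R u + s *\<^sub>R v) - fu (x + a *\<^sub>R u + 0 *\<^sub>R v)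
      = (s - 0) * frechet_derivative fu (at (x + a *\<^sub>R u + b *\<^sub>R v)) v"
    by (rule MVT2) (use \<open>s > 0\<close> D2 in \<open>auto simp del: scaleR_zero_left\<close>)
  then obtain b where b: "b > 0" "b < s" "fu (x + a *\<^sub>R u + s *\<^sub>R v) - fu (x + a *\<^sub>R u + 0 *\<^sub>R v)
      = s * frechet_derivative fu (at (x + a *\<^sub>R u + b *\<^sub>R v)) v" by auto
  have "\<phi> s - \<phi> 0 = s\<^sup>2 * frechet_derivative fu (at (x + a *\<^sub>R u + b *\<^sub>R v)) v"
    using a(3) b(3) by (simp add: power2_eq_square)
  then show ?thesis
    using a b by (intro bexI[of _ a] bexI[of _ b]) (auto simp: \<phi>_def fu_def)
qed

lemma smooth_on_symmetric_derivative:
  fixes f :: "'a::real_normed_vector \<Rightarrow> real"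
  assumes "open S" "smooth_on S f" "x \<in> S"
  shows "frechet_derivative (\<lambda>y. frechet_derivative f (at y) u) (at x) v
       = frechet_derivative (\<lambda>y. frechet_derivative f (at y) v) (at x) u"
proof (rule ccontr)
  define P where "P = (\<lambda>y. frechet_derivative (\<lambda>y. frechet_derivative f (at y) u) (at y) v)"
  define Q where "Q = (\<lambda>y. frechet_derivative (\<lambda>y. frechet_derivative f (at y) v) (at y) u)"
  assume "\<not> ?thesis"
  then have PQ: "dist (P x) (Q x) > 0" by (simp add: P_def Q_def)
  \<comment> \<open>Half of the supposed gap: a common value closer than \<open>e\<close> to both
    \<open>P x\<close> and \<open>Q x\<close> is impossible.\<close>
  define e where "e = dist (P x) (Q x) / 2"
  have e: "e > 0" using PQ by (simp add: e_def)
  have "continuous_on S P" "continuous_on S Q"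
    unfolding P_def Q_def by (intro smooth_on_continuous smooth_on_frechet_derivative assms)+
  then have "isCont P x" "isCont Q x"
    using assms continuous_on_eq_continuous_at by blast+
  then have "\<exists>d1>0. \<forall>y. dist y x < d1 \<longrightarrow> dist (P y) (P x) < e"
     "\<exists>d2>0. \<forall>y. dist y x < d2 \<longrightarrow> dist (Q y) (Q x) < e"
    using e unfolding continuous_at_eps_delta by blast+
  then obtain d1 d2 where d12: "d1 > 0" "\<And>y. dist y x < d1 \<Longrightarrow> dist (P y) (P x) < e"
     "d2 > 0" "\<And>y. dist y x < d2 \<Longrightarrow> dist (Q y) (Q x) < e"
    by blast
  obtain d3 where d3: "d3 > 0" "ball x d3 \<subseteq> S"
    using assms openE by blast
  define d where "d = min d1 (min d2 d3)"
  \<comment> \<open>Displacements up to \<open>s\<close> in both directions then have norm at most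
    \<open>d / 2\<close>; the summand 1 keeps the denominator positive when \<open>u\<close> and
    \<open>v\<close> vanish.\<close>
  define s where "s = d / (2 * (norm u + norm v + 1))"
  have d: "d > 0" using d12 d3 by (simp add: d_def)
  have nz: "norm u + norm v + 1 > 0" using norm_ge_zero[of u] norm_ge_zero[of v] by linarith
  have s: "s > 0" using d nz by (simp add: s_def)
  have near: "dist (x + a *\<^sub>R u + b *\<^sub>R v) x < d" if "a \<in> {0..s}" "b \<in> {0..s}" for a b
  proof -
    have "dist (x + a *\<^sub>R u + b *\<^sub>R v) x = norm (a *\<^sub>R u + b *\<^sub>R v)" by (simp add: dist_norm add.assoc)
    also have "\<dots> \<le> a * norm u + b * norm v"
      using norm_triangle_ineq[of "a *\<^sub>R u" "b *\<^sub>R v"] that by simp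
    also have "\<dots> \<le> s * norm u + s * norm v"
      using that by (intro add_mono mult_right_mono) auto
    also have "\<dots> \<le> s * (norm u + norm v + 1)" using s by (simp add: algebra_simps)
    also have "\<dots> = d / 2" using nz by (simp add: s_def del: distrib_left_numeral)
    also have "\<dots> < d" using d by simp
    finally show ?thesis .
  qed
  have inS: "x + a *\<^sub>R u + b *\<^sub>R v \<in> S" if "a \<in> {0..s}" "b \<in> {0..s}" for a b
    using near[OF that] d3 by (auto simp: d_def mem_ball dist_commute)
  have df: "f differentiable (at y)" "(\<lambda>y. frechet_derivative f (at y) w) differentiable (at y)"
    if "y \<in> S" for y w
    using that assms(2) by (auto intro: smooth_on_differentiable smooth_on_frechet_derivative)
  obtain a b where ab: "a \<in> {0..s}" "b \<in> {0..s}"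
    "f (x + s *\<^sub>R u + s *\<^sub>R v) - f (x + s *\<^sub>R u) - f (x + s *\<^sub>R v) + f x = s\<^sup>2 * P (x + a *\<^sub>R u + b *\<^sub>R v)"
    using second_difference_mean_value[OF s inS df(1) df(2)] unfolding P_def by blast
  have inS': "x + a *\<^sub>R v + b *\<^sub>R u \<in> S" if "a \<in> {0..s}" "b \<in> {0..s}" for a b
    using inS[OF that(2,1)] by (simp add: ac_simps)
  obtain a' b' where ab': "a' \<in> {0..s}" "b' \<in> {0..s}"
    "f (x + s *\<^sub>R v + s *\<^sub>R u) - f (x + s *\<^sub>R v) - f (x + s *\<^sub>R u) + f x = s\<^sup>2 * Q (x + a' *\<^sub>R v + b' *\<^sub>R u)"
    using second_difference_mean_value[OF s inS' df(1) df(2)] unfolding Q_def by blast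
  have swap: "x + a *\<^sub>R u + b *\<^sub>R v = x + b *\<^sub>R v + a *\<^sub>R u" for a b
    by (simp add: add.assoc add.commute)
  have "s\<^sup>2 * P (x + a *\<^sub>R u + b *\<^sub>R v)
      = f (x + s *\<^sub>R u + s *\<^sub>R v) - f (x + s *\<^sub>R u) - f (x + s *\<^sub>R v) + f x"
    by (rule ab(3)[symmetric])
  also have "\<dots> = f (x + s *\<^sub>R v + s *\<^sub>R u) - f (x + s *\<^sub>R v) - f (x + s *\<^sub>R u) + f x"
    unfolding swap[of s s] by linarith
  also have "\<dots> = s\<^sup>2 * Q (x + a' *\<^sub>R v + b' *\<^sub>R u)"
    by (rule ab'(3))
  finally have eq: "P (x + a *\<^sub>R u + b *\<^sub>R v) = Q (x + b' *\<^sub>R u + a' *\<^sub>R v)"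
    unfolding swap[of b' a'] using s by (metis mult_left_cancel power_eq_0_iff less_irrefl)
  have "dist (P (x + a *\<^sub>R u + b *\<^sub>R v)) (P x) < e" "dist (Q (x + b' *\<^sub>R u + a' *\<^sub>R v)) (Q x) < e"
    using d12 near[OF ab(1,2)] near[OF ab'(2,1)] by (auto simp: d_def)
  then show False
    using eq dist_triangle2[of "P x" "Q x" "P (x + a *\<^sub>R u + b *\<^sub>R v)"]
    by (simp add: e_def dist_commute)
qed

lemma pd_commute:
  assumes "open S" "smooth_on S f" "x \<in> S"
  shows "pd i (pd j f) x = pd j (pd i f) x"
  unfolding pd_def using smooth_on_symmetric_derivative[OF assms] .

subsection \<open>Bump functions and extension of vector fields\<close>

text \<open>\<open>p(1/t) exp(-1/t)\<close> extended by \<open>0\<close>: a family closed under differentiation.\<close>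

definition flat_exp :: "real poly \<Rightarrow> real \<Rightarrow> real" where
  "flat_exp p t = (if t > 0 then poly p (1 / t) * exp (- (1 / t)) else 0)"

lemma tendsto_poly_div_exp: "((\<lambda>s::real. poly p s * exp (- s)) \<longlongrightarrow> 0) at_top"
proof -
  have "((\<lambda>s. \<Sum>i\<le>degree p. coeff p i * (s ^ i / exp s)) \<longlongrightarrow> (\<Sum>i\<le>degree p. coeff p i * 0)) at_top"
    by (intro tendsto_intros tendsto_power_div_exp_0)
  then show ?thesis
    by (simp add: poly_altdef sum_distrib_right exp_minus divide_inverse mult.assoc)
qed

text \<open>With s = 1/t one has d/dt = -s^2 d/ds, and p(s) exp(-s) has s-derivative (p' - p)
  exp(-s); hence the polynomial factor. At 0 the right difference quotients tend to 0 because the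
  exponential beats every polynomial.\<close>

lemma flat_exp_has_derivative:
  "(flat_exp p has_real_derivative flat_exp ([:0, 0, 1:] * (p - pderiv p)) t) (at t)"
proof -
  consider "t > 0" | "t < 0" | "t = 0" by linarith
  then show ?thesis
  proof cases
    case 1
    have "((\<lambda>t. poly p (1 / t) * exp (- (1 / t))) has_real_derivative
        flat_exp ([:0, 0, 1:] * (p - pderiv p)) t) (at t)"
      using 1 by (auto intro!: derivative_eq_intros DERIV_chain2[OF poly_DERIV]
          simp: flat_exp_def field_simps power2_eq_square)
    then show ?thesis
      by (rule has_field_derivative_transform_within_open[where S = "{0<..}"])
        (use 1 in \<open>auto simp: flat_exp_def\<close>)
  next
    case 2
    have "((\<lambda>t. 0) has_real_derivative 0) (at t)" by simp
    then have "(flat_exp p has_real_derivative 0) (at t)"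
      by (rule has_field_derivative_transform_within_open[where S = "{..<0}"])
        (use 2 in \<open>auto simp: flat_exp_def\<close>)
    then show ?thesis using 2 by (simp add: flat_exp_def)
  next
    case 3
    \<comment> \<open>In the variable s = 1/h the quotient \<open>flat_exp p h / h\<close> is s p(s)
      exp(-s).\<close>
    have "((\<lambda>s. poly ([:0, 1:] * p) s * exp (- s)) \<longlongrightarrow> 0) at_top"
      by (rule tendsto_poly_div_exp)
    then have "((\<lambda>h. poly ([:0, 1:] * p) (inverse h) * exp (- inverse h)) \<longlongrightarrow> 0) (at_right 0)"
      by (rule filterlim_compose[OF _ filterlim_inverse_at_top_right])
    then have R: "((\<lambda>h. flat_exp p h / h) \<longlongrightarrow> 0) (at_right 0)"
      by (rule tendsto_cong[THEN iffD1, rotated])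
        (auto simp: eventually_at_right_field flat_exp_def divide_simps intro!: exI[of _ 1])
    have L: "((\<lambda>h. flat_exp p h / h) \<longlongrightarrow> 0) (at_left 0)"
      by (rule tendsto_eventually) (auto simp: eventually_at_left_field flat_exp_def intro!: exI[of _ "-1"])
    have "((\<lambda>h. flat_exp p h / h) \<longlongrightarrow> 0) (at 0)"
      using L R by (simp add: filterlim_split_at)
    then show ?thesis
      using 3 by (simp add: DERIV_def flat_exp_def)
  qed
qed

lemma smooth_on_flat_exp: "smooth_on UNIV (flat_exp p)"
proof (rule smooth_onI)
  show "Ck_on r UNIV (flat_exp p)" for r
  proof (induction r arbitrary: p)
    case 0
    show ?case
      using flat_exp_has_derivative[of p] DERIV_isCont
      by (auto simp: continuous_on_eq_continuous_at)
  next
    case (Suc r)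
    show ?case
      by (rule Ck_on_SucI[where D = "\<lambda>t v. flat_exp ([:0, 0, 1:] * (p - pderiv p)) t * v"])
        (use flat_exp_has_derivative[of p] Suc.IH in
          \<open>auto simp: has_field_derivative_def intro!: Ck_on_mult Ck_on_const simp del: mult_pCons_left\<close>)
  qed
qed

text \<open>\<open>flat_exp 1\<close> is composed with r^2 - |y - x|^2, which is positive exactly in
  the open ball. The value at the centre is divided out where the bump is used.\<close>

lemma smooth_bump:
  fixes x :: "'a::euclidean_space"
  assumes "r > 0"
  obtains \<theta> :: "'a \<Rightarrow> real" where "smooth_on UNIV \<theta>" "\<theta> x \<noteq> 0" "\<And>y. y \<notin> cball x r \<Longrightarrow> \<theta> y = 0"
proof
  let ?\<theta> = "\<lambda>y. flat_exp 1 (r\<^sup>2 - (y - x) \<bullet> (y - x))"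
  have id: "smooth_on UNIV (\<lambda>y::'a. y)"
    by (rule smooth_onI, induct_tac r) (auto simp: Ck_on_const frechet_derivative_ident)
  have "smooth_on UNIV (\<lambda>y. (y - x) \<bullet> (y - x))"
    using smooth_on_diff[OF open_UNIV id smooth_on_const[of UNIV x]]
    by (simp add: smooth_on_def Ck_on_bilinear[OF bounded_bilinear_inner])
  then have "smooth_on UNIV (\<lambda>y. r\<^sup>2 - (y - x) \<bullet> (y - x))"
    by (intro smooth_on_diff smooth_on_const open_UNIV)
  then show "smooth_on UNIV ?\<theta>"
    using smooth_on_compose[OF open_UNIV open_UNIV subset_UNIV _ smooth_on_flat_exp] by blast
  show "?\<theta> x \<noteq> 0" using assms by (simp add: flat_exp_def)
  show "?\<theta> y = 0" if "y \<notin> cball x r" for y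
  proof -
    have "r < norm (y - x)" using that by (simp add: dist_norm norm_minus_commute)
    then have "r\<^sup>2 < (norm (y - x))\<^sup>2" using assms by (intro power_strict_mono) auto
    then show ?thesis by (simp add: flat_exp_def power2_norm_eq_inner)
  qed
qed

text \<open>The field with components \<open>V\<close> in \<phi>, pushed forward on overlaps and
  continued by 0. It is a smooth field on the manifold once \<open>V\<close> vanishes outside a
  compact part of the chart range.\<close>

definition extend_field ::
  "('p, 'm::finite) chart \<Rightarrow> (real^'m \<Rightarrow> real^'m) \<Rightarrow> ('p, 'm) vfield" where
  "extend_field \<phi> V \<psi> y = (if y \<in> overlap \<psi> \<phi>
     then jacobian \<phi> \<psi> (transition \<psi> \<phi> y) *v V (transition \<psi> \<phi> y) else 0)"

lemma chart_map_in_range: "p \<in> chart_dom \<phi> \<Longrightarrow> chart_map \<phi> p \<in> chart_range \<phi>"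
  by (simp add: chart_range_def)

lemma overlap_self: "overlap \<phi> \<phi> = chart_range \<phi>"
  by (simp add: overlap_def chart_range_def)

context
  fixes A :: "('p::{second_countable_topology, t2_space}, 'm::finite) chart set"
  assumes A: "oriented_smooth_atlas A"
begin

lemma is_chart_atlas: "\<phi> \<in> A \<Longrightarrow> is_chart \<phi>"
  using A by (simp add: oriented_smooth_atlas_def)

lemma chart_inv_map: "\<phi> \<in> A \<Longrightarrow> p \<in> chart_dom \<phi> \<Longrightarrow> chart_inv \<phi> (chart_map \<phi> p) = p"
  using is_chart_atlas unfolding is_chart_def homeomorphism_def by blast

lemma chart_map_inv: "\<phi> \<in> A \<Longrightarrow> x \<in> chart_range \<phi> \<Longrightarrow> chart_map \<phi> (chart_inv \<phi> x) = x"
  using is_chart_atlas unfolding is_chart_def homeomorphism_def by blast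

lemma chart_inv_in_dom: "\<phi> \<in> A \<Longrightarrow> x \<in> chart_range \<phi> \<Longrightarrow> chart_inv \<phi> x \<in> chart_dom \<phi>"
  using is_chart_atlas unfolding is_chart_def homeomorphism_def by blast

lemma open_chart_range: "\<phi> \<in> A \<Longrightarrow> open (chart_range \<phi>)"
  and open_chart_dom: "\<phi> \<in> A \<Longrightarrow> open (chart_dom \<phi>)"
  using is_chart_atlas unfolding is_chart_def by blast+

lemma continuous_on_chart_inv: "\<phi> \<in> A \<Longrightarrow> continuous_on (chart_range \<phi>) (chart_inv \<phi>)"
  using is_chart_atlas unfolding is_chart_def homeomorphism_def by blast

lemma overlap_iff: "\<phi> \<in> A \<Longrightarrow> x \<in> overlap \<phi> \<psi> \<longleftrightarrow> x \<in> chart_range \<phi> \<and> chart_inv \<phi> x \<in> chart_dom \<psi>"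
  by (auto simp: overlap_def chart_inv_map chart_map_in_range)
    (metis IntI chart_inv_in_dom chart_map_inv image_eqI)

lemma open_overlap:
  assumes "\<phi> \<in> A" "\<psi> \<in> A"
  shows "open (overlap \<phi> \<psi>)"
proof -
  have "overlap \<phi> \<psi> = chart_range \<phi> \<inter> chart_inv \<phi> -` chart_dom \<psi>"
    using overlap_iff[OF assms(1)] by auto
  then show ?thesis
    using continuous_on_open_vimage[OF open_chart_range[OF assms(1)]] continuous_on_chart_inv[OF assms(1)]
      open_chart_dom[OF assms(2)] by (metis Int_commute)
qed

lemma transition_overlap:
  assumes "\<phi> \<in> A" "\<psi> \<in> A" "x \<in> overlap \<phi> \<psi>"
  shows "transition \<phi> \<psi> x \<in> overlap \<psi> \<phi>"
    and "chart_inv \<psi> (transition \<phi> \<psi> x) = chart_inv \<phi> x"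
    and "transition \<psi> \<theta> (transition \<phi> \<psi> x) = transition \<phi> \<theta> x"
  using assms by (auto simp: overlap_iff transition_def chart_inv_map chart_map_in_range chart_inv_in_dom)

lemma transition_self: "\<phi> \<in> A \<Longrightarrow> x \<in> chart_range \<phi> \<Longrightarrow> transition \<phi> \<phi> x = x"
  by (simp add: transition_def chart_map_inv)

lemma smooth_on_transition:
  "\<phi> \<in> A \<Longrightarrow> \<psi> \<in> A \<Longrightarrow> smooth_on (overlap \<phi> \<psi>) (transition \<phi> \<psi>)"
  using A by (simp add: oriented_smooth_atlas_def)

lemma jacobian_mult_vector:
  assumes "\<phi> \<in> A" "\<psi> \<in> A" "x \<in> overlap \<phi> \<psi>"
  shows "jacobian \<phi> \<psi> x *v w = frechet_derivative (transition \<phi> \<psi>) (at x) w"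
  using fun_cong[OF matrix_vector_mul(2)[OF linear_frechet_derivative[OF
        smooth_on_differentiable[OF smooth_on_transition[OF assms(1,2)] assms(3)]]], of w]
  by (simp add: jacobian_def)

lemma jacobian_self:
  assumes "\<phi> \<in> A" "x \<in> chart_range \<phi>"
  shows "jacobian \<phi> \<phi> x *v w = w"
proof -
  have "((\<lambda>y. y) has_derivative (\<lambda>v. v)) (at x)" by simp
  then have "(transition \<phi> \<phi> has_derivative (\<lambda>v. v)) (at x)"
    by (rule has_derivative_transform_within_open[OF _ open_chart_range[OF assms(1)] assms(2)])
      (simp add: transition_self assms(1))
  then show ?thesis
    using jacobian_mult_vector[OF assms(1,1)] assms(2) by (simp add: overlap_self frechet_derivative_eqI)
qed

text \<open>The chain rule for a composite of two transitions, which agrees with the direct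
  transition on the open set \<open>overlap \<phi> \<psi>\<close>.\<close>

lemma jacobian_chain:
  assumes "\<phi> \<in> A" "\<psi> \<in> A" "\<theta> \<in> A" "x \<in> overlap \<phi> \<psi>" "x \<in> overlap \<phi> \<theta>"
  shows "jacobian \<phi> \<theta> x *v w = jacobian \<psi> \<theta> (transition \<phi> \<psi> x) *v (jacobian \<phi> \<psi> x *v w)"
proof -
  let ?y = "transition \<phi> \<psi> x"
  have y: "?y \<in> overlap \<psi> \<theta>"
    using assms transition_overlap[OF assms(1,2,4)] by (simp add: overlap_iff)
  have 1: "(transition \<phi> \<psi> has_derivative frechet_derivative (transition \<phi> \<psi>) (at x)) (at x)"
    using smooth_on_differentiable[OF smooth_on_transition[OF assms(1,2)] assms(4)]
    by (simp add: frechet_derivative_works)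
  have 2: "(transition \<psi> \<theta> has_derivative frechet_derivative (transition \<psi> \<theta>) (at ?y)) (at ?y)"
    using smooth_on_differentiable[OF smooth_on_transition[OF assms(2,3)] y]
    by (simp add: frechet_derivative_works)
  have "((\<lambda>x. transition \<psi> \<theta> (transition \<phi> \<psi> x)) has_derivative
      (\<lambda>w. frechet_derivative (transition \<psi> \<theta>) (at ?y) (frechet_derivative (transition \<phi> \<psi>) (at x) w))) (at x)"
    by (rule has_derivative_compose[OF 1 2])
  then have "(transition \<phi> \<theta> has_derivative
      (\<lambda>w. frechet_derivative (transition \<psi> \<theta>) (at ?y) (frechet_derivative (transition \<phi> \<psi>) (at x) w))) (at x)"
    by (rule has_derivative_transform_within_open[OF _ open_overlap[OF assms(1,2)] assms(4)])
      (simp add: transition_overlap(3)[OF assms(1,2)])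
  then show ?thesis
    using jacobian_mult_vector[OF assms(1,3,5)] jacobian_mult_vector[OF assms(1,2,4)]
      jacobian_mult_vector[OF assms(2,3) y] by (simp add: frechet_derivative_eqI)
qed

lemma extend_field_self:
  "\<phi> \<in> A \<Longrightarrow> x \<in> chart_range \<phi> \<Longrightarrow> extend_field \<phi> V \<phi> x = V x"
  by (simp add: extend_field_def overlap_self transition_self jacobian_self)

lemma extend_field_transform:
  assumes "\<phi> \<in> A" "\<psi> \<in> A" "\<theta> \<in> A" "y \<in> overlap \<psi> \<theta>"
  shows "extend_field \<phi> V \<theta> (transition \<psi> \<theta> y) = jacobian \<psi> \<theta> y *v extend_field \<phi> V \<psi> y"
proof (cases "y \<in> overlap \<psi> \<phi>")
  case True
  let ?x = "transition \<psi> \<phi> y"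
  have 1: "transition \<psi> \<theta> y \<in> overlap \<theta> \<phi>"
    using assms True transition_overlap[OF assms(2,3,4)] by (simp add: overlap_iff)
  have 2: "?x \<in> overlap \<phi> \<psi>" "?x \<in> overlap \<phi> \<theta>"
    using assms True transition_overlap[OF assms(2,1) True] by (auto simp: overlap_iff)
  have 3: "transition \<phi> \<psi> ?x = y"
    using transition_overlap(3)[OF assms(2,1) True, of \<psi>] transition_self[OF assms(2)] True assms(2)
    by (simp add: overlap_iff)
  show ?thesis
    using True 1 jacobian_chain[OF assms(1,2,3) 2, of "V ?x"]
    by (simp add: extend_field_def transition_overlap(3)[OF assms(2,3,4)] 3)
next
  case False
  have "transition \<psi> \<theta> y \<notin> overlap \<theta> \<phi>"
    using assms False transition_overlap[OF assms(2,3,4)] by (simp add: overlap_iff)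
  then show ?thesis using False by (simp add: extend_field_def)
qed

text \<open>Two open sets cover the range of \<psi>: the overlap, where the push-forward is smooth,
  and the points outside the image of \<open>C\<close>, where the field is 0. The second set is open
  because compact subsets of a Hausdorff space are closed.\<close>

lemma smooth_on_extend_field:
  assumes "\<phi> \<in> A" "\<psi> \<in> A" "smooth_on (chart_range \<phi>) V" "compact C" "C \<subseteq> chart_range \<phi>"
    and V0: "\<And>y. y \<in> chart_range \<phi> \<Longrightarrow> y \<notin> C \<Longrightarrow> V y = 0"
  shows "smooth_on (chart_range \<psi>) (extend_field \<phi> V \<psi>)"
proof -
  let ?T = "transition \<phi> \<psi>" and ?O = "overlap \<phi> \<psi>"
  define U where "U = chart_range \<psi> \<inter> chart_inv \<psi> -` (- (chart_inv \<phi> ` C))"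
  have oo: "open ?O" "open (overlap \<psi> \<phi>)" using open_overlap assms(1,2) by blast+
  have V: "smooth_on ?O V"
    by (rule smooth_on_subset[OF assms(3)]) (auto simp: overlap_iff assms(1))
  have dT: "?T differentiable (at x)" if "x \<in> ?O" for x
    using smooth_on_differentiable[OF smooth_on_transition[OF assms(1,2)] that] .
  have "smooth_on ?O (\<lambda>x. \<Sum>i\<in>Basis. (V x \<bullet> i) *\<^sub>R frechet_derivative ?T (at x) i)"
    by (intro smooth_on_sum smooth_on_scaleR oo smooth_on_linear[OF bounded_linear_inner_left] V
        smooth_on_frechet_derivative smooth_on_transition assms)
  then have 1: "smooth_on ?O (\<lambda>x. jacobian \<phi> \<psi> x *v V x)"
    using smooth_on_cong[OF oo(1), of "\<lambda>x. jacobian \<phi> \<psi> x *v V x"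
        "\<lambda>x. \<Sum>i\<in>Basis. (V x \<bullet> i) *\<^sub>R frechet_derivative ?T (at x) i"]
      jacobian_mult_vector[OF assms(1,2)] frechet_derivative_Basis_sum[OF dT] by simp
  have "smooth_on (overlap \<psi> \<phi>) (\<lambda>y. jacobian \<phi> \<psi> (transition \<psi> \<phi> y) *v V (transition \<psi> \<phi> y))"
    by (rule smooth_on_compose[OF oo(2,1) _ smooth_on_transition[OF assms(2,1)] 1])
      (auto simp: transition_overlap(1)[OF assms(2,1)])
  then have 2: "smooth_on (overlap \<psi> \<phi>) (extend_field \<phi> V \<psi>)"
    using smooth_on_cong[OF oo(2), of "extend_field \<phi> V \<psi>"
        "\<lambda>y. jacobian \<phi> \<psi> (transition \<psi> \<phi> y) *v V (transition \<psi> \<phi> y)"]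
    by (simp add: extend_field_def)
  have "compact (chart_inv \<phi> ` C)"
    using compact_continuous_image continuous_on_subset[OF continuous_on_chart_inv[OF assms(1)] assms(5)]
      assms(4) by blast
  then have "open (- (chart_inv \<phi> ` C))" by (simp add: compact_imp_closed open_Compl)
  then have oU: "open U"
    using continuous_on_open_vimage[OF open_chart_range[OF assms(2)]] continuous_on_chart_inv[OF assms(2)]
    unfolding U_def by (metis Int_commute)
  have "extend_field \<phi> V \<psi> y = 0" if "y \<in> U" for y
  proof (cases "y \<in> overlap \<psi> \<phi>")
    case True
    have "transition \<psi> \<phi> y \<notin> C"
      using that transition_overlap(2)[OF assms(2,1) True] unfolding U_def by force
    moreover have "transition \<psi> \<phi> y \<in> chart_range \<phi>"
      using transition_overlap(1)[OF assms(2,1) True] by (simp add: overlap_iff assms(1))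
    ultimately show ?thesis by (simp add: extend_field_def V0)
  qed (simp add: extend_field_def)
  then have 3: "smooth_on U (extend_field \<phi> V \<psi>)"
    using smooth_on_cong[OF oU, of "extend_field \<phi> V \<psi>" "\<lambda>_. 0"] smooth_on_const by simp
  have "chart_range \<psi> = overlap \<psi> \<phi> \<union> U"
  proof -
    have "y \<in> overlap \<psi> \<phi>" if "y \<in> chart_range \<psi>" "chart_inv \<psi> y \<in> chart_inv \<phi> ` C" for y
      using that assms(1,2,5) chart_inv_in_dom[OF assms(1)] by (auto simp: overlap_iff)
    then show ?thesis unfolding U_def using overlap_iff[OF assms(2), of _ \<phi>] by auto
  qed
  then show ?thesis using smooth_on_Un[OF oo(2) oU 2 3] by simp
qed

end

subsection \<open>Pointwise form of the geodesic and shear-free conditions\<close>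

lemma ip_eq_inner: "ip G v w = v \<bullet> (G *v w)"
  by (simp add: ip_def inner_vec_def matrix_vector_mult_def sum_distrib_left mult_ac)

lemma ip_commute:
  assumes "transpose G = G"
  shows "ip G v w = ip G w v"
proof -
  have "v \<bullet> (G *v w) = (transpose G *v v) \<bullet> w"
    by (simp add: dot_lmul_matrix)
  then show ?thesis by (simp add: ip_eq_inner assms inner_commute)
qed

lemma ip_add_left: "ip G (u + v) w = ip G u w + ip G v w"
  and ip_add_right: "ip G w (u + v) = ip G w u + ip G w v"
  and ip_diff_left: "ip G (u - v) w = ip G u w - ip G v w"
  and ip_diff_right: "ip G w (u - v) = ip G w u - ip G w v"
  and ip_scaleR_left: "ip G (c *\<^sub>R v) w = c * ip G v w"
  and ip_scaleR_right: "ip G w (c *\<^sub>R v) = c * ip G w v"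
  by (simp_all add: ip_eq_inner inner_add_left matrix_vector_right_distrib inner_add_right
      inner_diff_left matrix_vector_mult_diff_distrib inner_diff_right matrix_vector_mult_scaleR)

lemma ip_axis: "ip G (axis a 1) (axis b 1) = G $ a $ b"
  by (simp add: ip_eq_inner inner_axis' matrix_vector_mul_component inner_axis)

lemma ip_congruence: "ip (transpose J ** G ** J) u v = ip G (J *v u) (J *v v)"
proof -
  have "transpose J ** G ** J *v v = transpose J *v (G *v (J *v v))"
    by (simp only: matrix_vector_mul_assoc matrix_mul_assoc)
  also have "u \<bullet> \<dots> = (J *v u) \<bullet> (G *v (J *v v))"
    using dot_lmul_matrix[of "G *v (J *v v)" J u]
    by (simp add: inner_commute transpose_matrix_vector)
  finally show ?thesis by (simp add: ip_eq_inner)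
qed

lemma lorentzian_invertible: "lorentzian G \<Longrightarrow> invertible G"
proof -
  assume "lorentzian G"
  then obtain P :: "real^'a^'a" and t where
    D: "transpose P ** G ** P = (\<chi> i j. if i = j then (if i = t then -1 else 1) else 0)"
    unfolding lorentzian_def by blast
  have "det (transpose P ** G ** P) \<noteq> 0"
    unfolding D by (subst det_diagonal) auto
  then show ?thesis by (simp add: det_mul invertible_det_nz)
qed

lemma lorentzian_symmetric: "lorentzian G \<Longrightarrow> transpose G = G"
  by (simp add: lorentzian_def)

text \<open>\<open>L\<close> minus its Euclidean projection to \<kappa> lies in the kernel of
  \<kappa> and is therefore orthogonal to itself. The explicit quotient, rather than mere
  proportionality, later makes the factor \<mu> differentiable.\<close>

lemma covector_vanishing_on_perp:
  fixes \<kappa> L :: "real^'m::finite"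
  assumes "\<kappa> \<noteq> 0" "\<And>v. \<kappa> \<bullet> v = 0 \<Longrightarrow> L \<bullet> v = 0"
  shows "L = ((L \<bullet> \<kappa>) / (\<kappa> \<bullet> \<kappa>)) *\<^sub>R \<kappa>"
proof -
  let ?v = "L - ((L \<bullet> \<kappa>) / (\<kappa> \<bullet> \<kappa>)) *\<^sub>R \<kappa>"
  have k: "\<kappa> \<bullet> ?v = 0" using assms(1) by (simp add: inner_diff_right inner_commute)
  then have "L \<bullet> ?v = 0" by (rule assms(2))
  with k have "?v \<bullet> ?v = 0"
    by (simp only: inner_diff_left[of L _ ?v] inner_scaleR_left)
  then show ?thesis by simp
qed

text \<open>The solution \<eta> of T = \<kappa> \<eta> + \<eta> \<kappa>: applying both sides to
  \<kappa> gives \<eta> up to a multiple of \<kappa>, and T(\<kappa>, \<kappa>) = 2 |\<kappa>|^2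
  (\<eta> . \<kappa>) fixes the multiple. Being rational in \<open>T\<close> and \<kappa>, it is
  differentiable along with them.\<close>

definition perp_cofactor :: "real^'m^'m::finite \<Rightarrow> real^'m \<Rightarrow> real^'m" where
  "perp_cofactor T \<kappa> = (1 / (\<kappa> \<bullet> \<kappa>)) *\<^sub>R (T *v \<kappa>) - (ip T \<kappa> \<kappa> / (2 * (\<kappa> \<bullet> \<kappa>)\<^sup>2)) *\<^sub>R \<kappa>"

lemma symmetric_form_vanishing_on_perp:
  fixes \<kappa> :: "real^'m::finite"
  assumes "\<kappa> \<noteq> 0" "transpose T = T" "\<And>v w. \<kappa> \<bullet> v = 0 \<Longrightarrow> \<kappa> \<bullet> w = 0 \<Longrightarrow> ip T v w = 0"
  shows "T $ a $ b = \<kappa> $ a * perp_cofactor T \<kappa> $ b + perp_cofactor T \<kappa> $ a * \<kappa> $ b"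
proof -
  let ?N = "\<kappa> \<bullet> \<kappa>"
  \<comment> \<open>Euclidean projections of the basis vectors to the kernel of \<kappa>; expanding
    their vanishing product isolates the entry of \<open>T\<close>.\<close>
  let ?v = "\<lambda>a. axis a 1 - (\<kappa> $ a / ?N) *\<^sub>R \<kappa>"
  have N: "?N \<noteq> 0" using assms(1) by simp
  have "\<kappa> \<bullet> ?v a = 0" for a using N by (simp add: inner_diff_right inner_axis)
  then have "ip T (?v a) (?v b) = 0" by (intro assms(3))
  moreover have "ip T \<kappa> (axis b 1) = (T *v \<kappa>) $ b" "ip T (axis a 1) \<kappa> = (T *v \<kappa>) $ a"
    using ip_commute[OF assms(2), of \<kappa> "axis b 1"] by (simp_all add: ip_eq_inner inner_axis')
  ultimately have "T $ a $ b = \<kappa> $ a / ?N * (T *v \<kappa>) $ b + \<kappa> $ b / ?N * (T *v \<kappa>) $ a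
      - \<kappa> $ a / ?N * (\<kappa> $ b / ?N) * ip T \<kappa> \<kappa>"
    by (simp add: ip_diff_left ip_diff_right ip_scaleR_left ip_scaleR_right ip_axis algebra_simps)
  also have "\<dots> = \<kappa> $ a * perp_cofactor T \<kappa> $ b + perp_cofactor T \<kappa> $ a * \<kappa> $ b"
    using N by (simp add: perp_cofactor_def field_simps power2_eq_square)
  finally show ?thesis .
qed

text \<open>If every vector in the kernel of \<kappa> were null, polarisation would make
  \<open>G\<close> vanish on that kernel, so \<open>G\<close> would equal \<kappa> \<eta> + \<eta>
  \<kappa>, of rank at most 2. An invertible form in dimension at least 3 cannot have this
  shape.\<close>

lemma exists_nonnull_perp:
  fixes \<kappa> :: "real^'m::finite"
  assumes "\<kappa> \<noteq> 0" "transpose G = G" "invertible G" "CARD('m) \<ge> 3"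
  obtains e where "\<kappa> \<bullet> e = 0" "ip G e e \<noteq> 0"
proof (rule ccontr)
  assume "\<not> thesis"
  then have null: "\<kappa> \<bullet> e = 0 \<longrightarrow> ip G e e = 0" for e using that by blast
  have "ip G v w = 0" if "\<kappa> \<bullet> v = 0" "\<kappa> \<bullet> w = 0" for v w
    using null[of "v + w"] null[of v] null[of w] that ip_commute[OF assms(2), of v w]
    by (simp add: ip_add_left ip_add_right inner_add_right)
  note G = symmetric_form_vanishing_on_perp[OF assms(1,2) this]
  let ?\<eta> = "perp_cofactor G \<kappa>"
  have "dim {\<kappa>, ?\<eta>} \<le> card {\<kappa>, ?\<eta>}" by (intro dim_le_card) (auto simp: span_superset)
  also have "\<dots> \<le> 2" by (simp add: card_insert_if)
  finally have "dim {\<kappa>, ?\<eta>} < DIM(real^'m)" using assms(4) by simp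
  then obtain v where v: "v \<noteq> 0" "\<And>y. y \<in> span {\<kappa>, ?\<eta>} \<Longrightarrow> orthogonal v y"
    by (rule orthogonal_to_subspace_exists) blast
  have "v \<bullet> \<kappa> = 0" "v \<bullet> ?\<eta> = 0" using v(2) by (auto simp: orthogonal_def span_base)
  then have "(\<Sum>b\<in>UNIV. \<kappa> $ b * v $ b) = 0" "(\<Sum>b\<in>UNIV. ?\<eta> $ b * v $ b) = 0"
    by (simp_all add: inner_vec_def mult.commute)
  then have "(G *v v) $ a = 0" for a
    unfolding matrix_vector_mult_def
    by (simp add: G distrib_right sum.distrib mult.assoc sum_distrib_left[symmetric])
  then have "G *v v = 0" by (simp add: vec_eq_iff)
  then have "v = 0"
    using assms(3) by (metis inj_matrix_vector_mult injD matrix_vector_mult_0_right)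
  with v(1) show False by simp
qed

section \<open>From global sections to conditions at a point\<close>

lemma conformal_metric:
  assumes "conformal_optical_geometry A \<C> F K" "g \<in> \<C>"
  shows "lorentzian_metric A g"
  using assms unfolding conformal_optical_geometry_def conformal_structure_def by blast

lemma optical_span:
  assumes "conformal_optical_geometry A \<C> F K" "optical_vector_field A K k" "\<phi> \<in> A" "x \<in> chart_range \<phi>"
  shows "K \<phi> x = span {k \<phi> x}"
proof -
  obtain X where X: "X \<noteq> 0" "K \<phi> x = span {X}"
    using assms(1,3,4) unfolding conformal_optical_geometry_def null_line_distribution_def by metis
  have k: "k \<phi> x \<in> span {X}" "k \<phi> x \<noteq> 0"
    using assms(2-4) X(2) unfolding optical_vector_field_def section_of_def by auto
  then obtain c where c: "k \<phi> x = c *\<^sub>R X" by (auto simp: span_singleton)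
  then have "X = (1 / c) *\<^sub>R k \<phi> x" using k(2) by auto
  then have "X \<in> span {k \<phi> x}" by (metis span_base span_scale insertI1)
  then show ?thesis
    using k(1) X(2) by (simp add: span_eq)
qed

text \<open>K is spanned by k at each point, so its orthogonal complement is the kernel of the
  single covector \<kappa>.\<close>

lemma perp_iff:
  assumes "conformal_optical_geometry A \<C> F K" "g \<in> \<C>" "optical_vector_field A K k"
    and "\<phi> \<in> A" "x \<in> chart_range \<phi>"
  shows "v \<in> perp g K \<phi> x \<longleftrightarrow> lower g k \<phi> x \<bullet> v = 0"
proof -
  have "transpose (g \<phi> x) = g \<phi> x"
    using conformal_metric[OF assms(1,2)] assms(4,5) lorentzian_symmetric
    unfolding lorentzian_metric_def by blast
  then have "ip (g \<phi> x) (k \<phi> x) v = lower g k \<phi> x \<bullet> v"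
    using ip_commute by (metis ip_eq_inner lower_def inner_commute)
  then show ?thesis
    unfolding perp_def optical_span[OF assms(1,3-5)] by (auto simp: span_singleton ip_scaleR_left)
qed

lemma lower_nonzero:
  assumes "conformal_optical_geometry A \<C> F K" "g \<in> \<C>" "optical_vector_field A K k"
    and "\<phi> \<in> A" "x \<in> chart_range \<phi>"
  shows "lower g k \<phi> x \<noteq> 0"
proof -
  have "invertible (g \<phi> x)"
    using conformal_metric[OF assms(1,2)] assms(4,5) lorentzian_invertible
    unfolding lorentzian_metric_def by blast
  moreover have "k \<phi> x \<noteq> 0" using assms(3-5) by (simp add: optical_vector_field_def)
  ultimately show ?thesis
    unfolding lower_def by (metis inj_matrix_vector_mult injD matrix_vector_mult_0_right)
qed

lemma smooth_on_lower:
  assumes "conformal_optical_geometry A \<C> F K" "g \<in> \<C>" "optical_vector_field A K k" "\<phi> \<in> A"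
  shows "smooth_on (chart_range \<phi>) (g \<phi>)" "smooth_on (chart_range \<phi>) (k \<phi>)"
    and "smooth_on (chart_range \<phi>) (lower g k \<phi>)"
proof -
  show g: "smooth_on (chart_range \<phi>) (g \<phi>)"
    using conformal_metric[OF assms(1,2)] assms(4) unfolding lorentzian_metric_def by blast
  show k: "smooth_on (chart_range \<phi>) (k \<phi>)"
    using assms(3,4) unfolding optical_vector_field_def section_of_def vector_field_def by blast
  have "open (chart_range \<phi>)"
    using assms(1,4) open_chart_range unfolding conformal_optical_geometry_def by blast
  then show "smooth_on (chart_range \<phi>) (lower g k \<phi>)"
    unfolding lower_def[abs_def] by (intro smooth_on_matrix_vector_mult g k)
qed

text \<open>Both congruence conditions quantify over global sections of K^perp. Their integrands
  contain the sections undifferentiated, so prescribing the value at one point turns them into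
  algebraic conditions there.\<close>

lemma perp_section_exists:
  assumes cog: "conformal_optical_geometry A \<C> F K" "g \<in> \<C>" "optical_vector_field A K k"
    and \<phi>: "\<phi> \<in> A" "x \<in> chart_range \<phi>" and v: "lower g k \<phi> x \<bullet> v = 0"
  obtains X where "section_of A (perp g K) X" "X \<phi> x = v"
proof -
  have A: "oriented_smooth_atlas A" using cog(1) by (simp add: conformal_optical_geometry_def)
  let ?\<kappa> = "lower g k \<phi>"
  let ?l = "?\<kappa> x"
  have o: "open (chart_range \<phi>)" by (rule open_chart_range[OF A \<phi>(1)])
  obtain r where r: "r > 0" "cball x r \<subseteq> chart_range \<phi>"
    using o \<phi>(2) open_contains_cball by blast
  obtain \<beta> :: "real^'b \<Rightarrow> real" where \<beta>: "smooth_on UNIV \<beta>" "\<beta> x \<noteq> 0" "\<And>y. y \<notin> cball x r \<Longrightarrow> \<beta> y = 0"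
    using smooth_bump[OF r(1)] by blast
  have \<kappa>0: "?l \<bullet> ?l \<noteq> 0" using lower_nonzero[OF cog \<phi>] by simp
  \<comment> \<open>The bracket is orthogonal to \<kappa> at every point, since its two terms
    cancel, and at x it is a multiple of \<open>v\<close> because \<open>v\<close> is orthogonal to
    \<open>?l\<close>. The prefactor is a bump normalised so that the value at x is exactly
    \<open>v\<close>.\<close>
  define V where "V = (\<lambda>y. (\<beta> y * (1 / (\<beta> x * (?l \<bullet> ?l)))) *\<^sub>R ((?\<kappa> y \<bullet> ?l) *\<^sub>R v - (?\<kappa> y \<bullet> v) *\<^sub>R ?l))"
  have \<beta>': "smooth_on (chart_range \<phi>) \<beta>" by (rule smooth_on_subset[OF \<beta>(1)]) simp
  have sV: "smooth_on (chart_range \<phi>) V"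
    unfolding V_def
    by (intro smooth_on_scaleR smooth_on_diff smooth_on_mult smooth_on_const o \<beta>'
        smooth_on_linear[OF bounded_linear_inner_left] smooth_on_lower(3)[OF cog \<phi>(1)])
  have Vperp: "?\<kappa> y \<bullet> V y = 0" for y
    by (simp add: V_def inner_diff_right)
  have V0: "V y = 0" if "y \<notin> cball x r" for y using \<beta>(3)[OF that] by (simp add: V_def)
  have Vx: "V x = v" using \<beta>(2) \<kappa>0 v by (simp add: V_def)
  define X where "X = extend_field \<phi> V"
  have "vector_field A X"
    unfolding vector_field_def X_def
    using smooth_on_extend_field[OF A \<phi>(1) _ sV compact_cball r(2)] V0
      extend_field_transform[OF A \<phi>(1)] by blast
  moreover have "X \<psi> y \<in> perp g K \<psi> y" if \<psi>: "\<psi> \<in> A" "y \<in> chart_range \<psi>" for \<psi> y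
  proof (cases "y \<in> overlap \<psi> \<phi>")
    case True
    let ?x = "transition \<psi> \<phi> y"
    let ?J = "jacobian \<phi> \<psi> ?x"
    have x: "?x \<in> overlap \<phi> \<psi>" "?x \<in> chart_range \<phi>"
      using transition_overlap(1)[OF A \<psi>(1) \<phi>(1) True] overlap_iff[OF A \<phi>(1)] by auto
    have tx: "transition \<phi> \<psi> ?x = y"
      using transition_overlap(3)[OF A \<psi>(1) \<phi>(1) True] transition_self[OF A \<psi>] by simp
    \<comment> \<open>Every vector of K in the chart \<psi> is \<open>?J\<close> applied to one in
      \<phi>, and g obeys the matching transformation law, so orthogonality is inherited from
      \<phi>.\<close>
    have K: "K \<psi> y = (*v) ?J ` K \<phi> ?x"
      using cog(1) \<phi>(1) \<psi>(1) x(1) tx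
      unfolding conformal_optical_geometry_def null_line_distribution_def tangent_subsets_def by metis
    have g: "g \<phi> ?x = transpose ?J ** g \<psi> y ** ?J"
      using conformal_metric[OF cog(1,2)] \<phi>(1) \<psi>(1) x(1) tx unfolding lorentzian_metric_def by metis
    have "V ?x \<in> perp g K \<phi> ?x"
      using perp_iff[OF cog \<phi>(1) x(2)] Vperp by blast
    then have "ip (g \<psi> y) (?J *v u) (?J *v V ?x) = 0" if "u \<in> K \<phi> ?x" for u
      using that g ip_congruence[of ?J "g \<psi> y" u "V ?x"] by (simp add: perp_def)
    then show ?thesis
      using True K by (auto simp: X_def extend_field_def perp_def)
  next
    case False
    then show ?thesis by (simp add: X_def extend_field_def perp_def ip_eq_inner)
  qed
  ultimately have "section_of A (perp g K) X" by (simp add: section_of_def)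
  moreover have "X \<phi> x = v" using extend_field_self[OF A \<phi>] Vx by (simp add: X_def)
  ultimately show ?thesis by (rule that)
qed

lemma geodesic_pointwise:
  assumes cog: "conformal_optical_geometry A \<C> F K" "g \<in> \<C>" "optical_vector_field A K k"
    and "geodesic_congruence A \<C> K"
    and \<phi>: "\<phi> \<in> A" "x \<in> chart_range \<phi>" and v: "lower g k \<phi> x \<bullet> v = 0"
  shows "(\<Sum>a\<in>UNIV. lie_form (k \<phi>) (lower g k \<phi>) x a * v $ a) = 0"
proof -
  obtain X where X: "section_of A (perp g K) X" "X \<phi> x = v"
    using perp_section_exists[OF cog \<phi> v] .
  then show ?thesis
    using assms(4)[unfolded geodesic_congruence_def, rule_format, OF cog(2,3) X(1) \<phi>] by simp
qed

text \<open>One function \<rho> on the manifold serves all charts and vectors, but nothing is known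
  about its regularity.\<close>

lemma nonshearing_pointwise:
  assumes cog: "conformal_optical_geometry A \<C> F K" "g \<in> \<C>" "optical_vector_field A K k"
    and "nonshearing_congruence A \<C> K"
  obtains \<rho> where "\<And>\<phi> x v w. \<phi> \<in> A \<Longrightarrow> x \<in> chart_range \<phi> \<Longrightarrow> lower g k \<phi> x \<bullet> v = 0 \<Longrightarrow>
    lower g k \<phi> x \<bullet> w = 0 \<Longrightarrow>
    ip (\<chi> a b. lie_metric (k \<phi>) (g \<phi>) x a b) v w = \<rho> (chart_inv \<phi> x) * ip (g \<phi> x) v w"
proof -
  obtain \<rho> where \<rho>: "\<forall>v w. section_of A (perp g K) v \<longrightarrow> section_of A (perp g K) w \<longrightarrow>
      (\<forall>\<phi>\<in>A. \<forall>x\<in>chart_range \<phi>.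
        (\<Sum>a\<in>UNIV. \<Sum>b\<in>UNIV. lie_metric (k \<phi>) (g \<phi>) x a b * v \<phi> x $ a * w \<phi> x $ b)
        = \<rho> (chart_inv \<phi> x) * ip (g \<phi> x) (v \<phi> x) (w \<phi> x))"
    using assms(4)[unfolded nonshearing_congruence_def, rule_format, OF cog(2,3)] by (rule exE)
  show ?thesis
  proof (rule that)
    fix \<phi> x v w
    assume \<phi>: "\<phi> \<in> A" "x \<in> chart_range \<phi>" and v: "lower g k \<phi> x \<bullet> v = 0" "lower g k \<phi> x \<bullet> w = 0"
    obtain X where "section_of A (perp g K) X" "X \<phi> x = v"
      using perp_section_exists[OF cog \<phi> v(1)] .
    moreover obtain Y where "section_of A (perp g K) Y" "Y \<phi> x = w"
      using perp_section_exists[OF cog \<phi> v(2)] .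
    ultimately show "ip (\<chi> a b. lie_metric (k \<phi>) (g \<phi>) x a b) v w = \<rho> (chart_inv \<phi> x) * ip (g \<phi> x) v w"
      using \<rho>[rule_format, of X Y \<phi> x] \<phi> by (simp add: ip_def)
  qed
qed

subsection \<open>Curvature in a chart\<close>

lemma
  assumes "open U" "x \<in> U" "\<And>y. y \<in> U \<Longrightarrow> f y = h y"
  shows pd_cong: "pd i f x = pd i h x"
    and differentiable_cong: "f differentiable (at x) \<longleftrightarrow> h differentiable (at x)"
proof -
  have "(f has_derivative D) (at x) \<longleftrightarrow> (h has_derivative D) (at x)" for D
    using has_derivative_transform_within_open[OF _ assms(1,2)] assms(3) by metis
  then show "pd i f x = pd i h x" "f differentiable (at x) \<longleftrightarrow> h differentiable (at x)"
    by (simp_all add: pd_def frechet_derivative_def differentiable_def)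
qed

lemma differentiable_has_derivative:
  "f differentiable (at x) \<Longrightarrow> (f has_derivative frechet_derivative f (at x)) (at x)"
  by (simp add: frechet_derivative_works)

lemma pd_const: "pd i (\<lambda>y. c) x = 0"
  by (simp add: pd_def)

lemma pd_add:
  assumes "f differentiable (at x)" "h differentiable (at x)"
  shows "pd i (\<lambda>y. f y + h y) x = pd i f x + pd i h x"
  using frechet_derivative_eqI[OF has_derivative_add[OF assms[THEN differentiable_has_derivative]]]
  by (simp add: pd_def)

lemma pd_diff:
  assumes "f differentiable (at x)" "h differentiable (at x)"
  shows "pd i (\<lambda>y. f y - h y) x = pd i f x - pd i h x"
  using frechet_derivative_eqI[OF has_derivative_diff[OF assms[THEN differentiable_has_derivative]]]
  by (simp add: pd_def)

lemma pd_mult: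
  assumes "f differentiable (at x)" "h differentiable (at x)"
  shows "pd i (\<lambda>y. f y * h y) x = pd i f x * h x + f x * pd i h x"
  using frechet_derivative_eqI[OF has_derivative_mult[OF assms[THEN differentiable_has_derivative]]]
  by (simp add: pd_def)

lemma pd_cmult:
  assumes "f differentiable (at x)"
  shows "pd i (\<lambda>y. c * f y) x = c * pd i f x"
  using pd_mult[OF differentiable_const assms, of i c] by (simp add: pd_const)

lemma pd_sum:
  assumes "finite I" "\<And>j. j \<in> I \<Longrightarrow> f j differentiable (at x)"
  shows "pd i (\<lambda>y. \<Sum>j\<in>I. f j y) x = (\<Sum>j\<in>I. pd i (f j) x)"
  using assms
proof (induction I)
  case (insert a I)
  then have "pd i (\<lambda>y. f a y + (\<Sum>j\<in>I. f j y)) x = pd i (f a) x + pd i (\<lambda>y. \<Sum>j\<in>I. f j y) x"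
    by (intro pd_add) auto
  then show ?case using insert by simp
qed (simp add: pd_const)

lemma differentiable_sum':
  assumes "\<And>i. i \<in> I \<Longrightarrow> f i differentiable (at x)"
  shows "(\<lambda>y. \<Sum>i\<in>I. f i y) differentiable (at x)"
  using assms by (induction I rule: infinite_finite_induct) auto

lemma differentiable_prod:
  fixes f :: "'i \<Rightarrow> 'a::real_normed_vector \<Rightarrow> real"
  assumes "\<And>i. i \<in> I \<Longrightarrow> f i differentiable (at x)"
  shows "(\<lambda>y. \<Prod>i\<in>I. f i y) differentiable (at x)"
  using assms by (induction I rule: infinite_finite_induct) auto

lemma differentiable_det:
  fixes M :: "'a::real_normed_vector \<Rightarrow> real^'n::finite^'n"
  assumes "\<And>i j. (\<lambda>y. M y $ i $ j) differentiable (at x)"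
  shows "(\<lambda>y. det (M y)) differentiable (at x)"
  unfolding det_def
  by (auto intro!: differentiable_sum differentiable_mult differentiable_prod assms)

text \<open>Christoffel symbols of the first kind. Working with them, the Riemann tensor with
  lowered index is computed without any formula for the derivative of the inverse metric.\<close>

definition christoffel_first :: "(real^'m::finite \<Rightarrow> real^'m^'m) \<Rightarrow> 'm \<Rightarrow> 'm \<Rightarrow> 'm \<Rightarrow> real^'m \<Rightarrow> real" where
  "christoffel_first G d b c x = (pd b (\<lambda>y. G y $ d $ c) x + pd c (\<lambda>y. G y $ d $ b) x - pd d (\<lambda>y. G y $ b $ c) x) / 2"

section \<open>Levi-Civita connection and Riemann tensor on an open set of coordinates\<close>

locale metric_chart =
  fixes U :: "(real^'m::finite) set" and G :: "real^'m \<Rightarrow> real^'m^'m"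
  assumes open_U: "open U"
    and smooth_G: "smooth_on U G"
    and sym_G: "\<And>y. y \<in> U \<Longrightarrow> transpose (G y) = G y"
    and inv_G: "\<And>y. y \<in> U \<Longrightarrow> invertible (G y)"
begin

lemma G_sym: "y \<in> U \<Longrightarrow> G y $ a $ b = G y $ b $ a"
  using sym_G[of y] by (metis transpose_def vec_lambda_beta)

lemma matrix_inv_G:
  assumes "y \<in> U"
  shows "G y ** matrix_inv (G y) = mat 1" "matrix_inv (G y) ** G y = mat 1"
  using someI_ex[OF inv_G[OF assms, unfolded invertible_def]] by (simp_all add: matrix_inv_def)

lemma ginv_G: "y \<in> U \<Longrightarrow> (\<Sum>c\<in>UNIV. ginv G y a c * G y $ c $ b) = (if a = b then 1 else 0)"
  and G_ginv: "y \<in> U \<Longrightarrow> (\<Sum>c\<in>UNIV. G y $ a $ c * ginv G y c b) = (if a = b then 1 else 0)"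
  using matrix_inv_G[of y] by (auto simp: ginv_def matrix_matrix_mult_def mat_def vec_eq_iff)

lemma ginv_sym:
  assumes "y \<in> U"
  shows "ginv G y a b = ginv G y b a"
proof -
  have "G y ** transpose (matrix_inv (G y)) = mat 1"
    using matrix_inv_G(2)[OF assms] sym_G[OF assms] by (metis matrix_transpose_mul transpose_mat)
  then have t: "transpose (matrix_inv (G y)) = matrix_inv (G y)"
    using matrix_inv_G(2)[OF assms] by (metis matrix_mul_assoc matrix_mul_lid matrix_mul_rid)
  have "ginv G y a b = transpose (matrix_inv (G y)) $ b $ a"
    by (simp add: ginv_def transpose_def)
  then show ?thesis by (simp add: t ginv_def)
qed

lemma raise_lower: "y \<in> U \<Longrightarrow> (\<Sum>c\<in>UNIV. ginv G y a c * (\<Sum>e\<in>UNIV. G y $ c $ e * v e)) = v a"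
proof -
  assume y: "y \<in> U"
  have "(\<Sum>c\<in>UNIV. ginv G y a c * (\<Sum>e\<in>UNIV. G y $ c $ e * v e))
      = (\<Sum>e\<in>UNIV. (\<Sum>c\<in>UNIV. ginv G y a c * G y $ c $ e) * v e)"
    by (simp add: sum_distrib_left sum_distrib_right mult.assoc) (rule sum.swap)
  also have "\<dots> = v a" by (simp add: ginv_G[OF y] if_distrib[of "\<lambda>z. z * _"] cong: if_cong)
  finally show ?thesis .
qed

lemma lower_raise: "y \<in> U \<Longrightarrow> (\<Sum>c\<in>UNIV. G y $ a $ c * (\<Sum>e\<in>UNIV. ginv G y c e * v e)) = v a"
proof -
  assume y: "y \<in> U"
  have "(\<Sum>c\<in>UNIV. G y $ a $ c * (\<Sum>e\<in>UNIV. ginv G y c e * v e))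
      = (\<Sum>e\<in>UNIV. (\<Sum>c\<in>UNIV. G y $ a $ c * ginv G y c e) * v e)"
    by (simp add: sum_distrib_left sum_distrib_right mult.assoc) (rule sum.swap)
  also have "\<dots> = v a" by (simp add: G_ginv[OF y] if_distrib[of "\<lambda>z. z * _"] cong: if_cong)
  finally show ?thesis .
qed

lemma smooth_G_entry: "smooth_on U (\<lambda>y. G y $ a $ b)"
  by (intro smooth_on_nth open_U smooth_G)

lemma differentiable_G: "y \<in> U \<Longrightarrow> (\<lambda>y. G y $ a $ b) differentiable (at y)"
  by (rule smooth_on_differentiable[OF smooth_G_entry])

lemma pd_G_sym: "y \<in> U \<Longrightarrow> pd i (\<lambda>y. G y $ a $ b) y = pd i (\<lambda>y. G y $ b $ a) y"
  by (rule pd_cong[OF open_U]) (auto intro: G_sym)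

lemma differentiable_pd_G: "y \<in> U \<Longrightarrow> pd i (\<lambda>y. G y $ a $ b) differentiable (at y)"
  by (rule smooth_on_differentiable[OF smooth_on_pd[OF smooth_G_entry]])

text \<open>By Cramer's rule an entry of the inverse is a quotient of two determinants, each
  differentiable in the entries of \<open>G\<close>.\<close>

lemma differentiable_ginv:
  assumes "x \<in> U"
  shows "(\<lambda>y. ginv G y a b) differentiable (at x)"
proof -
  let ?M = "\<lambda>y. (\<chi> i j. if j = a then (axis b 1 :: real^'m) $ i else G y $ i $ j) :: real^'m^'m"
  have ne: "det (G y) \<noteq> 0" if "y \<in> U" for y
    using inv_G[OF that] by (simp add: invertible_det_nz)
  have eq: "ginv G y a b = det (?M y) / det (G y)" if "y \<in> U" for y
  proof -
    have "G y *v (matrix_inv (G y) *v axis b 1) = axis b 1"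
      by (simp add: matrix_vector_mul_assoc matrix_inv_G[OF that])
    then have "matrix_inv (G y) *v axis b 1
        = (\<chi> k. det (\<chi> i j. if j = k then (axis b 1 :: real^'m) $ i else G y $ i $ j) / det (G y))"
      by (rule cramer[OF ne[OF that], THEN iffD1])
    then have "(matrix_inv (G y) *v axis b 1) $ a = det (?M y) / det (G y)" by simp
    then show ?thesis by (simp add: ginv_def matrix_vector_mul_component inner_axis)
  qed
  have "(\<lambda>y. ?M y $ i $ j) differentiable (at x)" for i j
    by (cases "j = a") (simp_all add: differentiable_G[OF assms])
  then have d: "(\<lambda>y. det (?M y)) differentiable (at x)" by (rule differentiable_det)
  have "(\<lambda>y. det (?M y) / det (G y)) differentiable (at x)"
    by (intro differentiable_divide d differentiable_det differentiable_G assms ne)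
  then show ?thesis
    using differentiable_cong[OF open_U assms, of "\<lambda>y. ginv G y a b" "\<lambda>y. det (?M y) / det (G y)"] eq
    by simp
qed

lemma christoffel_raise: "christoffel G a b c y = (\<Sum>d\<in>UNIV. ginv G y a d * christoffel_first G d b c y)"
  by (simp add: christoffel_def christoffel_first_def sum_distrib_left)

lemma christoffel_lower:
  "y \<in> U \<Longrightarrow> (\<Sum>a\<in>UNIV. G y $ d $ a * christoffel G a b c y) = christoffel_first G d b c y"
  by (simp add: christoffel_raise lower_raise)

lemma christoffel_first_sym: "y \<in> U \<Longrightarrow> christoffel_first G d b c y = christoffel_first G d c b y"
  using pd_G_sym[of y d b c] by (simp add: christoffel_first_def)

text \<open>Metric compatibility of the connection, written in coordinates.\<close>

lemma pd_G: "y \<in> U \<Longrightarrow> pd a (\<lambda>y. G y $ c $ d) y = christoffel_first G c a d y + christoffel_first G d a c y"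
  using pd_G_sym[of y a d c] pd_G_sym[of y c a d] pd_G_sym[of y d a c] by (simp add: christoffel_first_def field_simps)

lemma differentiable_christoffel_first: "y \<in> U \<Longrightarrow> christoffel_first G d b c differentiable (at y)"
  unfolding christoffel_first_def[abs_def]
  by (intro differentiable_divide differentiable_diff differentiable_add differentiable_pd_G) auto

lemma differentiable_christoffel: "y \<in> U \<Longrightarrow> christoffel G a b c differentiable (at y)"
  unfolding christoffel_raise[abs_def]
  by (intro differentiable_sum' differentiable_mult differentiable_ginv differentiable_christoffel_first)

text \<open>Pulling the lowering metric inside the derivative costs a derivative of
  \<open>G\<close>, a sum of two first-kind symbols. One of them cancels the quadratic terms of
  \<open>riemann_up\<close>, the other produces the quadratic terms displayed.\<close>

lemma riemann_christoffel_first: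
  assumes x: "x \<in> U"
  shows "riemann G x a b c d = pd a (christoffel_first G c b d) x - pd b (christoffel_first G c a d) x
    - (\<Sum>e\<in>UNIV. christoffel_first G e a c x * christoffel G e b d x)
    + (\<Sum>e\<in>UNIV. christoffel_first G e b c x * christoffel G e a d x)"
proof -
  have 1: "(\<Sum>e\<in>UNIV. G x $ c $ e * pd a (christoffel G e b d) x)
      = pd a (christoffel_first G c b d) x - (\<Sum>e\<in>UNIV. (christoffel_first G c a e x + christoffel_first G e a c x) * christoffel G e b d x)"
    for a b
  proof -
    have "pd a (christoffel_first G c b d) x = pd a (\<lambda>y. \<Sum>e\<in>UNIV. G y $ c $ e * christoffel G e b d y) x"
      by (rule pd_cong[OF open_U x]) (simp add: christoffel_lower)
    also have "\<dots> = (\<Sum>e\<in>UNIV. pd a (\<lambda>y. G y $ c $ e * christoffel G e b d y) x)"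
      by (intro pd_sum differentiable_mult differentiable_G differentiable_christoffel x) simp
    also have "\<dots> = (\<Sum>e\<in>UNIV. (christoffel_first G c a e x + christoffel_first G e a c x) * christoffel G e b d x
        + G x $ c $ e * pd a (christoffel G e b d) x)"
      by (simp add: pd_mult differentiable_G differentiable_christoffel x pd_G)
    finally show ?thesis by (simp add: sum.distrib)
  qed
  have 2: "(\<Sum>e\<in>UNIV. G x $ c $ e * (\<Sum>q\<in>UNIV. christoffel G e a q x * christoffel G q b d x))
      = (\<Sum>q\<in>UNIV. christoffel_first G c a q x * christoffel G q b d x)" for a b
  proof -
    have "(\<Sum>e\<in>UNIV. G x $ c $ e * (\<Sum>q\<in>UNIV. christoffel G e a q x * christoffel G q b d x))
        = (\<Sum>q\<in>UNIV. (\<Sum>e\<in>UNIV. G x $ c $ e * christoffel G e a q x) * christoffel G q b d x)"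
      by (simp add: sum_distrib_left sum_distrib_right mult.assoc) (rule sum.swap)
    then show ?thesis by (simp add: christoffel_lower x)
  qed
  have "riemann G x a b c d = (\<Sum>e\<in>UNIV. G x $ c $ e * pd a (christoffel G e b d) x)
      - (\<Sum>e\<in>UNIV. G x $ c $ e * pd b (christoffel G e a d) x)
      + (\<Sum>e\<in>UNIV. G x $ c $ e * (\<Sum>q\<in>UNIV. christoffel G e a q x * christoffel G q b d x))
      - (\<Sum>e\<in>UNIV. G x $ c $ e * (\<Sum>q\<in>UNIV. christoffel G e b q x * christoffel G q a d x))"
    by (simp add: riemann_def riemann_up_def sum_subtractf sum.distrib ring_distribs)
  then show ?thesis
    unfolding 1 2 by (simp add: sum.distrib distrib_right)
qed

text \<open>The part symmetric in c, d of the derivative terms is a commutator of second derivatives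
  of G_cd, and the quadratic terms are values of a symmetric pairing of first-kind symbols. Both
  contributions drop out.\<close>

lemma riemann_antisym:
  assumes x: "x \<in> U"
  shows "riemann G x a b c d = - riemann G x a b d c"
proof -
  define X where "X a c b d = (\<Sum>e\<in>UNIV. christoffel_first G e a c x * christoffel G e b d x)" for a c b d
  have X: "X a c b d = X b d a c" for a b c d
  proof -
    have "X a c b d = (\<Sum>e\<in>UNIV. \<Sum>q\<in>UNIV. G x $ e $ q * christoffel G q a c x * christoffel G e b d x)"
      by (simp add: X_def christoffel_lower[OF x, symmetric] sum_distrib_right)
    also have "\<dots> = (\<Sum>q\<in>UNIV. \<Sum>e\<in>UNIV. G x $ q $ e * christoffel G e b d x * christoffel G q a c x)"
      by (subst sum.swap) (simp add: G_sym[OF x] mult_ac)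
    also have "\<dots> = X b d a c"
      by (simp add: X_def christoffel_lower[OF x, symmetric] sum_distrib_right)
    finally show ?thesis .
  qed
  have P: "pd a (christoffel_first G c b d) x + pd a (christoffel_first G d b c) x = pd a (pd b (\<lambda>y. G y $ c $ d)) x" for a b
  proof -
    have "pd a (pd b (\<lambda>y. G y $ c $ d)) x = pd a (\<lambda>y. christoffel_first G c b d y + christoffel_first G d b c y) x"
      by (rule pd_cong[OF open_U x]) (rule pd_G)
    then show ?thesis by (simp add: pd_add differentiable_christoffel_first x)
  qed
  have "riemann G x a b c d + riemann G x a b d c = 0"
    using P[of a b] P[of b a] pd_commute[OF open_U smooth_G_entry x, of a b c d]
      X[of a c b d] X[of b c a d]
    by (simp add: riemann_christoffel_first[OF x] X_def[symmetric])
  then show ?thesis by simp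
qed

lemma differentiable_nabla_form:
  assumes "smooth_on U \<alpha>" "x \<in> U"
  shows "(\<lambda>y. nabla_form G \<alpha> y b c) differentiable (at x)"
proof -
  have s: "smooth_on U (\<lambda>y. \<alpha> y $ c)" for c by (intro smooth_on_nth open_U assms)
  show ?thesis
    unfolding nabla_form_def
    by (intro differentiable_diff differentiable_sum' differentiable_mult assms(2)
        differentiable_christoffel smooth_on_differentiable[OF smooth_on_pd[OF s]]
        smooth_on_differentiable[OF s])
qed

text \<open>The Ricci identity for one-forms, with the terms in \<open>\<Gamma>\<^sup>q\<^sub>e\<^sub>b\<close> already cancelled.\<close>

lemma ricci_identity_form:
  assumes \<alpha>: "smooth_on U \<alpha>" and x: "x \<in> U"
  shows "(\<Sum>p\<in>UNIV. \<alpha> x $ p * riemann_up G x b e p c)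
    = pd e (\<lambda>y. nabla_form G \<alpha> y b c) x - pd b (\<lambda>y. nabla_form G \<alpha> y e c) x
      - (\<Sum>q\<in>UNIV. nabla_form G \<alpha> x b q * christoffel G q e c x)
      + (\<Sum>q\<in>UNIV. nabla_form G \<alpha> x e q * christoffel G q b c x)"
proof -
  have s: "smooth_on U (\<lambda>y. \<alpha> y $ c)" for c by (intro smooth_on_nth open_U \<alpha>)
  note d = smooth_on_differentiable[OF s x] smooth_on_differentiable[OF smooth_on_pd[OF s] x]
    differentiable_christoffel[OF x]
  have 1: "pd e (\<lambda>y. nabla_form G \<alpha> y b c) x = pd e (pd b (\<lambda>y. \<alpha> y $ c)) x
      - (\<Sum>p\<in>UNIV. pd e (christoffel G p b c) x * \<alpha> x $ p)
      - (\<Sum>p\<in>UNIV. christoffel G p b c x * pd e (\<lambda>y. \<alpha> y $ p) x)" for b e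
  proof -
    have "pd e (\<lambda>y. nabla_form G \<alpha> y b c) x = pd e (pd b (\<lambda>y. \<alpha> y $ c)) x
        - pd e (\<lambda>y. \<Sum>p\<in>UNIV. christoffel G p b c y * \<alpha> y $ p) x"
      unfolding nabla_form_def
      by (intro pd_diff differentiable_sum' differentiable_mult d)
    also have "pd e (\<lambda>y. \<Sum>p\<in>UNIV. christoffel G p b c y * \<alpha> y $ p) x
        = (\<Sum>p\<in>UNIV. pd e (\<lambda>y. christoffel G p b c y * \<alpha> y $ p) x)"
      by (intro pd_sum differentiable_mult d) simp
    finally show ?thesis by (simp add: pd_mult d sum.distrib)
  qed
  have 2: "(\<Sum>q\<in>UNIV. nabla_form G \<alpha> x b q * christoffel G q e c x)
      = (\<Sum>p\<in>UNIV. christoffel G p e c x * pd b (\<lambda>y. \<alpha> y $ p) x)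
        - (\<Sum>p\<in>UNIV. \<alpha> x $ p * (\<Sum>q\<in>UNIV. christoffel G p b q x * christoffel G q e c x))" for b e
  proof -
    have "(\<Sum>q\<in>UNIV. (\<Sum>p\<in>UNIV. christoffel G p b q x * \<alpha> x $ p) * christoffel G q e c x)
        = (\<Sum>p\<in>UNIV. \<alpha> x $ p * (\<Sum>q\<in>UNIV. christoffel G p b q x * christoffel G q e c x))"
      unfolding sum_distrib_left sum_distrib_right by (subst sum.swap) (simp add: mult_ac)
    then show ?thesis
      by (simp add: nabla_form_def left_diff_distrib right_diff_distrib sum_subtractf mult.commute)
  qed
  have "(\<Sum>p\<in>UNIV. \<alpha> x $ p * riemann_up G x b e p c)
    = (\<Sum>p\<in>UNIV. pd b (christoffel G p e c) x * \<alpha> x $ p) - (\<Sum>p\<in>UNIV. pd e (christoffel G p b c) x * \<alpha> x $ p)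
      + (\<Sum>p\<in>UNIV. \<alpha> x $ p * (\<Sum>q\<in>UNIV. christoffel G p b q x * christoffel G q e c x))
      - (\<Sum>p\<in>UNIV. \<alpha> x $ p * (\<Sum>q\<in>UNIV. christoffel G p e q x * christoffel G q b c x))"
    by (simp add: riemann_up_def sum_subtractf sum.distrib ring_distribs mult.commute)
  then show ?thesis
    unfolding 1 2 using pd_commute[OF open_U s[of c] x, of b e] by simp
qed

end

subsection \<open>Algebra of null one-forms\<close>

text \<open>Everything that happens at one point, separated from the calculus: \<open>H\<close> is
  the inverse metric, \<open>F\<close> half the exterior derivative of \<kappa>, and
  \<open>k_F\<close> the geodesic condition.\<close>

locale null_algebra =
  fixes H G F :: "'m::finite \<Rightarrow> 'm \<Rightarrow> real" and \<kappa> k :: "'m \<Rightarrow> real" and \<mu> :: real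
  assumes H_sym: "H a b = H b a"
    and G_sym: "G a b = G b a"
    and H_G: "(\<Sum>c\<in>UNIV. H a c * G c b) = (if a = b then 1 else 0)"
    and raise_\<kappa>: "(\<Sum>b\<in>UNIV. H a b * \<kappa> b) = k a"
    and null: "(\<Sum>a\<in>UNIV. \<kappa> a * k a) = 0"
    and F_anti: "F a b = - F b a"
    and k_F: "(\<Sum>e\<in>UNIV. k e * F e c) = \<mu> / 2 * \<kappa> c"
begin

definition cometric :: "('m \<Rightarrow> real) \<Rightarrow> ('m \<Rightarrow> real) \<Rightarrow> real" where
  "cometric u v = (\<Sum>a\<in>UNIV. \<Sum>b\<in>UNIV. H a b * u a * v b)"

lemma cometric_commute: "cometric u v = cometric v u"
  unfolding cometric_def by (subst sum.swap) (simp add: H_sym mult_ac)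

lemma cometric_linear:
  "cometric (\<lambda>e. u e + v e) w = cometric u w + cometric v w" "cometric w (\<lambda>e. u e + v e) = cometric w u + cometric w v"
  "cometric (\<lambda>e. u e - v e) w = cometric u w - cometric v w" "cometric w (\<lambda>e. u e - v e) = cometric w u - cometric w v"
  "cometric (\<lambda>e. c * u e) w = c * cometric u w" "cometric w (\<lambda>e. c * u e) = c * cometric w u"
  "cometric (\<lambda>e. u e * c) w = c * cometric u w" "cometric w (\<lambda>e. u e * c) = c * cometric w u"
  by (simp_all add: cometric_def ring_distribs sum.distrib sum_subtractf sum_distrib_left mult_ac)

lemma cometric_G: "cometric (G b) v = v b"
proof -
  have "cometric (G b) v = (\<Sum>q\<in>UNIV. (\<Sum>p\<in>UNIV. H q p * G p b) * v q)"
    unfolding cometric_def by (subst sum.swap) (simp add: sum_distrib_right H_sym[of _ q for q] G_sym[of b])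
  then show ?thesis by (simp add: H_G if_distrib[of "\<lambda>z. z * _"] cong: if_cong)
qed

lemma cometric_\<kappa>: "cometric \<kappa> v = (\<Sum>e\<in>UNIV. k e * v e)"
proof -
  have "cometric \<kappa> v = cometric v \<kappa>" by (rule cometric_commute)
  also have "\<dots> = (\<Sum>a\<in>UNIV. (\<Sum>b\<in>UNIV. H a b * \<kappa> b) * v a)"
    by (simp add: cometric_def sum_distrib_left mult_ac)
  finally show ?thesis by (simp add: raise_\<kappa>)
qed

lemma cometric_\<kappa>_\<kappa>: "cometric \<kappa> \<kappa> = 0"
  using null by (simp add: cometric_\<kappa> mult.commute)

lemma k_F': "(\<Sum>e\<in>UNIV. k e * F c e) = - (\<mu> / 2 * \<kappa> c)"
  unfolding F_anti[of c] by (simp add: sum_negf k_F)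

lemma cometric_\<kappa>_F: "cometric \<kappa> (F c) = - (\<mu> / 2 * \<kappa> c)" "cometric (F c) \<kappa> = - (\<mu> / 2 * \<kappa> c)"
  using cometric_commute[of "F c" \<kappa>] by (simp_all add: cometric_\<kappa> k_F')

lemma k_cometric_F: "(\<Sum>p\<in>UNIV. k p * cometric (F p) v) = \<mu> / 2 * cometric \<kappa> v"
proof -
  have "(\<Sum>p\<in>UNIV. k p * cometric (F p) v) = (\<Sum>p\<in>UNIV. \<Sum>a\<in>UNIV. \<Sum>b\<in>UNIV. H a b * (k p * F p a) * v b)"
    by (simp add: cometric_def sum_distrib_left mult_ac)
  also have "\<dots> = (\<Sum>a\<in>UNIV. \<Sum>p\<in>UNIV. \<Sum>b\<in>UNIV. H a b * (k p * F p a) * v b)"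
    by (rule sum.swap)
  also have "\<dots> = (\<Sum>a\<in>UNIV. \<Sum>b\<in>UNIV. \<Sum>p\<in>UNIV. H a b * (k p * F p a) * v b)"
    by (intro sum.cong refl sum.swap)
  also have "\<dots> = cometric (\<lambda>a. \<Sum>p\<in>UNIV. k p * F p a) v"
    by (simp add: cometric_def sum_distrib_left sum_distrib_right)
  finally show ?thesis by (simp only: k_F cometric_linear)
qed

text \<open>The full contraction F_ab F^ab. It is smaller than the squared norm of F on K^perp/K by
  \<mu>^2/2, which is due to the component of F on k and a transverse null vector.\<close>

definition F_norm :: real where
  "F_norm = (\<Sum>e\<in>UNIV. \<Sum>p\<in>UNIV. H e p * cometric (F p) (F e))"

text \<open>The wedge product of \<kappa> and F. With the last argument open it is a covector, so
  that contractions over that index become \<open>cometric\<close>.\<close>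

definition \<kappa>F :: "'m \<Rightarrow> 'm \<Rightarrow> 'm \<Rightarrow> real" where
  "\<kappa>F a b c = \<kappa> a * F b c - \<kappa> b * F a c + \<kappa> c * F a b"

text \<open>The summands F_ab \<kappa> and F_cd \<kappa> drop out: \<kappa> is null, and pairing
  \<kappa> with F returns a multiple of \<kappa>, so the cross terms contain a product of two
  components of \<kappa> skewed in its indices.\<close>

lemma cometric_\<kappa>F: "cometric (\<kappa>F a b) (\<kappa>F c d) = \<kappa> a * \<kappa> c * cometric (F b) (F d) - \<kappa> a * \<kappa> d * cometric (F b) (F c)
    - \<kappa> b * \<kappa> c * cometric (F a) (F d) + \<kappa> b * \<kappa> d * cometric (F a) (F c)"
  by (simp add: \<kappa>F_def[abs_def] cometric_linear cometric_\<kappa>_\<kappa> cometric_\<kappa>_F algebra_simps)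

text \<open>The term without F contraction to k gives \<open>F_norm\<close>; each of the two cross
  terms contracts k with F twice and adds \<mu>^2/4; the last term vanishes because \<kappa> is
  null.\<close>

lemma contract_\<kappa>F:
  "(\<Sum>e\<in>UNIV. \<Sum>p\<in>UNIV. H e p * cometric (\<kappa>F a p) (\<kappa>F d e)) = (F_norm + \<mu>\<^sup>2 / 2) * \<kappa> a * \<kappa> d"
proof -
  have 1: "(\<Sum>e\<in>UNIV. \<Sum>p\<in>UNIV. H e p * (\<kappa> e * cometric (F p) (F d))) = - (\<mu>\<^sup>2 / 4 * \<kappa> d)" for d
  proof -
    have "(\<Sum>e\<in>UNIV. \<Sum>p\<in>UNIV. H e p * (\<kappa> e * cometric (F p) (F d))) = cometric \<kappa> (\<lambda>p. cometric (F p) (F d))"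
      by (simp add: cometric_def[of \<kappa>] mult.assoc)
    also have "\<dots> = \<mu> / 2 * cometric \<kappa> (F d)" by (simp only: cometric_\<kappa>[of "\<lambda>p. cometric (F p) (F d)"] k_cometric_F)
    finally show ?thesis by (simp add: cometric_\<kappa>_F power2_eq_square)
  qed
  have 2: "(\<Sum>e\<in>UNIV. \<Sum>p\<in>UNIV. H e p * (\<kappa> p * cometric (F d) (F e))) = - (\<mu>\<^sup>2 / 4 * \<kappa> d)" for d
    using 1[of d] by (subst sum.swap) (simp add: H_sym cometric_commute[of "F d"])
  have 3: "(\<Sum>e\<in>UNIV. \<Sum>p\<in>UNIV. H e p * (\<kappa> e * \<kappa> p)) = 0"
    using cometric_\<kappa>_\<kappa> by (simp add: cometric_def mult.assoc)
  have "(\<Sum>e\<in>UNIV. \<Sum>p\<in>UNIV. H e p * cometric (\<kappa>F a p) (\<kappa>F d e))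
     = \<kappa> a * \<kappa> d * F_norm - \<kappa> a * (\<Sum>e\<in>UNIV. \<Sum>p\<in>UNIV. H e p * (\<kappa> e * cometric (F p) (F d)))
       - \<kappa> d * (\<Sum>e\<in>UNIV. \<Sum>p\<in>UNIV. H e p * (\<kappa> p * cometric (F a) (F e)))
       + cometric (F a) (F d) * (\<Sum>e\<in>UNIV. \<Sum>p\<in>UNIV. H e p * (\<kappa> e * \<kappa> p))"
    by (simp add: cometric_\<kappa>F F_norm_def ring_distribs sum.distrib sum_subtractf sum_distrib_left mult_ac)
  then show ?thesis unfolding 1 2 3 by (simp add: algebra_simps)
qed

text \<open>Contraction with k on either side shows that \<kappa> pairs with \<alpha> and with
  \<beta> to -\<sigma> - \<mu>^2/4. These two pairings enter the trace and lower the coefficient of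
  \<sigma> from the dimension to the rank of K^perp/K.\<close>

lemma trace_form:
  assumes N: "\<And>b c. N b c = \<sigma> * G b c + \<kappa> b * \<alpha> c + \<beta> b * \<kappa> c - cometric (F b) (F c)"
    and N1: "\<And>c. (\<Sum>b\<in>UNIV. N b c * k b) = 0" and N2: "\<And>b. (\<Sum>c\<in>UNIV. N b c * k c) = 0"
    and ne: "\<exists>a. \<kappa> a \<noteq> 0"
  shows "(\<Sum>b\<in>UNIV. \<Sum>c\<in>UNIV. H b c * N b c) = (real CARD('m) - 2) * \<sigma> - F_norm - \<mu>\<^sup>2 / 2"
proof -
  obtain a where a: "\<kappa> a \<noteq> 0" using ne by blast
  have low: "(\<Sum>c\<in>UNIV. k c * G b c) = \<kappa> b" for b
    using cometric_G[of b \<kappa>] cometric_commute[of \<kappa> "G b"] by (simp add: cometric_\<kappa>)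
  have "(\<Sum>c\<in>UNIV. N b c * k c) = \<sigma> * (\<Sum>c\<in>UNIV. k c * G b c) + \<kappa> b * (\<Sum>c\<in>UNIV. k c * \<alpha> c)
      + \<beta> b * (\<Sum>c\<in>UNIV. \<kappa> c * k c) - (\<Sum>c\<in>UNIV. k c * cometric (F c) (F b))" for b
    by (simp add: N ring_distribs sum.distrib sum_subtractf sum_distrib_left mult_ac cometric_commute[of "F b"])
  then have "0 = \<kappa> a * (\<sigma> + cometric \<kappa> \<alpha> + \<mu>\<^sup>2 / 4)"
    unfolding N2 low null k_cometric_F cometric_\<kappa>_F cometric_\<kappa>[of \<alpha>] by (simp add: power2_eq_square algebra_simps)
  then have 1: "\<sigma> + cometric \<kappa> \<alpha> + \<mu>\<^sup>2 / 4 = 0" using a by simp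
  have "(\<Sum>b\<in>UNIV. N b c * k b) = \<sigma> * (\<Sum>b\<in>UNIV. k b * G c b) + \<kappa> c * (\<Sum>b\<in>UNIV. k b * \<beta> b)
      + \<alpha> c * (\<Sum>b\<in>UNIV. \<kappa> b * k b) - (\<Sum>b\<in>UNIV. k b * cometric (F b) (F c))" for c
    by (simp add: N ring_distribs sum.distrib sum_subtractf sum_distrib_left mult_ac G_sym[of c])
  then have "0 = \<kappa> a * (\<sigma> + cometric \<kappa> \<beta> + \<mu>\<^sup>2 / 4)"
    unfolding N1 low null k_cometric_F cometric_\<kappa>_F cometric_\<kappa>[of \<beta>] by (simp add: power2_eq_square algebra_simps)
  then have 2: "\<sigma> + cometric \<kappa> \<beta> + \<mu>\<^sup>2 / 4 = 0" using a by simp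
  have 3: "(\<Sum>b\<in>UNIV. \<Sum>c\<in>UNIV. H b c * G b c) = real CARD('m)"
  proof -
    have "(\<Sum>b\<in>UNIV. \<Sum>c\<in>UNIV. H b c * G b c) = (\<Sum>b\<in>UNIV. \<Sum>c\<in>UNIV. H b c * G c b)"
      by (simp add: G_sym)
    then show ?thesis by (simp add: H_G)
  qed
  have 4: "(\<Sum>b\<in>UNIV. \<Sum>c\<in>UNIV. H b c * cometric (F b) (F c)) = F_norm"
    unfolding F_norm_def by (simp add: cometric_commute)
  have "(\<Sum>b\<in>UNIV. \<Sum>c\<in>UNIV. H b c * N b c) = \<sigma> * (\<Sum>b\<in>UNIV. \<Sum>c\<in>UNIV. H b c * G b c) + cometric \<kappa> \<alpha>
      + cometric \<beta> \<kappa> - (\<Sum>b\<in>UNIV. \<Sum>c\<in>UNIV. H b c * cometric (F b) (F c))"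
    unfolding cometric_def[of \<kappa>] cometric_def[of \<beta>]
    by (simp add: N ring_distribs sum.distrib sum_subtractf sum_distrib_left mult_ac)
  then show ?thesis
    unfolding 3 4 using 1 2 by (simp add: cometric_commute[of \<beta>] algebra_simps)
qed

text \<open>The \<alpha> and \<beta> terms contain \<kappa>_a \<kappa>_b or \<kappa>_c \<kappa>_d
  and die under skew-symmetrisation. The minus sign of the FF term is absorbed by \<kappa>_d
  standing last in its pair.\<close>

lemma tracefree_identity:
  assumes M: "\<And>b c. M b c = \<kappa> b * \<alpha> c + \<beta> b * \<kappa> c - cometric (F b) (F c) + (F_norm + \<mu>\<^sup>2 / 2) / n * G b c"
  shows "4 * alt22 (\<lambda>a b c d. \<kappa> a * M b c * \<kappa> d) a b c d
    = cometric (\<kappa>F a b) (\<kappa>F c d)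
      + 4 / n * alt22 (\<lambda>a b c d. (\<Sum>e\<in>UNIV. \<Sum>p\<in>UNIV. H e p * cometric (\<kappa>F a p) (\<kappa>F d e)) * G b c) a b c d"
proof -
  define q where "q = (F_norm + \<mu>\<^sup>2 / 2) / n"
  have *: "4 / n * alt22 (\<lambda>a b c d. (F_norm + \<mu>\<^sup>2 / 2) * \<kappa> a * \<kappa> d * G b c) a b c d
      = 4 * alt22 (\<lambda>a b c d. q * \<kappa> a * \<kappa> d * G b c) a b c d"
    \<comment> \<open>For n = 0 both sides are 0, since division by 0 returns 0.\<close>
    unfolding q_def alt22_def alt2_def by (cases "n = 0") (simp_all add: field_simps)
  show ?thesis
    unfolding contract_\<kappa>F * unfolding cometric_\<kappa>F M q_def[symmetric]
    by (simp add: alt22_def alt2_def field_simps)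
qed

end

subsection \<open>Curvature along a shear-free null congruence\<close>

locale optical_chart = metric_chart U G for U :: "(real^'m::finite) set" and G +
  fixes k :: "real^'m \<Rightarrow> real^'m"
  assumes smooth_k: "smooth_on U k"
    and null_k: "\<And>y. y \<in> U \<Longrightarrow> (G y *v k y) \<bullet> k y = 0"
begin

definition \<kappa> :: "real^'m \<Rightarrow> real^'m" where "\<kappa> y = G y *v k y"

definition B :: "'m \<Rightarrow> 'm \<Rightarrow> real^'m \<Rightarrow> real" where "B b c y = nabla_form G \<kappa> y b c"

text \<open>Half the exterior derivative, with partial derivatives: the Christoffel symbols would
  cancel by symmetry, and closedness becomes a matter of commuting second derivatives.\<close>

definition F :: "'m \<Rightarrow> 'm \<Rightarrow> real^'m \<Rightarrow> real" where
  "F b c y = (pd b (\<lambda>y. \<kappa> y $ c) y - pd c (\<lambda>y. \<kappa> y $ b) y) / 2"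

lemma \<kappa>_nth: "\<kappa> y $ a = (\<Sum>e\<in>UNIV. G y $ a $ e * k y $ e)"
  by (simp add: \<kappa>_def matrix_vector_mult_def)

lemma smooth_\<kappa>: "smooth_on U \<kappa>"
  unfolding \<kappa>_def[abs_def] by (intro smooth_on_matrix_vector_mult open_U smooth_G smooth_k)

lemma smooth_entries: "smooth_on U (\<lambda>y. \<kappa> y $ a)" "smooth_on U (\<lambda>y. k y $ a)"
  by (intro smooth_on_nth open_U smooth_\<kappa> smooth_k)+

lemma differentiable_entries:
  assumes "y \<in> U"
  shows "(\<lambda>y. \<kappa> y $ a) differentiable (at y)" "(\<lambda>y. k y $ a) differentiable (at y)"
    "pd i (\<lambda>y. \<kappa> y $ a) differentiable (at y)" "pd i (\<lambda>y. k y $ a) differentiable (at y)"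
    "B b c differentiable (at y)" "F b c differentiable (at y)"
proof -
  show 1: "(\<lambda>y. \<kappa> y $ a) differentiable (at y)" "(\<lambda>y. k y $ a) differentiable (at y)"
    "pd i (\<lambda>y. \<kappa> y $ a) differentiable (at y)" "pd i (\<lambda>y. k y $ a) differentiable (at y)" for i a
    by (rule smooth_on_differentiable[OF _ assms], intro smooth_on_pd smooth_entries)+
  show "B b c differentiable (at y)"
    unfolding B_def[abs_def] by (rule differentiable_nabla_form[OF smooth_\<kappa> assms])
  show "F b c differentiable (at y)"
    unfolding F_def[abs_def] by (intro differentiable_divide differentiable_diff 1) auto
qed

lemma null: "y \<in> U \<Longrightarrow> (\<Sum>a\<in>UNIV. \<kappa> y $ a * k y $ a) = 0"
  using null_k[of y] by (simp add: \<kappa>_def inner_vec_def)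

lemma F_anti: "F b c y = - F c b y"
  by (simp add: F_def minus_divide_left)

lemma pd_\<kappa>: "y \<in> U \<Longrightarrow> pd i (\<lambda>y. \<kappa> y $ a) y
    = (\<Sum>e\<in>UNIV. pd i (\<lambda>y. G y $ a $ e) y * k y $ e + G y $ a $ e * pd i (\<lambda>y. k y $ e) y)"
proof -
  assume y: "y \<in> U"
  have "pd i (\<lambda>y. \<kappa> y $ a) y = pd i (\<lambda>y. \<Sum>e\<in>UNIV. G y $ a $ e * k y $ e) y"
    by (simp add: \<kappa>_nth)
  also have "\<dots> = (\<Sum>e\<in>UNIV. pd i (\<lambda>y. G y $ a $ e * k y $ e) y)"
    by (intro pd_sum differentiable_mult differentiable_G differentiable_entries y) simp
  finally show ?thesis by (simp add: pd_mult differentiable_G differentiable_entries y)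
qed

lemma B_christoffel_first: "y \<in> U \<Longrightarrow> B b c y = pd b (\<lambda>y. \<kappa> y $ c) y - (\<Sum>q\<in>UNIV. k y $ q * christoffel_first G q b c y)"
proof -
  assume y: "y \<in> U"
  have "(\<Sum>p\<in>UNIV. christoffel G p b c y * \<kappa> y $ p)
      = (\<Sum>p\<in>UNIV. \<Sum>q\<in>UNIV. k y $ q * (G y $ q $ p * christoffel G p b c y))"
    by (simp add: \<kappa>_nth sum_distrib_left G_sym[OF y] mult_ac)
  also have "\<dots> = (\<Sum>q\<in>UNIV. k y $ q * christoffel_first G q b c y)"
    by (subst sum.swap) (simp add: sum_distrib_left[symmetric] christoffel_lower y)
  finally show ?thesis by (simp add: B_def nabla_form_def)
qed

lemma B_split: "y \<in> U \<Longrightarrow> B b c y = lie_metric k G y b c / 2 + F b c y"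
proof -
  assume y: "y \<in> U"
  have g: "G y $ e $ c = G y $ c $ e" for e c by (rule G_sym[OF y])
  have pg: "pd i (\<lambda>y. G y $ e $ c) y = pd i (\<lambda>y. G y $ c $ e) y" for i e c by (rule pd_G_sym[OF y])
  have "2 * B b c y - lie_metric k G y b c - 2 * F b c y
     = pd b (\<lambda>y. \<kappa> y $ c) y + pd c (\<lambda>y. \<kappa> y $ b) y
       - 2 * (\<Sum>q\<in>UNIV. k y $ q * christoffel_first G q b c y) - lie_metric k G y b c"
    by (simp add: B_christoffel_first[OF y] F_def field_simps)
  also have "\<dots> = (\<Sum>e\<in>UNIV. pd b (\<lambda>y. G y $ c $ e) y * k y $ e + G y $ c $ e * pd b (\<lambda>y. k y $ e) y
       + (pd c (\<lambda>y. G y $ b $ e) y * k y $ e + G y $ b $ e * pd c (\<lambda>y. k y $ e) y)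
       - 2 * (k y $ e * christoffel_first G e b c y)
       - (k y $ e * pd e (\<lambda>y. G y $ b $ c) y + G y $ e $ c * pd b (\<lambda>y. k y $ e) y
          + G y $ b $ e * pd c (\<lambda>y. k y $ e) y))"
    unfolding pd_\<kappa>[OF y] lie_metric_def sum_distrib_left sum.distrib[symmetric] sum_subtractf[symmetric]
    by (rule refl)
  also have "\<dots> = 0"
    \<comment> \<open>Once the first-kind symbols are expanded, the summands cancel for each index
      separately.\<close>
    by (rule sum.neutral) (simp add: christoffel_first_def pg[of b _ c] pg[of c _ b] g[of _ c] field_simps)
  finally show ?thesis by simp
qed

text \<open>Covariant differentiation commutes with raising an index. The lemma trades Christoffel
  symbols contracted with k for partial derivatives of k, from which a Lie derivative can be
  assembled.\<close>

lemma nabla_k: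
  assumes y: "y \<in> U"
  shows "pd c (\<lambda>y. k y $ q) y + (\<Sum>e\<in>UNIV. christoffel G q e c y * k y $ e)
    = (\<Sum>r\<in>UNIV. ginv G y q r * B c r y)"
proof -
  define V where "V q = pd c (\<lambda>y. k y $ q) y + (\<Sum>e\<in>UNIV. christoffel G q e c y * k y $ e)" for q
  have "(\<Sum>q\<in>UNIV. G y $ r $ q * V q) = B c r y" for r
  proof -
    have "(\<Sum>q\<in>UNIV. G y $ r $ q * (\<Sum>e\<in>UNIV. christoffel G q e c y * k y $ e))
        = (\<Sum>e\<in>UNIV. (\<Sum>q\<in>UNIV. G y $ r $ q * christoffel G q e c y) * k y $ e)"
      unfolding sum_distrib_left sum_distrib_right by (subst sum.swap) (simp add: mult_ac)
    also have "\<dots> = (\<Sum>e\<in>UNIV. christoffel_first G r e c y * k y $ e)" by (simp add: christoffel_lower y)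
    finally have "(\<Sum>q\<in>UNIV. G y $ r $ q * V q)
        = (\<Sum>q\<in>UNIV. G y $ r $ q * pd c (\<lambda>y. k y $ q) y + christoffel_first G r q c y * k y $ q)"
      by (simp add: V_def distrib_left sum.distrib)
    also have "\<dots> = pd c (\<lambda>y. \<kappa> y $ r) y - (\<Sum>q\<in>UNIV. k y $ q * christoffel_first G q c r y)"
      unfolding pd_\<kappa>[OF y] sum_subtractf[symmetric]
      by (rule sum.cong) (simp_all add: pd_G y christoffel_first_sym[OF y, of r] algebra_simps)
    finally show ?thesis by (simp add: B_christoffel_first y)
  qed
  then have "(\<Sum>r\<in>UNIV. ginv G y q r * B c r y) = V q"
    using raise_lower[OF y, of q V] by simp
  then show ?thesis by (simp add: V_def)
qed

end

text \<open>The two equations hold on a neighbourhood and can thus be differentiated at x. A single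
  derivative is taken, so \<mu>, \<rho> and \<eta> are asked to be differentiable at x.\<close>

locale shearfree_chart = optical_chart U G k for U :: "(real^'m::finite) set" and G k +
  fixes x :: "real^'m" and \<mu> \<rho> :: "real^'m \<Rightarrow> real" and \<eta> :: "'m \<Rightarrow> real^'m \<Rightarrow> real"
  assumes x: "x \<in> U"
    and geodesic: "\<And>y a. y \<in> U \<Longrightarrow> lie_form k (\<lambda>y. G y *v k y) y a = \<mu> y * (G y *v k y) $ a"
    and shearfree: "\<And>y a b. y \<in> U \<Longrightarrow> lie_metric k G y a b
      = \<rho> y * G y $ a $ b + (G y *v k y) $ a * \<eta> b y + \<eta> a y * (G y *v k y) $ b"
    and differentiable_\<mu>: "\<mu> differentiable (at x)"
    and differentiable_\<rho>: "\<rho> differentiable (at x)"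
    and differentiable_\<eta>: "\<And>a. \<eta> a differentiable (at x)"
begin

lemmas geodesic' = geodesic[folded \<kappa>_def]
lemmas shearfree' = shearfree[folded \<kappa>_def]

lemma lie_\<kappa>: "y \<in> U \<Longrightarrow> (\<Sum>b\<in>UNIV. k y $ b * pd b (\<lambda>y. \<kappa> y $ a) y + \<kappa> y $ b * pd a (\<lambda>y. k y $ b) y)
    = \<mu> y * \<kappa> y $ a"
  using geodesic'[of y a] by (simp add: lie_form_def \<kappa>_def[abs_def])

text \<open>Cartan's formula for the Lie derivative of \<kappa>; the term d(\<kappa>(k)) vanishes
  because \<kappa>(k) = 0 on all of \<open>U\<close>.\<close>

lemma k_F: "y \<in> U \<Longrightarrow> (\<Sum>e\<in>UNIV. k y $ e * F e c y) = \<mu> y / 2 * \<kappa> y $ c"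
proof -
  assume y: "y \<in> U"
  have "pd c (\<lambda>y. \<Sum>a\<in>UNIV. \<kappa> y $ a * k y $ a) y = pd c (\<lambda>y. 0) y"
    by (rule pd_cong[OF open_U y]) (rule null)
  moreover have "pd c (\<lambda>y. \<Sum>a\<in>UNIV. \<kappa> y $ a * k y $ a) y = (\<Sum>a\<in>UNIV. pd c (\<lambda>y. \<kappa> y $ a * k y $ a) y)"
    by (intro pd_sum differentiable_mult differentiable_entries y) simp
  ultimately have "(\<Sum>a\<in>UNIV. pd c (\<lambda>y. \<kappa> y $ a) y * k y $ a + \<kappa> y $ a * pd c (\<lambda>y. k y $ a) y) = 0"
    by (simp add: pd_const pd_mult differentiable_entries y)
  then have "\<mu> y * \<kappa> y $ c
      = (\<Sum>b\<in>UNIV. k y $ b * pd b (\<lambda>y. \<kappa> y $ c) y + \<kappa> y $ b * pd c (\<lambda>y. k y $ b) y)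
      - (\<Sum>a\<in>UNIV. pd c (\<lambda>y. \<kappa> y $ a) y * k y $ a + \<kappa> y $ a * pd c (\<lambda>y. k y $ a) y)"
    by (simp add: lie_\<kappa>[OF y])
  also have "\<dots> = (\<Sum>b\<in>UNIV. 2 * (k y $ b * F b c y))"
    unfolding sum_subtractf[symmetric] by (rule sum.cong) (simp_all add: F_def field_simps)
  finally show ?thesis by (simp add: sum_distrib_left[symmetric])
qed

lemma lie_metric_sym: "y \<in> U \<Longrightarrow> lie_metric k G y a b = lie_metric k G y b a"
  by (simp add: shearfree' G_sym)

text \<open>The Lie derivative of k along itself is 0, so (L_k g)(k, .) is the Lie derivative of
  \<kappa>.\<close>

lemma k_lie_metric: "y \<in> U \<Longrightarrow> (\<Sum>e\<in>UNIV. k y $ e * lie_metric k G y e c) = \<mu> y * \<kappa> y $ c"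
proof -
  assume y: "y \<in> U"
  have "(\<Sum>e\<in>UNIV. k y $ e * lie_metric k G y e c)
    = (\<Sum>e\<in>UNIV. \<Sum>b\<in>UNIV. k y $ e * k y $ b * pd b (\<lambda>y. G y $ c $ e) y)
      + (\<Sum>e\<in>UNIV. \<Sum>b\<in>UNIV. k y $ e * G y $ c $ b * pd e (\<lambda>y. k y $ b) y)
      + (\<Sum>e\<in>UNIV. \<Sum>b\<in>UNIV. k y $ e * G y $ b $ e * pd c (\<lambda>y. k y $ b) y)"
    unfolding lie_metric_def sum_distrib_left sum.distrib[symmetric]
    by (simp add: distrib_left mult.assoc[symmetric] G_sym[OF y, of _ c] pd_G_sym[OF y, of _ _ c])
      (intro sum.cong refl, simp add: G_sym[OF y])
  also have "(\<Sum>e\<in>UNIV. \<Sum>b\<in>UNIV. k y $ e * k y $ b * pd b (\<lambda>y. G y $ c $ e) y)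
      = (\<Sum>b\<in>UNIV. k y $ b * (\<Sum>e\<in>UNIV. pd b (\<lambda>y. G y $ c $ e) y * k y $ e))"
    by (subst sum.swap) (simp add: sum_distrib_left mult_ac)
  also have "(\<Sum>e\<in>UNIV. \<Sum>b\<in>UNIV. k y $ e * G y $ b $ e * pd c (\<lambda>y. k y $ b) y)
      = (\<Sum>b\<in>UNIV. \<kappa> y $ b * pd c (\<lambda>y. k y $ b) y)"
    by (subst sum.swap) (simp add: \<kappa>_nth sum_distrib_left mult_ac)
  also have "(\<Sum>e\<in>UNIV. \<Sum>b\<in>UNIV. k y $ e * G y $ c $ b * pd e (\<lambda>y. k y $ b) y)
      = (\<Sum>b\<in>UNIV. k y $ b * (\<Sum>e\<in>UNIV. G y $ c $ e * pd b (\<lambda>y. k y $ e) y))"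
    by (simp add: sum_distrib_left mult_ac)
  also have "(\<Sum>b\<in>UNIV. k y $ b * (\<Sum>e\<in>UNIV. pd b (\<lambda>y. G y $ c $ e) y * k y $ e))
      + (\<Sum>b\<in>UNIV. k y $ b * (\<Sum>e\<in>UNIV. G y $ c $ e * pd b (\<lambda>y. k y $ e) y))
      + (\<Sum>b\<in>UNIV. \<kappa> y $ b * pd c (\<lambda>y. k y $ b) y) = \<mu> y * \<kappa> y $ c"
    unfolding lie_\<kappa>[OF y, symmetric] by (simp add: pd_\<kappa>[OF y] sum.distrib distrib_left)
  finally show ?thesis .
qed

text \<open>The geodesic equation: the symmetric and the skew part of \<nabla>\<kappa> contribute
  \<mu>/2 each.\<close>

lemma k_B: "y \<in> U \<Longrightarrow> (\<Sum>e\<in>UNIV. k y $ e * B e c y) = \<mu> y * \<kappa> y $ c"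
proof -
  assume y: "y \<in> U"
  have "(\<Sum>e\<in>UNIV. k y $ e * B e c y)
      = (\<Sum>e\<in>UNIV. k y $ e * lie_metric k G y e c) / 2 + (\<Sum>e\<in>UNIV. k y $ e * F e c y)"
    by (simp add: B_split[OF y] distrib_left sum.distrib sum_divide_distrib)
  then show ?thesis by (simp add: k_lie_metric k_F y)
qed

section \<open>The curvature N and Lie derivatives along k\<close>

definition N :: "'m \<Rightarrow> 'm \<Rightarrow> real" where
  "N b c = (\<Sum>e\<in>UNIV. \<Sum>f\<in>UNIV. riemann G x b e f c * k x $ e * k x $ f)"

lemma N_riemann_up:
  "N b c = (\<Sum>e\<in>UNIV. k x $ e * (\<Sum>p\<in>UNIV. \<kappa> x $ p * riemann_up G x b e p c))"
proof -
  have "(\<Sum>f\<in>UNIV. riemann G x b e f c * k x $ e * k x $ f)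
      = k x $ e * (\<Sum>p\<in>UNIV. \<kappa> x $ p * riemann_up G x b e p c)" for e
  proof -
    have "(\<Sum>f\<in>UNIV. riemann G x b e f c * k x $ e * k x $ f)
        = (\<Sum>f\<in>UNIV. \<Sum>p\<in>UNIV. k x $ e * (G x $ p $ f * k x $ f * riemann_up G x b e p c))"
      by (simp add: riemann_def sum_distrib_right sum_distrib_left G_sym[OF x] mult_ac)
    also have "\<dots> = (\<Sum>p\<in>UNIV. \<Sum>f\<in>UNIV. k x $ e * (G x $ p $ f * k x $ f * riemann_up G x b e p c))"
      by (rule sum.swap)
    also have "\<dots> = k x $ e * (\<Sum>p\<in>UNIV. \<kappa> x $ p * riemann_up G x b e p c)"
      by (simp add: \<kappa>_nth sum_distrib_right sum_distrib_left mult_ac)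
    finally show ?thesis .
  qed
  then show ?thesis by (simp add: N_def)
qed

text \<open>In invariant notation: \<open>N = \<L>\<^sub>k B - \<mu> B - d\<mu> \<otimes> \<kappa> - B B\<^sup>T\<close>.\<close>

lemma N_lie:
  "N b c = (\<Sum>e\<in>UNIV. k x $ e * pd e (B b c) x + pd b (\<lambda>y. k y $ e) x * B e c x
        + pd c (\<lambda>y. k y $ e) x * B b e x)
    - \<mu> x * B b c x - pd b \<mu> x * \<kappa> x $ c
    - (\<Sum>q\<in>UNIV. \<Sum>r\<in>UNIV. ginv G x q r * B b q x * B c r x)"
proof -
  have R: "(\<Sum>p\<in>UNIV. \<kappa> x $ p * riemann_up G x b e p c)
      = pd e (B b c) x - pd b (B e c) x
        - (\<Sum>q\<in>UNIV. B b q x * christoffel G q e c x) + (\<Sum>q\<in>UNIV. B e q x * christoffel G q b c x)" for e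
    using ricci_identity_form[OF smooth_\<kappa> x] by (simp add: B_def[abs_def])
  \<comment> \<open>Differentiating the geodesic equation \<open>k_B\<close> moves the derivative
    from \<open>B\<close> to k, where it becomes part of a Lie derivative.\<close>
  have "pd b (\<lambda>y. \<Sum>e\<in>UNIV. k y $ e * B e c y) x = pd b (\<lambda>y. \<mu> y * \<kappa> y $ c) x"
    by (rule pd_cong[OF open_U x]) (rule k_B)
  moreover have "pd b (\<lambda>y. \<Sum>e\<in>UNIV. k y $ e * B e c y) x = (\<Sum>e\<in>UNIV. pd b (\<lambda>y. k y $ e * B e c y) x)"
    by (intro pd_sum differentiable_mult differentiable_entries x) simp
  ultimately have a: "(\<Sum>e\<in>UNIV. k x $ e * pd b (B e c) x)
      = pd b \<mu> x * \<kappa> x $ c + \<mu> x * pd b (\<lambda>y. \<kappa> y $ c) x - (\<Sum>e\<in>UNIV. pd b (\<lambda>y. k y $ e) x * B e c x)"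
    by (simp add: pd_mult differentiable_entries x differentiable_\<mu> sum.distrib)
  \<comment> \<open>These symbols complete the partial derivative of \<kappa> in \<open>a\<close> to
    \<open>B\<close>, which leaves -\<mu> B.\<close>
  have b: "(\<Sum>e\<in>UNIV. k x $ e * (\<Sum>q\<in>UNIV. B e q x * christoffel G q b c x))
      = \<mu> x * (pd b (\<lambda>y. \<kappa> y $ c) x - B b c x)"
  proof -
    have "(\<Sum>e\<in>UNIV. k x $ e * (\<Sum>q\<in>UNIV. B e q x * christoffel G q b c x))
        = (\<Sum>q\<in>UNIV. (\<Sum>e\<in>UNIV. k x $ e * B e q x) * christoffel G q b c x)"
      unfolding sum_distrib_left sum_distrib_right by (subst sum.swap) (simp add: mult_ac)
    also have "\<dots> = \<mu> x * (\<Sum>q\<in>UNIV. christoffel G q b c x * \<kappa> x $ q)"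
      by (simp add: k_B[OF x] sum_distrib_left mult_ac)
    finally show ?thesis by (simp add: B_def nabla_form_def)
  qed
  \<comment> \<open>\<open>nabla_k\<close> yields the product B B^T and the last piece of the Lie
    derivative.\<close>
  have c: "(\<Sum>e\<in>UNIV. k x $ e * (\<Sum>q\<in>UNIV. B b q x * christoffel G q e c x))
      = (\<Sum>q\<in>UNIV. \<Sum>r\<in>UNIV. ginv G x q r * B b q x * B c r x)
        - (\<Sum>q\<in>UNIV. pd c (\<lambda>y. k y $ q) x * B b q x)"
  proof -
    have "(\<Sum>e\<in>UNIV. k x $ e * (\<Sum>q\<in>UNIV. B b q x * christoffel G q e c x))
        = (\<Sum>q\<in>UNIV. B b q x * (\<Sum>e\<in>UNIV. christoffel G q e c x * k x $ e))"
      unfolding sum_distrib_left sum_distrib_right by (subst sum.swap) (simp add: mult_ac)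
    also have "\<dots> = (\<Sum>q\<in>UNIV. B b q x * ((\<Sum>r\<in>UNIV. ginv G x q r * B c r x) - pd c (\<lambda>y. k y $ q) x))"
      by (simp add: nabla_k[OF x, symmetric])
    finally show ?thesis
      by (simp add: right_diff_distrib sum_subtractf sum_distrib_left mult_ac)
  qed
  have "N b c = (\<Sum>e\<in>UNIV. k x $ e * pd e (B b c) x) - (\<Sum>e\<in>UNIV. k x $ e * pd b (B e c) x)
      - (\<Sum>e\<in>UNIV. k x $ e * (\<Sum>q\<in>UNIV. B b q x * christoffel G q e c x))
      + (\<Sum>e\<in>UNIV. k x $ e * (\<Sum>q\<in>UNIV. B e q x * christoffel G q b c x))"
    unfolding N_riemann_up R by (simp add: ring_distribs sum.distrib sum_subtractf)
  then show ?thesis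
    unfolding a b c by (simp add: sum.distrib algebra_simps)
qed

text \<open>Cartan's formula again: F is closed, so its Lie derivative is the exterior derivative of
  its contraction with k, which is \<mu> \<kappa> / 2.\<close>

lemma lie_F:
  "(\<Sum>e\<in>UNIV. k x $ e * pd e (F b c) x + pd b (\<lambda>y. k y $ e) x * F e c x + pd c (\<lambda>y. k y $ e) x * F b e x)
    = \<mu> x * F b c x + (pd b \<mu> x * \<kappa> x $ c - pd c \<mu> x * \<kappa> x $ b) / 2"
proof -
  have pdF: "pd e (F b c) x = (pd e (pd b (\<lambda>y. \<kappa> y $ c)) x - pd e (pd c (\<lambda>y. \<kappa> y $ b)) x) / 2" for e b c
  proof -
    have "pd e (F b c) x = pd e (\<lambda>y. (1 / 2) * (pd b (\<lambda>y. \<kappa> y $ c) y - pd c (\<lambda>y. \<kappa> y $ b) y)) x"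
      by (simp add: F_def[abs_def])
    also have "\<dots> = (1 / 2) * pd e (\<lambda>y. pd b (\<lambda>y. \<kappa> y $ c) y - pd c (\<lambda>y. \<kappa> y $ b) y) x"
      by (intro pd_cmult differentiable_diff differentiable_entries x)
    finally show ?thesis by (simp add: pd_diff differentiable_entries x)
  qed
  have closed: "pd e (F b c) x = pd b (F e c) x - pd c (F e b) x" for e
    using pd_commute[OF open_U smooth_entries(1) x, of e b c] pd_commute[OF open_U smooth_entries(1) x, of e c b]
      pd_commute[OF open_U smooth_entries(1) x, of b c e]
    by (simp add: pdF field_simps)
  have D: "(\<Sum>e\<in>UNIV. k x $ e * pd b (F e c) x + pd b (\<lambda>y. k y $ e) x * F e c x)
      = (pd b \<mu> x * \<kappa> x $ c + \<mu> x * pd b (\<lambda>y. \<kappa> y $ c) x) / 2" for b c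
  proof -
    have "pd b (\<lambda>y. \<Sum>e\<in>UNIV. k y $ e * F e c y) x = pd b (\<lambda>y. (1 / 2) * (\<mu> y * \<kappa> y $ c)) x"
      by (rule pd_cong[OF open_U x]) (simp add: k_F)
    moreover have "pd b (\<lambda>y. \<Sum>e\<in>UNIV. k y $ e * F e c y) x = (\<Sum>e\<in>UNIV. pd b (\<lambda>y. k y $ e * F e c y) x)"
      by (intro pd_sum differentiable_mult differentiable_entries x) simp
    moreover have "pd b (\<lambda>y. (1 / 2) * (\<mu> y * \<kappa> y $ c)) x = (1 / 2) * pd b (\<lambda>y. \<mu> y * \<kappa> y $ c) x"
      by (intro pd_cmult differentiable_mult differentiable_entries differentiable_\<mu> x)
    ultimately show ?thesis
      by (simp add: pd_mult differentiable_entries x differentiable_\<mu> add.commute)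
  qed
  have "(\<Sum>e\<in>UNIV. k x $ e * pd e (F b c) x + pd b (\<lambda>y. k y $ e) x * F e c x + pd c (\<lambda>y. k y $ e) x * F b e x)
    = (\<Sum>e\<in>UNIV. k x $ e * pd b (F e c) x + pd b (\<lambda>y. k y $ e) x * F e c x)
      - (\<Sum>e\<in>UNIV. k x $ e * pd c (F e b) x + pd c (\<lambda>y. k y $ e) x * F e b x)"
    unfolding sum_subtractf[symmetric]
    by (rule sum.cong) (simp_all add: closed F_anti[of b] algebra_simps)
  then show ?thesis unfolding D by (simp add: F_def field_simps)
qed

end

section \<open>Algebraic form of N and the Weyl tensor\<close>

context shearfree_chart
begin

sublocale na: null_algebra "ginv G x" "\<lambda>a b. G x $ a $ b" "\<lambda>a b. F a b x" "\<lambda>a. \<kappa> x $ a"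
  "\<lambda>a. k x $ a" "\<mu> x"
proof
  show "ginv G x a b = ginv G x b a" for a b by (rule ginv_sym[OF x])
  show "G x $ a $ b = G x $ b $ a" for a b by (rule G_sym[OF x])
  show "(\<Sum>c\<in>UNIV. ginv G x a c * G x $ c $ b) = (if a = b then 1 else 0)" for a b
    by (rule ginv_G[OF x])
  show "(\<Sum>b\<in>UNIV. ginv G x a b * \<kappa> x $ b) = k x $ a" for a
    unfolding \<kappa>_nth by (rule raise_lower[OF x])
  show "(\<Sum>a\<in>UNIV. \<kappa> x $ a * k x $ a) = 0" by (rule null[OF x])
  show "F a b x = - F b a x" for a b by (rule F_anti)
  show "(\<Sum>e\<in>UNIV. k x $ e * F e c x) = \<mu> x / 2 * \<kappa> x $ c" for c by (rule k_F[OF x])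
qed

text \<open>Equal to \<open>lie_metric\<close> on \<open>U\<close>, but kept in decomposed form:
  differentiating it takes one derivative of each coefficient and leaves the factors \<kappa>
  visible.\<close>

definition h :: "'m \<Rightarrow> 'm \<Rightarrow> real^'m \<Rightarrow> real" where
  "h a b y = \<rho> y * G y $ a $ b + \<kappa> y $ a * \<eta> b y + \<eta> a y * \<kappa> y $ b"

lemma lie_metric_h: "y \<in> U \<Longrightarrow> lie_metric k G y a b = h a b y"
  by (simp add: shearfree' h_def)

lemma B_h: "y \<in> U \<Longrightarrow> B b c y = (1 / 2) * h b c y + F b c y"
  by (simp add: B_split lie_metric_h)

lemma differentiable_h: "h a b differentiable (at x)"
  unfolding h_def[abs_def]
  by (intro differentiable_add differentiable_mult differentiable_\<rho> differentiable_G differentiable_\<eta>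
      differentiable_entries x)

lemma pd_h: "pd e (h b c) x = pd e \<rho> x * G x $ b $ c + \<rho> x * pd e (\<lambda>y. G y $ b $ c) x
    + (pd e (\<lambda>y. \<kappa> y $ b) x * \<eta> c x + \<kappa> x $ b * pd e (\<eta> c) x)
    + (pd e (\<eta> b) x * \<kappa> x $ c + \<eta> b x * pd e (\<lambda>y. \<kappa> y $ c) x)"
proof -
  note d = differentiable_\<rho> differentiable_G[OF x] differentiable_\<eta> differentiable_entries[OF x]
  have "pd e (h b c) x = pd e (\<lambda>y. \<rho> y * G y $ b $ c) x + pd e (\<lambda>y. \<kappa> y $ b * \<eta> c y) x
      + pd e (\<lambda>y. \<eta> b y * \<kappa> y $ c) x"
    unfolding h_def[abs_def] by (simp only: pd_add differentiable_add differentiable_mult d)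
  then show ?thesis by (simp only: pd_mult d)
qed

definition lie_\<eta> :: "'m \<Rightarrow> real" where
  "lie_\<eta> c = (\<Sum>e\<in>UNIV. k x $ e * pd e (\<eta> c) x + \<eta> e x * pd c (\<lambda>y. k y $ e) x)"

text \<open>Leibniz rule: because L_k g = h and L_k \<kappa> = \<mu> \<kappa>, the result again has
  the shape of h.\<close>

lemma lie_h:
  "(\<Sum>e\<in>UNIV. k x $ e * pd e (h b c) x + pd b (\<lambda>y. k y $ e) x * h e c x + pd c (\<lambda>y. k y $ e) x * h b e x)
    = ((\<Sum>e\<in>UNIV. k x $ e * pd e \<rho> x) + (\<rho> x)\<^sup>2) * G x $ b $ c
      + \<kappa> x $ b * ((\<rho> x + \<mu> x) * \<eta> c x + lie_\<eta> c) + ((\<rho> x + \<mu> x) * \<eta> b x + lie_\<eta> b) * \<kappa> x $ c"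
proof -
  have "(\<Sum>e\<in>UNIV. k x $ e * pd e (h b c) x + pd b (\<lambda>y. k y $ e) x * h e c x + pd c (\<lambda>y. k y $ e) x * h b e x)
    = (\<Sum>e\<in>UNIV. k x $ e * pd e \<rho> x) * G x $ b $ c + \<rho> x * lie_metric k G x b c
      + \<eta> c x * (\<Sum>e\<in>UNIV. k x $ e * pd e (\<lambda>y. \<kappa> y $ b) x + \<kappa> x $ e * pd b (\<lambda>y. k y $ e) x)
      + \<eta> b x * (\<Sum>e\<in>UNIV. k x $ e * pd e (\<lambda>y. \<kappa> y $ c) x + \<kappa> x $ e * pd c (\<lambda>y. k y $ e) x)
      + \<kappa> x $ b * lie_\<eta> c + \<kappa> x $ c * lie_\<eta> b"
    unfolding lie_metric_def lie_\<eta>_def sum_distrib_left sum_distrib_right sum.distrib[symmetric] pd_h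
    by (rule sum.cong) (simp_all add: h_def algebra_simps)
  then show ?thesis
    unfolding lie_\<kappa>[OF x] lie_metric_h[OF x] by (simp add: h_def power2_eq_square algebra_simps)
qed

text \<open>Two cancellations leave no term linear in F on its own: \<mu> F from
  \<open>lie_F\<close> is removed by -\<mu> B, and in B B^T the products of \<rho> g with F add up
  to a multiple of F_bc + F_cb = 0.\<close>

lemma N_form:
  obtains \<sigma> \<alpha> \<beta> where "\<And>b c. N b c = \<sigma> * G x $ b $ c + \<kappa> x $ b * \<alpha> c + \<beta> b * \<kappa> x $ c
    - na.cometric (\<lambda>e. F b e x) (\<lambda>e. F c e x)"
proof
  define K\<rho> where "K\<rho> = (\<Sum>e\<in>UNIV. k x $ e * pd e \<rho> x)"
  define \<omega> where "\<omega> c = (\<rho> x + \<mu> x) * \<eta> c x + lie_\<eta> c" for c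
  define f where "f c = na.cometric (\<lambda>e. \<eta> e x) (\<lambda>e. F c e x)" for c
  define s where "s = na.cometric (\<lambda>e. \<kappa> x $ e) (\<lambda>e. \<eta> e x)"
  define s2 where "s2 = na.cometric (\<lambda>e. \<eta> e x) (\<lambda>e. \<eta> e x)"
  \<comment> \<open>\<rho>^2/4 is \<rho>^2/2 from half the Lie derivative of \<open>h\<close> minus
    \<rho>^2/4 from B B^T; the term in \<mu> \<rho> comes from -\<mu> B.\<close>
  let ?\<sigma> = "K\<rho> / 2 + (\<rho> x)\<^sup>2 / 4 - \<mu> x * \<rho> x / 2"
  let ?\<alpha> = "\<lambda>c. \<omega> c / 2 - pd c \<mu> x / 2 - \<mu> x * \<eta> c x / 4 - \<rho> x * \<eta> c x / 2 - s2 * \<kappa> x $ c / 4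
    - s * \<eta> c x / 4 - f c / 2"
  \<comment> \<open>For d\<mu>, \<open>lie_F\<close> gives +1/2 and -d\<mu> \<kappa> gives -1, hence
    -1/2 as in \<open>?\<alpha>\<close>. The \<kappa> \<kappa> term with \<open>s2\<close> is
    assigned to \<open>?\<alpha>\<close> alone.\<close>
  let ?\<beta> = "\<lambda>b. \<omega> b / 2 - pd b \<mu> x / 2 - \<mu> x * \<eta> b x / 4 - \<rho> x * \<eta> b x / 2 - s * \<eta> b x / 4 - f b / 2"
  show "N b c = ?\<sigma> * G x $ b $ c + \<kappa> x $ b * ?\<alpha> c + ?\<beta> b * \<kappa> x $ c
    - na.cometric (\<lambda>e. F b e x) (\<lambda>e. F c e x)" for b c
  proof -
    have "pd e (B b c) x = pd e (\<lambda>y. (1 / 2) * h b c y + F b c y) x" for e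
      by (rule pd_cong[OF open_U x]) (rule B_h)
    then have pdB: "pd e (B b c) x = (1 / 2) * pd e (h b c) x + pd e (F b c) x" for e
      by (simp only: pd_add pd_cmult differentiable_mult differentiable_const differentiable_h
          differentiable_entries[OF x])
    have "(\<Sum>e\<in>UNIV. k x $ e * pd e (B b c) x + pd b (\<lambda>y. k y $ e) x * B e c x + pd c (\<lambda>y. k y $ e) x * B b e x)
      = (1 / 2) * (\<Sum>e\<in>UNIV. k x $ e * pd e (h b c) x + pd b (\<lambda>y. k y $ e) x * h e c x
          + pd c (\<lambda>y. k y $ e) x * h b e x)
        + (\<Sum>e\<in>UNIV. k x $ e * pd e (F b c) x + pd b (\<lambda>y. k y $ e) x * F e c x
          + pd c (\<lambda>y. k y $ e) x * F b e x)"
      unfolding pdB B_h[OF x] sum_distrib_left sum.distrib[symmetric]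
      by (rule sum.cong) (simp_all add: algebra_simps)
    then have lieB: "(\<Sum>e\<in>UNIV. k x $ e * pd e (B b c) x + pd b (\<lambda>y. k y $ e) x * B e c x
        + pd c (\<lambda>y. k y $ e) x * B b e x)
      = (1 / 2) * ((K\<rho> + (\<rho> x)\<^sup>2) * G x $ b $ c + \<kappa> x $ b * \<omega> c + \<omega> b * \<kappa> x $ c)
        + (\<mu> x * F b c x + (pd b \<mu> x * \<kappa> x $ c - pd c \<mu> x * \<kappa> x $ b) / 2)"
      unfolding lie_h lie_F K\<rho>_def[symmetric] \<omega>_def[symmetric] .
    have G: "na.cometric v (\<lambda>e. G x $ b $ e) = v b" "na.cometric (\<lambda>e. G x $ b $ e) v = v b" for v b
      using na.cometric_G[of b v] na.cometric_commute by simp_all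
    have B: "B b q x = (1 / 2) * (\<rho> x * G x $ b $ q + \<kappa> x $ b * \<eta> q x + \<eta> b x * \<kappa> x $ q) + F b q x" for b q
      by (simp add: B_h[OF x] h_def)
    have "(\<Sum>q\<in>UNIV. \<Sum>r\<in>UNIV. ginv G x q r * B b q x * B c r x)
        = na.cometric (\<lambda>q. B b q x) (\<lambda>q. B c q x)"
      by (simp add: na.cometric_def)
    also have "\<dots> = (\<rho> x)\<^sup>2 / 4 * G x $ b $ c
        + \<rho> x / 2 * (\<kappa> x $ b * \<eta> c x + \<eta> b x * \<kappa> x $ c)
        + s2 / 4 * \<kappa> x $ b * \<kappa> x $ c + s / 4 * (\<kappa> x $ b * \<eta> c x + \<eta> b x * \<kappa> x $ c)
        + (\<kappa> x $ b * f c + f b * \<kappa> x $ c) / 2 - \<mu> x / 4 * (\<kappa> x $ b * \<eta> c x + \<eta> b x * \<kappa> x $ c)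
        + na.cometric (\<lambda>e. F b e x) (\<lambda>e. F c e x)"
      unfolding B na.cometric_linear G na.cometric_\<kappa>_\<kappa> na.cometric_\<kappa>_F f_def[symmetric] s2_def[symmetric] s_def[symmetric]
        na.cometric_commute[of "\<lambda>e. F _ e x" "\<lambda>e. \<eta> e x"] na.cometric_commute[of "\<lambda>e. \<eta> e x" "\<lambda>e. \<kappa> x $ e"]
      using F_anti[of b c x] G_sym[OF x, of b c]
      by (simp add: power2_eq_square field_simps)
    finally show ?thesis
      unfolding N_lie lieB B[of b c] by (simp add: power2_eq_square field_simps)
  qed
qed

text \<open>One contraction meets the skewness of the Riemann tensor in its first pair, the other
  that in its last pair.\<close>

lemma N_null: "(\<Sum>b\<in>UNIV. N b c * k x $ b) = 0" "(\<Sum>c\<in>UNIV. N b c * k x $ c) = 0"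
proof -
  have *: "s = 0" if "s = - s" for s :: real using that by simp
  have "(\<Sum>b\<in>UNIV. N b c * k x $ b)
      = (\<Sum>b\<in>UNIV. \<Sum>e\<in>UNIV. (\<Sum>f\<in>UNIV. riemann G x b e f c * k x $ f) * k x $ e * k x $ b)"
    by (simp add: N_def sum_distrib_left sum_distrib_right mult_ac)
  also have "\<dots> = (\<Sum>b\<in>UNIV. \<Sum>e\<in>UNIV. (\<Sum>f\<in>UNIV. riemann G x e b f c * k x $ f) * k x $ e * k x $ b)"
    by (subst sum.swap) (simp add: mult_ac)
  also have "\<dots> = - (\<Sum>b\<in>UNIV. \<Sum>e\<in>UNIV. (\<Sum>f\<in>UNIV. riemann G x b e f c * k x $ f) * k x $ e * k x $ b)"
  proof -
    have "riemann G x e b f c = - riemann G x b e f c" for e b f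
      by (simp add: riemann_def riemann_up_def sum_negf[symmetric] sum_subtractf algebra_simps)
    then have "(\<Sum>f\<in>UNIV. riemann G x e b f c * k x $ f) = - (\<Sum>f\<in>UNIV. riemann G x b e f c * k x $ f)"
      for e b by (subst sum_negf[symmetric]) (intro sum.cong refl, metis mult_minus_left)
    note inner = this
    show ?thesis
      unfolding sum_negf[symmetric] by (intro sum.cong refl, subst inner, simp)
  qed
  finally show "(\<Sum>b\<in>UNIV. N b c * k x $ b) = 0"
    by (simp add: N_def sum_distrib_left sum_distrib_right mult_ac)
  have "(\<Sum>c\<in>UNIV. N b c * k x $ c)
      = (\<Sum>c\<in>UNIV. \<Sum>e\<in>UNIV. \<Sum>f\<in>UNIV. riemann G x b e f c * k x $ e * k x $ f * k x $ c)"
    by (simp add: N_def sum_distrib_right)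
  also have "\<dots> = (\<Sum>e\<in>UNIV. \<Sum>c\<in>UNIV. \<Sum>f\<in>UNIV. riemann G x b e f c * k x $ e * k x $ f * k x $ c)"
    by (rule sum.swap)
  also have "\<dots> = 0"
  proof (rule sum.neutral, rule ballI, rule *)
    fix e
    have "(\<Sum>c\<in>UNIV. \<Sum>f\<in>UNIV. riemann G x b e f c * k x $ e * k x $ f * k x $ c)
        = (\<Sum>c\<in>UNIV. \<Sum>f\<in>UNIV. riemann G x b e c f * k x $ e * k x $ f * k x $ c)"
      by (subst sum.swap) (simp add: mult_ac)
    also have "\<dots> = (\<Sum>c\<in>UNIV. \<Sum>f\<in>UNIV. - (riemann G x b e f c * k x $ e * k x $ f * k x $ c))"
      by (intro sum.cong refl) (subst riemann_antisym[OF x], simp)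
    finally show "(\<Sum>c\<in>UNIV. \<Sum>f\<in>UNIV. riemann G x b e f c * k x $ e * k x $ f * k x $ c)
        = - (\<Sum>c\<in>UNIV. \<Sum>f\<in>UNIV. riemann G x b e f c * k x $ e * k x $ f * k x $ c)"
      by (simp add: sum_negf)
  qed
  finally show "(\<Sum>c\<in>UNIV. N b c * k x $ c) = 0" .
qed

text \<open>The trace of \<open>N\<close> pairs the first and fourth index, the Ricci tensor the
  first and third; exchanging the last pair produces the sign.\<close>

lemma ricci_trace:
  "(\<Sum>e\<in>UNIV. \<Sum>f\<in>UNIV. ricci G x e f * k x $ e * k x $ f)
    = - (\<Sum>b\<in>UNIV. \<Sum>c\<in>UNIV. ginv G x b c * N b c)"
proof -
  have up: "riemann_up G x a b e d = (\<Sum>c\<in>UNIV. ginv G x e c * riemann G x a b c d)" for a b e d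
    unfolding riemann_def by (rule raise_lower[OF x, symmetric])
  have "(\<Sum>b\<in>UNIV. \<Sum>c\<in>UNIV. ginv G x b c * N b c)
      = (\<Sum>b\<in>UNIV. \<Sum>c\<in>UNIV. \<Sum>e\<in>UNIV. \<Sum>f\<in>UNIV. - (ginv G x b c * riemann G x b e c f * k x $ e * k x $ f))"
    unfolding N_def sum_distrib_left
    by (intro sum.cong refl, subst riemann_antisym[OF x], simp)
  also have "\<dots> = (\<Sum>b\<in>UNIV. \<Sum>e\<in>UNIV. \<Sum>c\<in>UNIV. \<Sum>f\<in>UNIV. - (ginv G x b c * riemann G x b e c f * k x $ e * k x $ f))"
    by (intro sum.cong refl sum.swap)
  also have "\<dots> = (\<Sum>b\<in>UNIV. \<Sum>e\<in>UNIV. \<Sum>f\<in>UNIV. \<Sum>c\<in>UNIV. - (ginv G x b c * riemann G x b e c f * k x $ e * k x $ f))"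
    by (intro sum.cong refl sum.swap)
  also have "\<dots> = (\<Sum>b\<in>UNIV. \<Sum>e\<in>UNIV. \<Sum>f\<in>UNIV. - (riemann_up G x b e b f * k x $ e * k x $ f))"
    by (simp add: up sum_distrib_right sum_negf)
  also have "\<dots> = (\<Sum>e\<in>UNIV. \<Sum>b\<in>UNIV. \<Sum>f\<in>UNIV. - (riemann_up G x b e b f * k x $ e * k x $ f))"
    by (rule sum.swap)
  also have "\<dots> = (\<Sum>e\<in>UNIV. \<Sum>f\<in>UNIV. \<Sum>b\<in>UNIV. - (riemann_up G x b e b f * k x $ e * k x $ f))"
    by (intro sum.cong refl sum.swap)
  also have "\<dots> = - (\<Sum>e\<in>UNIV. \<Sum>f\<in>UNIV. ricci G x e f * k x $ e * k x $ f)"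
    by (simp add: ricci_def sum_distrib_right sum_negf)
  finally show ?thesis by simp
qed

text \<open>Corrections containing g(k, k) vanish as k is null. The others carry \<kappa>_b or
  \<kappa>_c, except Ric(k, k) g_bc.\<close>

lemma weyl_contraction:
  obtains u w where "\<And>b c. (\<Sum>e\<in>UNIV. \<Sum>f\<in>UNIV. weyl G x b e f c * k x $ e * k x $ f)
    = N b c + (\<Sum>e\<in>UNIV. \<Sum>f\<in>UNIV. ricci G x e f * k x $ e * k x $ f) / (real CARD('m) - 2) * G x $ b $ c
      + \<kappa> x $ b * u c + w b * \<kappa> x $ c"
proof
  define p where "p = 1 / (real CARD('m) - 2)"
  define q where "q = scalar_curvature G x / ((real CARD('m) - 1) * (real CARD('m) - 2))"
  define R where "R = (\<Sum>e\<in>UNIV. \<Sum>f\<in>UNIV. ricci G x e f * k x $ e * k x $ f)"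
  let ?u = "\<lambda>c. q * \<kappa> x $ c - p * (\<Sum>e\<in>UNIV. ricci G x e c * k x $ e)"
  let ?w = "\<lambda>b. - p * (\<Sum>f\<in>UNIV. ricci G x b f * k x $ f)"
  fix b c
  have 1: "(\<Sum>f\<in>UNIV. G x $ b $ f * k x $ f) = \<kappa> x $ b" for b by (simp add: \<kappa>_nth)
  have 2: "(\<Sum>e\<in>UNIV. \<Sum>f\<in>UNIV. G x $ e $ f * k x $ e * k x $ f) = 0"
  proof -
    have "(\<Sum>e\<in>UNIV. \<Sum>f\<in>UNIV. G x $ e $ f * k x $ e * k x $ f) = (\<Sum>e\<in>UNIV. \<kappa> x $ e * k x $ e)"
      by (simp add: \<kappa>_nth sum_distrib_left mult_ac)
    then show ?thesis by (simp add: null[OF x])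
  qed
  have 3: "(\<Sum>e\<in>UNIV. \<Sum>f\<in>UNIV. s e * t f) = (\<Sum>e\<in>UNIV. s e) * (\<Sum>f\<in>UNIV. t f)" for s t :: "'m \<Rightarrow> real"
    by (simp add: sum_product)
  have "(\<Sum>e\<in>UNIV. \<Sum>f\<in>UNIV. weyl G x b e f c * k x $ e * k x $ f)
    = (\<Sum>e\<in>UNIV. \<Sum>f\<in>UNIV. riemann G x b e f c * k x $ e * k x $ f)
      - p * (\<Sum>e\<in>UNIV. \<Sum>f\<in>UNIV. (ricci G x e c * k x $ e) * (G x $ b $ f * k x $ f))
      + p * G x $ b $ c * (\<Sum>e\<in>UNIV. \<Sum>f\<in>UNIV. ricci G x e f * k x $ e * k x $ f)
      + p * ricci G x b c * (\<Sum>e\<in>UNIV. \<Sum>f\<in>UNIV. G x $ e $ f * k x $ e * k x $ f)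
      - p * (\<Sum>e\<in>UNIV. \<Sum>f\<in>UNIV. (G x $ c $ e * k x $ e) * (ricci G x b f * k x $ f))
      + q * (\<Sum>e\<in>UNIV. \<Sum>f\<in>UNIV. (G x $ c $ e * k x $ e) * (G x $ b $ f * k x $ f))
      - q * G x $ b $ c * (\<Sum>e\<in>UNIV. \<Sum>f\<in>UNIV. G x $ e $ f * k x $ e * k x $ f)"
    unfolding weyl_def p_def[symmetric] q_def[symmetric] sum_distrib_left sum.distrib[symmetric]
      sum_subtractf[symmetric]
    by (intro sum.cong refl) (simp add: G_sym[OF x, of _ c] algebra_simps)
  also have "\<dots> = N b c + R * p * G x $ b $ c + \<kappa> x $ b * ?u c + ?w b * \<kappa> x $ c"
    unfolding 2 3 1 N_def[symmetric] R_def[symmetric] by (simp add: algebra_simps)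
  finally show "(\<Sum>e\<in>UNIV. \<Sum>f\<in>UNIV. weyl G x b e f c * k x $ e * k x $ f)
    = N b c + R / (real CARD('m) - 2) * G x $ b $ c + \<kappa> x $ b * ?u c + ?w b * \<kappa> x $ c"
    by (simp add: p_def)
qed

text \<open>Skew-symmetrisation discards the symmetric part of \<open>B\<close>; the six
  permutations pair up to 2F each, and 3 times 2/6 is 1.\<close>

lemma tau_\<kappa>F: "tau G \<kappa> x a b c = na.\<kappa>F a b c"
  using F_anti[of a b x] F_anti[of b c x] F_anti[of a c x] lie_metric_sym[OF x]
  by (simp add: tau_def alt3_def B_def[symmetric] B_split[OF x] na.\<kappa>F_def field_simps)

lemma weyl_identity:
  assumes n: "CARD('m) = n + 2" "n > 0" and ne: "\<kappa> x \<noteq> 0"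
  shows "4 * alt22 (\<lambda>a b c d. \<Sum>e\<in>UNIV. \<Sum>f\<in>UNIV.
            \<kappa> x $ a * weyl G x b e f c * \<kappa> x $ d * k x $ e * k x $ f) a b c d
      = (\<Sum>e\<in>UNIV. tau G \<kappa> x a b e * tau_up1 G \<kappa> x e c d)
        + 4 / real n * alt22 (\<lambda>a b c d. \<Sum>e\<in>UNIV. \<Sum>f\<in>UNIV.
            tau_up23 G \<kappa> x a e f * G x $ b $ c * tau G \<kappa> x d e f) a b c d"
proof -
  obtain \<sigma> \<alpha> \<beta> where N: "\<And>b c. N b c = \<sigma> * G x $ b $ c + \<kappa> x $ b * \<alpha> c + \<beta> b * \<kappa> x $ c
    - na.cometric (\<lambda>e. F b e x) (\<lambda>e. F c e x)"
    by (rule N_form) (rule that, assumption)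
  define R where "R = (\<Sum>e\<in>UNIV. \<Sum>f\<in>UNIV. ricci G x e f * k x $ e * k x $ f)"
  define M where "M b c = (\<Sum>e\<in>UNIV. \<Sum>f\<in>UNIV. weyl G x b e f c * k x $ e * k x $ f)" for b c
  obtain u w where W: "\<And>b c. M b c = N b c + R / (real CARD('m) - 2) * G x $ b $ c
      + \<kappa> x $ b * u c + w b * \<kappa> x $ c"
    unfolding M_def R_def by (rule weyl_contraction) (rule that, unfold M_def R_def, assumption)
  have "\<exists>a. \<kappa> x $ a \<noteq> 0" using ne by (simp add: vec_eq_iff)
  then have R: "R = - (real n * \<sigma>) + na.F_norm + (\<mu> x)\<^sup>2 / 2"
    unfolding R_def ricci_trace using na.trace_form[OF N N_null] by (simp add: n)
  \<comment> \<open>The part -\<sigma> of Ric(k, k)/n cancels the \<sigma> in \<open>N\<close>, so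
    its value is irrelevant.\<close>
  have M: "M b c = \<kappa> x $ b * (\<alpha> c + u c) + (\<beta> b + w b) * \<kappa> x $ c
      - na.cometric (\<lambda>e. F b e x) (\<lambda>e. F c e x) + (na.F_norm + (\<mu> x)\<^sup>2 / 2) / real n * G x $ b $ c" for b c
    unfolding W N R using n by (simp add: field_simps)
  have 1: "(\<Sum>e\<in>UNIV. \<Sum>f\<in>UNIV. \<kappa> x $ a * weyl G x b e f c * \<kappa> x $ d * k x $ e * k x $ f)
      = \<kappa> x $ a * M b c * \<kappa> x $ d" for a b c d
    by (simp add: M_def sum_distrib_left sum_distrib_right mult_ac)
  have 2: "(\<Sum>e\<in>UNIV. tau G \<kappa> x a b e * tau_up1 G \<kappa> x e c d) = na.cometric (na.\<kappa>F a b) (na.\<kappa>F c d)"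
  proof -
    \<comment> \<open>Cyclic invariance moves the raised index of \<open>tau_up1\<close> to the last
      slot, where \<open>cometric\<close> contracts.\<close>
    have "na.\<kappa>F p c d = na.\<kappa>F c d p" for p
      using F_anti[of p c x] F_anti[of p d x] F_anti[of d c x] by (simp add: na.\<kappa>F_def)
    then show ?thesis
      by (simp add: tau_up1_def tau_\<kappa>F na.cometric_def sum_distrib_left mult_ac)
  qed
  have 3: "(\<Sum>e\<in>UNIV. \<Sum>f\<in>UNIV. tau_up23 G \<kappa> x a e f * G x $ b $ c * tau G \<kappa> x d e f)
      = (\<Sum>e\<in>UNIV. \<Sum>p\<in>UNIV. ginv G x e p * na.cometric (na.\<kappa>F a p) (na.\<kappa>F d e)) * G x $ b $ c" for a b c d
  proof -
    have "(\<Sum>f\<in>UNIV. tau_up23 G \<kappa> x a e f * G x $ b $ c * tau G \<kappa> x d e f)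
        = (\<Sum>p\<in>UNIV. ginv G x e p * na.cometric (na.\<kappa>F a p) (na.\<kappa>F d e)) * G x $ b $ c" for e
    proof -
      have "(\<Sum>f\<in>UNIV. tau_up23 G \<kappa> x a e f * G x $ b $ c * tau G \<kappa> x d e f)
          = (\<Sum>f\<in>UNIV. \<Sum>p\<in>UNIV. \<Sum>q\<in>UNIV. ginv G x e p * (ginv G x f q * na.\<kappa>F d e f * na.\<kappa>F a p q)) * G x $ b $ c"
        by (simp add: tau_up23_def tau_\<kappa>F sum_distrib_left mult_ac)
      also have "(\<Sum>f\<in>UNIV. \<Sum>p\<in>UNIV. \<Sum>q\<in>UNIV. ginv G x e p * (ginv G x f q * na.\<kappa>F d e f * na.\<kappa>F a p q))
          = (\<Sum>p\<in>UNIV. \<Sum>f\<in>UNIV. \<Sum>q\<in>UNIV. ginv G x e p * (ginv G x f q * na.\<kappa>F d e f * na.\<kappa>F a p q))"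
        by (rule sum.swap)
      also have "\<dots> = (\<Sum>p\<in>UNIV. ginv G x e p * na.cometric (na.\<kappa>F d e) (na.\<kappa>F a p))"
        by (simp add: na.cometric_def sum_distrib_left)
      finally show ?thesis by (simp add: na.cometric_commute[of "na.\<kappa>F d e"])
    qed
    then show ?thesis by (simp add: sum_distrib_right)
  qed
  show ?thesis
    unfolding 1 2 3 by (rule na.tracefree_identity[OF M])
qed

end

subsection \<open>The Weyl tensor of a shear-free geometry\<close>

lemma differentiable_ip:
  assumes "\<And>a b. (\<lambda>y. M y $ a $ b) differentiable (at x)"
    "\<And>a. (\<lambda>y. v y $ a) differentiable (at x)" "\<And>a. (\<lambda>y. w y $ a) differentiable (at x)"
  shows "(\<lambda>y. ip (M y) (v y) (w y)) differentiable (at x)"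
  unfolding ip_def by (intro differentiable_sum' differentiable_mult assms)

lemma differentiable_perp_cofactor:
  assumes M: "\<And>a b. (\<lambda>y. M y $ a $ b) differentiable (at x)"
    and v: "\<And>a. (\<lambda>y. v y $ a) differentiable (at x)" and v0: "v x \<noteq> 0"
  shows "(\<lambda>y. perp_cofactor (M y) (v y) $ a) differentiable (at x)"
proof -
  have N: "(\<lambda>y. v y \<bullet> v y) differentiable (at x)"
    unfolding inner_vec_def inner_real_def by (intro differentiable_sum' differentiable_mult v)
  show ?thesis
    unfolding perp_cofactor_def matrix_vector_mult_def vector_minus_component vector_scaleR_component
      vec_lambda_beta real_scaleR_def power2_eq_square
    using v0
    by (intro differentiable_diff differentiable_mult differentiable_divide differentiable_sum'
        differentiable_ip differentiable_const N M v) auto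
qed

theorem theorem3p1:
  fixes A :: "('p::{second_countable_topology, t2_space}, 'm::finite) chart set"
    and \<C> :: "('p, 'm) metric set"
    and F K :: "('p, 'm) tset"
    and k :: "('p, 'm) vfield"
    and g :: "('p, 'm) metric"
    and n :: nat
  assumes "conformal_optical_geometry A \<C> F K"
    and "CARD('m) = n + 2" and "n > 2"
    and "geodesic_congruence A \<C> K"
    and "nonshearing_congruence A \<C> K"
    and "optical_vector_field A K k"
    and "g \<in> \<C>"
  shows "\<forall>\<phi>\<in>A. \<forall>x\<in>chart_range \<phi>. \<forall>a b c d.
    (let G = g \<phi>; \<kappa> = lower g k \<phi> in
      4 * alt22 (\<lambda>a b c d. \<Sum>e\<in>UNIV. \<Sum>f\<in>UNIV.
            \<kappa> x $ a * weyl G x b e f c * \<kappa> x $ d * k \<phi> x $ e * k \<phi> x $ f) a b c d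
      = (\<Sum>e\<in>UNIV. tau G \<kappa> x a b e * tau_up1 G \<kappa> x e c d)
        + 4 / real n * alt22 (\<lambda>a b c d. \<Sum>e\<in>UNIV. \<Sum>f\<in>UNIV.
            tau_up23 G \<kappa> x a e f * G x $ b $ c * tau G \<kappa> x d e f) a b c d)"
proof (intro ballI allI)
  fix \<phi> x a b c d
  assume \<phi>: "\<phi> \<in> A" "x \<in> chart_range \<phi>"
  note cog = assms(1,7,6)
  have A: "oriented_smooth_atlas A" using assms(1) by (simp add: conformal_optical_geometry_def)
  note smooth = smooth_on_lower[OF cog \<phi>(1)]
  have o: "open (chart_range \<phi>)" by (rule open_chart_range[OF A \<phi>(1)])
  have lor: "lorentzian (g \<phi> y)" if "y \<in> chart_range \<phi>" for y
    using conformal_metric[OF cog(1,2)] \<phi>(1) that unfolding lorentzian_metric_def by blast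
  let ?\<kappa> = "lower g k \<phi>"
  \<comment> \<open>Differentiability of g, k and \<kappa> is needed to choose the smaller
    neighbourhood, hence a first instance on the whole chart range.\<close>
  interpret O: optical_chart "chart_range \<phi>" "g \<phi>" "k \<phi>"
  proof
    show "transpose (g \<phi> y) = g \<phi> y" "invertible (g \<phi> y)" if "y \<in> chart_range \<phi>" for y
      using lor[OF that] lorentzian_symmetric lorentzian_invertible by blast+
    show "(g \<phi> y *v k \<phi> y) \<bullet> k \<phi> y = 0" if y: "y \<in> chart_range \<phi>" for y
    proof -
      have "k \<phi> y \<in> K \<phi> y" using optical_span[OF assms(1,6) \<phi>(1) y] by (simp add: span_base)
      moreover have "\<forall>v\<in>K \<phi> y. ip (g \<phi> y) v v = 0"
        using assms(1,7) \<phi>(1) y unfolding conformal_optical_geometry_def null_line_distribution_def by blast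
      ultimately show ?thesis by (simp add: ip_eq_inner inner_commute)
    qed
  qed (rule o smooth(1,2))+
  have \<kappa>: "O.\<kappa> = ?\<kappa>" by (rule ext) (simp add: O.\<kappa>_def lower_def)
  have \<kappa>0: "?\<kappa> y \<noteq> 0" if "y \<in> chart_range \<phi>" for y by (rule lower_nonzero[OF cog \<phi>(1) that])
  define h where "h y = (\<chi> a b. lie_metric (k \<phi>) (g \<phi>) y a b)" for y
  obtain \<rho> where \<rho>0: "\<And>\<psi> y v w. \<psi> \<in> A \<Longrightarrow> y \<in> chart_range \<psi> \<Longrightarrow> lower g k \<psi> y \<bullet> v = 0 \<Longrightarrow>
      lower g k \<psi> y \<bullet> w = 0 \<Longrightarrow>
      ip (\<chi> a b. lie_metric (k \<psi>) (g \<psi>) y a b) v w = \<rho> (chart_inv \<psi> y) * ip (g \<psi> y) v w"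
    by (rule nonshearing_pointwise[OF cog assms(5)]) (rule that, assumption)
  note \<rho> = \<rho>0[OF \<phi>(1), folded h_def]
  obtain e0 where e0: "?\<kappa> x \<bullet> e0 = 0" "ip (g \<phi> x) e0 e0 \<noteq> 0"
    by (rule exists_nonnull_perp[of "?\<kappa> x" "g \<phi> x"])
      (use \<kappa>0 O.sym_G O.inv_G \<phi>(2) assms(2,3) in auto)
  \<comment> \<open>Euclidean projection extends \<open>e0\<close> to nearby points while staying in
    the kernel of \<kappa>.\<close>
  define e where "e y = e0 - ((?\<kappa> y \<bullet> e0) / (?\<kappa> y \<bullet> ?\<kappa> y)) *\<^sub>R ?\<kappa> y" for y
  have e: "?\<kappa> y \<bullet> e y = 0" if "y \<in> chart_range \<phi>" for y
    using \<kappa>0[OF that] by (simp add: e_def inner_diff_right)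
  have ex: "e x = e0" using e0(1) by (simp add: e_def)
  note dk = O.differentiable_entries[unfolded \<kappa>]
  have dh: "(\<lambda>y. h y $ a $ b) differentiable (at y)" if y: "y \<in> chart_range \<phi>" for a b y
    unfolding h_def vec_lambda_beta lie_metric_def
    by (intro differentiable_sum' differentiable_add differentiable_mult dk
        O.differentiable_G O.differentiable_pd_G y)
  have dN: "(\<lambda>y. ?\<kappa> y \<bullet> v) differentiable (at y)" "(\<lambda>y. ?\<kappa> y \<bullet> ?\<kappa> y) differentiable (at y)"
    if y: "y \<in> chart_range \<phi>" for v y
    unfolding inner_vec_def inner_real_def by (intro differentiable_sum' differentiable_mult differentiable_const dk y)+
  have de: "(\<lambda>y. e y $ a) differentiable (at y)" if y: "y \<in> chart_range \<phi>" for a y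
    unfolding e_def vector_minus_component vector_scaleR_component real_scaleR_def
    by (intro differentiable_diff differentiable_mult differentiable_divide differentiable_const dN dk y)
      (use \<kappa>0[OF y] in simp)
  have dgee: "(\<lambda>y. ip (g \<phi> y) (e y) (e y)) differentiable (at y)" if y: "y \<in> chart_range \<phi>" for y
    by (intro differentiable_ip O.differentiable_G de y)
  \<comment> \<open>The neighbourhood of x on which the test field is non-null.\<close>
  define U where "U = chart_range \<phi> \<inter> (\<lambda>y. ip (g \<phi> y) (e y) (e y)) -` (- {0})"
  have "continuous_on (chart_range \<phi>) (\<lambda>y. ip (g \<phi> y) (e y) (e y))"
    by (intro continuous_at_imp_continuous_on ballI differentiable_imp_continuous_within dgee)
  then have "open U"
    unfolding U_def by (intro continuous_open_preimage o) auto
  have U: "y \<in> chart_range \<phi>" if "y \<in> U" for y using that by (simp add: U_def)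
  have xU: "x \<in> U" using \<phi>(2) e0(2) ex by (simp add: U_def)
  \<comment> \<open>On \<open>U\<close> this is \<rho> itself, now expressed by differentiable
    quantities.\<close>
  define r where "r y = ip (h y) (e y) (e y) / ip (g \<phi> y) (e y) (e y)" for y
  have r: "r y = \<rho> (chart_inv \<phi> y)" if "y \<in> U" for y
    using that \<rho>[OF U[OF that] e[OF U[OF that]] e[OF U[OF that]]] by (simp add: r_def U_def)
  \<comment> \<open>\<open>h - r g\<close> vanishes on the kernel of \<kappa>, so its cofactor is
    the one-form of the decomposition.\<close>
  define \<eta> where "\<eta> b y = perp_cofactor (h y - r y *\<^sub>R g \<phi> y) (?\<kappa> y) $ b" for b y
  define m where "m y = ((\<chi> a. lie_form (k \<phi>) ?\<kappa> y a) \<bullet> ?\<kappa> y) / (?\<kappa> y \<bullet> ?\<kappa> y)" for y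
  have dr: "r differentiable (at x)"
    unfolding r_def[abs_def]
    by (intro differentiable_divide dgee differentiable_ip dh de \<phi>(2)) (simp add: ex e0(2))
  interpret S: shearfree_chart U "g \<phi>" "k \<phi>" x m r \<eta>
  proof
    show "open U" by fact
    show "smooth_on U (g \<phi>)" "smooth_on U (k \<phi>)"
      using smooth(1,2) smooth_on_subset U by blast+
    show "transpose (g \<phi> y) = g \<phi> y" "invertible (g \<phi> y)" "(g \<phi> y *v k \<phi> y) \<bullet> k \<phi> y = 0"
      if "y \<in> U" for y
      using O.sym_G O.inv_G O.null_k U[OF that] by blast+
    show "x \<in> U" by (rule xU)
    show "r differentiable (at x)" by (rule dr)
    show "m differentiable (at x)"
      unfolding m_def[abs_def] inner_vec_def[of "vec_lambda _"] inner_real_def vec_lambda_beta lie_form_def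
      by (intro differentiable_divide differentiable_sum' differentiable_add differentiable_mult dN dk \<phi>(2))
        (use \<kappa>0[OF \<phi>(2)] in simp)
    show "\<eta> b differentiable (at x)" for b
      unfolding \<eta>_def[abs_def]
      by (intro differentiable_perp_cofactor dk \<kappa>0 \<phi>(2))
        (simp add: differentiable_diff differentiable_mult dr dh O.differentiable_G \<phi>(2))
    fix y a b
    assume y: "y \<in> U"
    let ?L = "\<chi> a. lie_form (k \<phi>) ?\<kappa> y a"
    have "?L \<bullet> v = 0" if "?\<kappa> y \<bullet> v = 0" for v
      using geodesic_pointwise[OF cog assms(4) \<phi>(1) U[OF y] that] by (simp add: inner_vec_def)
    then have "?L = m y *\<^sub>R ?\<kappa> y"
      unfolding m_def by (rule covector_vanishing_on_perp[OF \<kappa>0[OF U[OF y]]])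
    then have "?L $ a = (m y *\<^sub>R ?\<kappa> y) $ a" by simp
    then show "lie_form (k \<phi>) (\<lambda>y. g \<phi> y *v k \<phi> y) y a = m y * (g \<phi> y *v k \<phi> y) $ a"
      by (simp add: lower_def[abs_def])
    let ?T = "h y - r y *\<^sub>R g \<phi> y"
    have hs: "h y $ a $ b = h y $ b $ a" for a b
    proof -
      note y' = U[OF y]
      show ?thesis
        using O.pd_G_sym[OF y', of _ a b] O.G_sym[OF y', of a] O.G_sym[OF y', of _ b]
        by (simp add: h_def lie_metric_def sum.distrib)
    qed
    have "transpose ?T = ?T"
      using hs O.G_sym[OF U[OF y]] by (simp add: transpose_def vec_eq_iff)
    moreover have "ip ?T v w = 0" if "?\<kappa> y \<bullet> v = 0" "?\<kappa> y \<bullet> w = 0" for v w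
    proof -
      have "ip ?T v w = ip (h y) v w - r y * ip (g \<phi> y) v w"
        by (simp add: ip_eq_inner matrix_vector_mult_diff_rdistrib scaleR_matrix_vector_assoc[symmetric]
            inner_diff_right)
      then show ?thesis using \<rho>[OF U[OF y] that] r[OF y] by simp
    qed
    ultimately have "?T $ a $ b = ?\<kappa> y $ a * \<eta> b y + \<eta> a y * ?\<kappa> y $ b"
      unfolding \<eta>_def by (rule symmetric_form_vanishing_on_perp[OF \<kappa>0[OF U[OF y]]])
    then show "lie_metric (k \<phi>) (g \<phi>) y a b = r y * g \<phi> y $ a $ b
        + (g \<phi> y *v k \<phi> y) $ a * \<eta> b y + \<eta> a y * (g \<phi> y *v k \<phi> y) $ b"
      by (simp add: h_def lower_def algebra_simps)
  qed
  have \<kappa>S: "S.\<kappa> = ?\<kappa>" by (rule ext) (simp add: S.\<kappa>_def lower_def)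
  have "n > 0" using assms(3) by simp
  from S.weyl_identity[OF assms(2) this, unfolded \<kappa>S, OF \<kappa>0[OF \<phi>(2)]]
  show "let G = g \<phi>; \<kappa> = ?\<kappa> in
      4 * alt22 (\<lambda>a b c d. \<Sum>e\<in>UNIV. \<Sum>f\<in>UNIV.
            \<kappa> x $ a * weyl G x b e f c * \<kappa> x $ d * k \<phi> x $ e * k \<phi> x $ f) a b c d
      = (\<Sum>e\<in>UNIV. tau G \<kappa> x a b e * tau_up1 G \<kappa> x e c d)
        + 4 / real n * alt22 (\<lambda>a b c d. \<Sum>e\<in>UNIV. \<Sum>f\<in>UNIV.
            tau_up23 G \<kappa> x a e f * G x $ b $ c * tau G \<kappa> x d e f) a b c d"
    unfolding Let_def .
qed

end
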